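(* Let $n\ge 1$ and $\alpha\in\mathbb{R}^n$ with $\alpha_i>-\frac12$ for all $i$. 1. Let $p\in[1,+\infty)$ and $s,t\in\mathbb{R}$ with $s\le t$. Then $E_\alpha^{t,p}\subset E_\alpha^{s,p}$. Moreover $\|T\|_{E_\alpha^{s,p}}\le\|T\|_{E_\alpha^{t,p}}$ for all $T\in E_\alpha^{t,p}$, so that the embedding $E_\alpha^{t,p}\hookrightarrow E_\alpha^{s,p}$ is continuous. 2. Let $(s,p)\in\mathbb{R}\times[1,+\infty)$. Then $(-\Delta_\alpha)^k(E_\alpha^{s,p})\subset E_\alpha^{s-k,p}$ for all $k\in\mathbb{N}$. Moreover, the operator $(-\Delta_\alpha)^k:E_\alpha^{s,p}\to E_\alpha^{s-k,p}$ is continuous and $\|(-\Delta_\alpha)^k(T)\|_{E_\alpha^{s-k,p}}\le\|T\|_{E_\alpha^{s,p}}$ for all $T\in E_\alpha^{s,p}$.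
   Context: Fix $n\ge1$ and $\alpha=(\alpha_1,\dots,\alpha_n)\in\mathbb{R}^n$ with $\alpha_i>-\frac12$; $|\alpha|=\alpha_1+\dots+\alpha_n$, $\|x\|$ is the Euclidean norm, $\mathbb{N}=\{0,1,2,\dots\}$. $\mathbb{R}^n_+=\{x\in\mathbb{R}^n: x_1>0,\dots,x_n>0\}$, $d\mu_\alpha(x)=\prod_{i=1}^n x_i^{2\alpha_i+1}dx_i$, and $L^p_\alpha(\mathbb{R}^n_+)=L^p(\mathbb{R}^n_+,d\mu_\alpha)$ (complex-valued functions). A function on $\mathbb{R}^n$ is called even if it is even in each variable. $\mathcal{S}_e(\mathbb{R}^n)$ is the space of even Schwartz functions with its usual Fréchet topology, and $\mathcal{S}'_e(\mathbb{R}^n)$ is its topological dual (even tempered distributions). A function $\psi\in L^p_\alpha(\mathbb{R}^n_+)$ is identified with the element of $\mathcal{S}'_e(\mathbb{R}^n)$ given by $\langle\psi,f\rangle=\int_{\mathbb{R}^n_+}\psi f\,d\mu_\alpha$. An even smooth function $h$ all of whose derivatives grow at most polynomially acts on $\mathcal{S}'_e(\mathbb{R}^n)$ by $\langle hT,\varphi\rangle=\langle T,h\varphi\rangle$. The Poly-axially operator is $\Delta_\alpha=\sum_{i=1}^n\left(\frac{\partial^2}{\partial x_i^2}+\frac{2\alpha_i+1}{x_i}\frac{\partial}{\partial x_i}\right)$; it acts on $\mathcal{S}_e(\mathbb{R}^n)$ and, by duality, on $\mathcal{S}'_e(\mathbb{R}^n)$: $\langle\Delta_\alpha T,\varphi\rangle=\langle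 T,\Delta_\alpha\varphi\rangle$. For $\gamma>-\frac12$, $j_\gamma(t)=\Gamma(\gamma+1)\sum_{k\ge0}\frac{(-1)^k}{k!\,\Gamma(k+\gamma+1)}\left(\frac t2\right)^{2k}$ is the normalized Bessel function. The Fourier-Bessel transform is $\mathcal{F}_\alpha f(\lambda)=\int_{\mathbb{R}^n_+}f(x)\prod_{i=1}^n j_{\alpha_i}(\lambda_ix_i)\,d\mu_\alpha(x)$; it is a topological isomorphism of $\mathcal{S}_e(\mathbb{R}^n)$ with inverse $c_\alpha^2\mathcal{F}_\alpha$, where $c_\alpha=\frac{2^{-|\alpha|}}{\prod_{i=1}^n\Gamma(\alpha_i+1)}$. It is extended to $\mathcal{S}'_e(\mathbb{R}^n)$ by $\langle\mathcal{F}_\alpha(T),\varphi\rangle=\langle T,\mathcal{F}_\alpha(\varphi)\rangle$. For $s\in\mathbb{R}$, $p\in[1,+\infty)$: $E_\alpha^{s,p}=E_\alpha^{s,p}(\mathbb{R}^n_+)=\{T\in\mathcal{S}'_e(\mathbb{R}^n): (1+\|\xi\|^2)^s\mathcal{F}_\alpha(T)\in L^p_\alpha(\mathbb{R}^n_+)\}$, with norm $\|T\|_{E_\alpha^{s,p}}=c_\alpha\|(1+\|\xi\|^2)^s\mathcal{F}_\alpha(T)\|_{L^p_\alpha}$. *)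

theory Defs
  imports "HOL-Analysis.Analysis"
begin

text \<open>The topology on a set \<open>V\<close> of complex-valued functions (closed under subtraction) given by a
  family \<open>P\<close> of seminorms: the neighbourhoods of \<open>x\<close> are the sets containing a ball around \<open>x\<close> for
  finitely many of the seminorms. Used with a countable family for the Schwartz space, and with a
  single norm for the spaces \<open>E\<close>.\<close>

definition seminorm_topology ::
    "('a \<Rightarrow> complex) set \<Rightarrow> (('a \<Rightarrow> complex) \<Rightarrow> real) set \<Rightarrow> ('a \<Rightarrow> complex) topology" where
  "seminorm_topology V P = topology (\<lambda>W. W \<subseteq> V \<and>
     (\<forall>x\<in>W. \<exists>F r. finite F \<and> F \<subseteq> P \<and> 0 < r \<and> {y \<in> V. \<forall>q\<in>F. q (y - x) < r} \<subseteq> W))"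

lemma openin_seminorm_topology:
  "openin (seminorm_topology V P) W \<longleftrightarrow> W \<subseteq> V \<and>
     (\<forall>x\<in>W. \<exists>F r. finite F \<and> F \<subseteq> P \<and> 0 < r \<and> {y \<in> V. \<forall>q\<in>F. q (y - x) < r} \<subseteq> W)"
proof -
  define nb where "nb W x \<longleftrightarrow>
      (\<exists>F r. finite F \<and> F \<subseteq> P \<and> 0 < (r::real) \<and> {y \<in> V. \<forall>q\<in>F. q (y - x) < r} \<subseteq> W)" for W x
  have mono: "nb W' x" if 1: "nb W x" and 2: "W \<subseteq> W'" for W W' x
  proof -
    obtain F r where F: "finite F" "F \<subseteq> P" "0 < r" "{y \<in> V. \<forall>q\<in>F. q (y - x) < r} \<subseteq> W"
      using 1 unfolding nb_def by (elim exE conjE)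
    have "{y \<in> V. \<forall>q\<in>F. q (y - x) < r} \<subseteq> W'"
      using F(4) 2 by (rule subset_trans)
    with F(1-3) show ?thesis
      unfolding nb_def by (intro exI conjI)
  qed
  have int: "nb (A \<inter> B) x" if 1: "nb A x" and 2: "nb B x" for A B x
  proof -
    obtain F r where F: "finite F" "F \<subseteq> P" "0 < r" "{y \<in> V. \<forall>q\<in>F. q (y - x) < r} \<subseteq> A"
      using 1 unfolding nb_def by (elim exE conjE)
    obtain G r' where G: "finite G" "G \<subseteq> P" "0 < r'" "{y \<in> V. \<forall>q\<in>G. q (y - x) < r'} \<subseteq> B"
      using 2 unfolding nb_def by (elim exE conjE)
    have "{y \<in> V. \<forall>q\<in>F \<union> G. q (y - x) < min r r'} \<subseteq> {y \<in> V. \<forall>q\<in>F. q (y - x) < r}"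
      and "{y \<in> V. \<forall>q\<in>F \<union> G. q (y - x) < min r r'} \<subseteq> {y \<in> V. \<forall>q\<in>G. q (y - x) < r'}"
      by simp_all (simp_all add: subset_iff)
    then have "{y \<in> V. \<forall>q\<in>F \<union> G. q (y - x) < min r r'} \<subseteq> A \<inter> B"
      using F(4) G(4) by (meson le_infI subset_trans)
    moreover have "finite (F \<union> G)" "F \<union> G \<subseteq> P" "0 < min r r'"
      using F G by simp_all
    ultimately show ?thesis
      unfolding nb_def by (intro exI conjI)
  qed
  have "istopology (\<lambda>W. W \<subseteq> V \<and> (\<forall>x\<in>W. nb W x))"
    unfolding istopology_def
  proof (intro conjI allI impI)
    fix A B assume "A \<subseteq> V \<and> (\<forall>x\<in>A. nb A x)" "B \<subseteq> V \<and> (\<forall>x\<in>B. nb B x)"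
    then show "A \<inter> B \<subseteq> V" "\<forall>x\<in>A \<inter> B. nb (A \<inter> B) x"
      using int by blast+
  next
    fix K assume K: "\<forall>W\<in>K. W \<subseteq> V \<and> (\<forall>x\<in>W. nb W x)"
    show "\<Union>K \<subseteq> V" using K by blast
    show "\<forall>x\<in>\<Union>K. nb (\<Union>K) x"
      using K mono by (meson UnionE Union_upper)
  qed
  then show ?thesis
    unfolding seminorm_topology_def nb_def[symmetric] by (simp only: topology_inverse')
qed

lemma topspace_seminorm_topology [simp]: "topspace (seminorm_topology V P) = V"
proof
  show "topspace (seminorm_topology V P) \<subseteq> V"
    by (metis openin_seminorm_topology openin_topspace)
  have "openin (seminorm_topology V P) V"
    unfolding openin_seminorm_topology
    by (intro conjI ballI exI[of _ "{}"] exI[of _ "1::real"]) auto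
  then show "V \<subseteq> topspace (seminorm_topology V P)"
    by (rule openin_subset)
qed

definition partial_deriv :: "'n::finite \<Rightarrow> (real^'n \<Rightarrow> complex) \<Rightarrow> real^'n \<Rightarrow> complex" where
  "partial_deriv i f x = frechet_derivative f (at x) (axis i 1)"

definition partials :: "'n::finite list \<Rightarrow> (real^'n \<Rightarrow> complex) \<Rightarrow> real^'n \<Rightarrow> complex" where
  "partials is f = foldr partial_deriv is f"

definition smooth_fun :: "(real^'n::finite \<Rightarrow> complex) \<Rightarrow> bool" where
  "smooth_fun f \<longleftrightarrow> (\<forall>is x. partials is f differentiable (at x))"

definition even_fun :: "(real^'n::finite \<Rightarrow> complex) \<Rightarrow> bool" where
  "even_fun f \<longleftrightarrow> (\<forall>i x. f (\<chi> j. if j = i then - (x $ j) else x $ j) = f x)"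

definition schwartz_even :: "(real^'n::finite \<Rightarrow> complex) set" where
  "schwartz_even = {f. smooth_fun f \<and> even_fun f \<and>
     (\<forall>m is. bounded (range (\<lambda>x. (1 + (norm x)\<^sup>2) ^ m *\<^sub>R partials is f x)))}"

definition schwartz_seminorm :: "nat \<Rightarrow> 'n::finite list \<Rightarrow> (real^'n \<Rightarrow> complex) \<Rightarrow> real" where
  "schwartz_seminorm m is f = (SUP x. (1 + (norm x)\<^sup>2) ^ m * norm (partials is f x))"

definition schwartz_topology :: "(real^'n::finite \<Rightarrow> complex) topology" where
  "schwartz_topology =
     seminorm_topology schwartz_even (range (\<lambda>(m, is). schwartz_seminorm m is))"

text \<open>Functionals on \<open>schwartz_even\<close> are total functions normalised to be \<open>0\<close> off
  \<open>schwartz_even\<close>, so that equality of functionals is equality in HOL.\<close>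

type_synonym 'n functional = "(real^'n \<Rightarrow> complex) \<Rightarrow> complex"

definition tempered_even :: "'n::finite functional set" where
  "tempered_even = {T.
     (\<forall>f\<in>schwartz_even. \<forall>g\<in>schwartz_even. T (\<lambda>x. f x + g x) = T f + T g) \<and>
     (\<forall>c. \<forall>f\<in>schwartz_even. T (\<lambda>x. c * f x) = c * T f) \<and>
     continuous_map schwartz_topology euclidean T \<and>
     (\<forall>f. f \<notin> schwartz_even \<longrightarrow> T f = 0)}"

definition dual_op ::
    "((real^'n::finite \<Rightarrow> complex) \<Rightarrow> (real^'n \<Rightarrow> complex)) \<Rightarrow> 'n functional \<Rightarrow> 'n functional" where
  "dual_op A T = (\<lambda>\<phi>. if \<phi> \<in> schwartz_even then T (A \<phi>) else 0)"

definition mult_dist :: "(real^'n::finite \<Rightarrow> complex) \<Rightarrow> 'n functional \<Rightarrow> 'n functional" where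
  "mult_dist h = dual_op (\<lambda>\<phi> x. h x * \<phi> x)"

definition pos_orthant :: "(real^'n::finite) set" where
  "pos_orthant = {x. \<forall>i. 0 < x $ i}"

definition mu :: "real^'n::finite \<Rightarrow> (real^'n) measure" where
  "mu \<alpha> = density (restrict_space lborel pos_orthant)
            (\<lambda>x. ennreal (\<Prod>i\<in>UNIV. x $ i powr (2 * \<alpha> $ i + 1)))"

definition Lp :: "real^'n::finite \<Rightarrow> real \<Rightarrow> (real^'n \<Rightarrow> complex) set" where
  "Lp \<alpha> p = {\<psi>. \<psi> \<in> borel_measurable (mu \<alpha>) \<and> integrable (mu \<alpha>) (\<lambda>x. norm (\<psi> x) powr p)}"

definition Lp_norm :: "real^'n::finite \<Rightarrow> real \<Rightarrow> (real^'n \<Rightarrow> complex) \<Rightarrow> real" where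
  "Lp_norm \<alpha> p \<psi> = (\<integral>x. norm (\<psi> x) powr p \<partial>mu \<alpha>) powr (1 / p)"

definition dist_of_fun :: "real^'n::finite \<Rightarrow> (real^'n \<Rightarrow> complex) \<Rightarrow> 'n functional" where
  "dist_of_fun \<alpha> \<psi> =
     (\<lambda>\<phi>. if \<phi> \<in> schwartz_even then (\<integral>x. \<psi> x * \<phi> x \<partial>mu \<alpha>) else 0)"

definition dist_in_Lp :: "real^'n::finite \<Rightarrow> real \<Rightarrow> 'n functional \<Rightarrow> bool" where
  "dist_in_Lp \<alpha> p T \<longleftrightarrow> (\<exists>\<psi>\<in>Lp \<alpha> p. dist_of_fun \<alpha> \<psi> = T)"

text \<open>The function representing \<open>T\<close> is unique up to null sets, so its norm does not depend on the
  choice.\<close>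

definition dist_Lp_norm :: "real^'n::finite \<Rightarrow> real \<Rightarrow> 'n functional \<Rightarrow> real" where
  "dist_Lp_norm \<alpha> p T = Lp_norm \<alpha> p (SOME \<psi>. \<psi> \<in> Lp \<alpha> p \<and> dist_of_fun \<alpha> \<psi> = T)"

text \<open>On the hyperplane \<open>x\<^sub>i = 0\<close> the quotient \<open>\<partial>\<^sub>i f / x\<^sub>i\<close> is read as its continuous extension: for
  \<open>f\<close> smooth and even the limit is \<open>\<partial>\<^sub>i\<^sup>2 f\<close>. (HOL division by zero would give the wrong value
  \<open>0\<close>.)\<close>

definition laplace :: "real^'n::finite \<Rightarrow> (real^'n \<Rightarrow> complex) \<Rightarrow> real^'n \<Rightarrow> complex" where
  "laplace \<alpha> f x = (\<Sum>i\<in>UNIV. partial_deriv i (partial_deriv i f) x +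
     of_real (2 * \<alpha> $ i + 1) *
       (if x $ i = 0 then partial_deriv i (partial_deriv i f) x
        else partial_deriv i f x / of_real (x $ i)))"

definition laplace_dist :: "real^'n::finite \<Rightarrow> 'n functional \<Rightarrow> 'n functional" where
  "laplace_dist \<alpha> = dual_op (laplace \<alpha>)"

definition neg_laplace_pow :: "real^'n::finite \<Rightarrow> nat \<Rightarrow> 'n functional \<Rightarrow> 'n functional" where
  "neg_laplace_pow \<alpha> k = (\<lambda>T. - laplace_dist \<alpha> T) ^^ k"

definition bessel_j :: "real \<Rightarrow> real \<Rightarrow> real" where
  "bessel_j \<gamma> t = Gamma (\<gamma> + 1) *
     (\<Sum>k. (-1) ^ k / (fact k * Gamma (real k + \<gamma> + 1)) * (t / 2) ^ (2 * k))"

definition fourier_bessel :: "real^'n::finite \<Rightarrow> (real^'n \<Rightarrow> complex) \<Rightarrow> real^'n \<Rightarrow> complex" where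
  "fourier_bessel \<alpha> f \<xi> =
     (\<integral>x. f x * of_real (\<Prod>i\<in>UNIV. bessel_j (\<alpha> $ i) (\<xi> $ i * x $ i)) \<partial>mu \<alpha>)"

definition fourier_bessel_dist :: "real^'n::finite \<Rightarrow> 'n functional \<Rightarrow> 'n functional" where
  "fourier_bessel_dist \<alpha> = dual_op (fourier_bessel \<alpha>)"

definition c_const :: "real^'n::finite \<Rightarrow> real" where
  "c_const \<alpha> = 2 powr (- (\<Sum>i\<in>UNIV. \<alpha> $ i)) / (\<Prod>i\<in>UNIV. Gamma (\<alpha> $ i + 1))"

definition weighted_transform ::
    "real^'n::finite \<Rightarrow> real \<Rightarrow> 'n functional \<Rightarrow> 'n functional" where
  "weighted_transform \<alpha> s T =
     mult_dist (\<lambda>\<xi>. of_real ((1 + (norm \<xi>)\<^sup>2) powr s)) (fourier_bessel_dist \<alpha> T)"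

definition E_space :: "real^'n::finite \<Rightarrow> real \<Rightarrow> real \<Rightarrow> 'n functional set" where
  "E_space \<alpha> s p = {T \<in> tempered_even. dist_in_Lp \<alpha> p (weighted_transform \<alpha> s T)}"

definition E_norm :: "real^'n::finite \<Rightarrow> real \<Rightarrow> real \<Rightarrow> 'n functional \<Rightarrow> real" where
  "E_norm \<alpha> s p T = c_const \<alpha> * dist_Lp_norm \<alpha> p (weighted_transform \<alpha> s T)"

definition E_topology :: "real^'n::finite \<Rightarrow> real \<Rightarrow> real \<Rightarrow> 'n functional topology" where
  "E_topology \<alpha> s p = seminorm_topology (E_space \<alpha> s p) {E_norm \<alpha> s p}"

end

theory Submission
  imports Defs
begin

text \<open>
  The transform side is a multiplier problem: if \<open>\<psi>\<close> represents \<open>(1 + |\<xi>|\<^sup>2)\<^sup>t F(T)\<close>, then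
  \<open>(1 + |\<xi>|\<^sup>2)\<^bsup>s-t\<^esup> \<psi>\<close> represents \<open>(1 + |\<xi>|\<^sup>2)\<^sup>s F(T)\<close>, and \<open>|\<xi>|\<^sup>2 / (1 + |\<xi>|\<^sup>2) \<psi>\<close> represents
  \<open>(1 + |\<xi>|\<^sup>2)\<^bsup>t-1\<^esup> F(- \<Delta> T)\<close>; both multipliers take values in \<open>[0, 1]\<close>. By duality the second claim is
  \<open>\<Delta> F \<phi> = - F(|x|\<^sup>2 \<phi>)\<close> for even Schwartz functions, which is Bessel's equation under the integral.

  Since distributions are functionals on even Schwartz functions, \<open>\<Delta>\<close> must act continuously there,
  and \<open>F\<close> must map these functions to themselves. Smoothness of \<open>F \<phi>\<close> with bounded derivatives follows from the
  boundedness of all derivatives of \<open>j\<^sub>\<gamma>\<close>, and decay from \<open>(1 + |\<xi>|\<^sup>2) F \<phi> = F(\<phi> - \<Delta> \<phi>)\<close>, an integration by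
  parts.

  The norm is well defined because an \<open>L\<^sup>p\<close> function is determined almost everywhere by its pairings
  with Schwartz functions: the functions \<open>exp (- |x|\<^sup>2 - \<Sum>\<^sub>i (x\<^sub>i / b\<^sub>i)\<^bsup>2k\<^esup> / k)\<close> converge on the orthant to a Gaussian cut
  off to the box \<open>x \<le> b\<close>.
\<close>

text \<open>Growth is measured in real powers of \<open>jap x\<close>, and an even Schwartz function
  is an even symbol of every order; decay, multiplication by weights and differentiation then become
  closure properties of sets of functions. The condition \<alpha>_i > -1/2 matters most in two
  places. Since 2 \<alpha>_i + 1 is nonnegative, the first-order term of Bessel's equation acts as
  damping, which bounds j and j'. Since it is positive, the density of the measure vanishes on the
  walls of the orthant; multiplied by a Wronskian that vanishes there too, it extends by zero to a
  function on the whole space that is differentiable along coordinate lines. Integration by parts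
  then becomes translation invariance of Lebesgue measure, with no boundary terms. The main obstacle
  on the Schwartz side is the singular quotient in \<open>laplace\<close>. For \<open>T\<close>
  composed with \<open>laplace\<close> to be continuous, each seminorm of the image must be bounded
  by finitely many seminorms of f with a constant uniform in f; smoothness and decay of each single
  image would not be enough.\<close>

abbreviation jap :: "'a::real_normed_vector \<Rightarrow> real" where
  "jap x \<equiv> 1 + (norm x)\<^sup>2"

lemma jap_pos [simp]: "0 < jap x" "jap x \<noteq> 0" "0 \<le> jap x" "1 \<le> jap x"
proof -
  show "1 \<le> jap x" by simp
  then show "0 < jap x" "0 \<le> jap x" "jap x \<noteq> 0" by linarith+
qed

subsection \<open>Iterated partial derivatives\<close>

lemma vec_eq_sum_axis: "h = (\<Sum>i\<in>UNIV. (h $ i) *\<^sub>R axis i (1::real))"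
  for h :: "real^'n::finite"
  by (simp add: vec_eq_iff axis_def if_distrib cong: if_cong)

text \<open>This sum over coordinates is the normal form in which derivatives are stated below, so
  that \<open>partial_deriv_eq_sumI\<close> can read off the partial derivatives.\<close>

lemma has_derivative_partials:
  fixes f :: "real^'n::finite \<Rightarrow> complex"
  assumes "f differentiable (at x)"
  shows "(f has_derivative (\<lambda>h. \<Sum>i\<in>UNIV. (h $ i) *\<^sub>R partial_deriv i f x)) (at x)"
proof -
  let ?D = "frechet_derivative f (at x)"
  have d: "(f has_derivative ?D) (at x)"
    using assms by (simp add: frechet_derivative_works)
  have lin: "linear ?D"
    using d by (rule has_derivative_linear)
  have "?D h = (\<Sum>i\<in>UNIV. (h $ i) *\<^sub>R partial_deriv i f x)" for h
  proof -
    have "?D h = ?D (\<Sum>i\<in>UNIV. (h $ i) *\<^sub>R axis i 1)"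
      using vec_eq_sum_axis[of h] by simp
    then show ?thesis
      by (simp add: linear_sum[OF lin] linear_cmul[OF lin] partial_deriv_def)
  qed
  then have "?D = (\<lambda>h. \<Sum>i\<in>UNIV. (h $ i) *\<^sub>R partial_deriv i f x)" by blast
  with d show ?thesis by simp
qed

lemma partial_deriv_eqI:
  assumes "(f has_derivative D) (at x)"
  shows "partial_deriv i f x = D (axis i 1)"
  using frechet_derivative_at[OF assms] by (simp add: partial_deriv_def)

lemma sum_axis_scaleR [simp]:
  "(\<Sum>j\<in>UNIV. (axis i (1::real) $ j) *\<^sub>R d j) = d i" for d :: "'n::finite \<Rightarrow> 'b::real_vector"
proof -
  have "(\<Sum>j\<in>UNIV. (axis i (1::real) $ j) *\<^sub>R d j) = (\<Sum>j\<in>UNIV. if j = i then d j else 0)"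
    by (rule sum.cong) (auto simp: axis_def)
  then show ?thesis by simp
qed

lemma partial_deriv_eq_sumI:
  assumes "(f has_derivative (\<lambda>h. \<Sum>i\<in>UNIV. (h $ i) *\<^sub>R d i)) (at x)"
  shows "partial_deriv i f x = d i"
  using partial_deriv_eqI[OF assms] by simp

lemma has_vector_derivative_line:
  fixes f :: "real^'n::finite \<Rightarrow> complex"
  assumes "f differentiable (at (x + t *\<^sub>R axis i 1))"
  shows "((\<lambda>t. f (x + t *\<^sub>R axis i 1)) has_vector_derivative
           partial_deriv i f (x + t *\<^sub>R axis i 1)) (at t)"
proof -
  have "((\<lambda>t. x + t *\<^sub>R axis i (1::real)) has_derivative (\<lambda>s. s *\<^sub>R axis i 1)) (at t)"
    by (auto intro!: derivative_eq_intros)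
  from has_derivative_compose[OF this has_derivative_partials[OF assms]]
  have "((\<lambda>t. f (x + t *\<^sub>R axis i 1)) has_derivative
    (\<lambda>s. \<Sum>j\<in>UNIV. ((s *\<^sub>R axis i (1::real)) $ j) *\<^sub>R partial_deriv j f (x + t *\<^sub>R axis i 1))) (at t)" .
  moreover have "(\<Sum>j\<in>UNIV. ((s *\<^sub>R axis i (1::real)) $ j) *\<^sub>R partial_deriv j f (x + t *\<^sub>R axis i 1))
     = s *\<^sub>R partial_deriv i f (x + t *\<^sub>R axis i 1)" for s
  proof -
    have "(\<Sum>j\<in>UNIV. ((s *\<^sub>R axis i (1::real)) $ j) *\<^sub>R partial_deriv j f (x + t *\<^sub>R axis i 1))
      = s *\<^sub>R (\<Sum>j\<in>UNIV. (axis i (1::real) $ j) *\<^sub>R partial_deriv j f (x + t *\<^sub>R axis i 1))"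
      unfolding scaleR_sum_right by (rule sum.cong) auto
    then show ?thesis by simp
  qed
  ultimately show ?thesis
    by (simp add: has_vector_derivative_def)
qed

lemma partials_Nil [simp]: "partials [] f = f"
  and partials_Cons [simp]: "partials (i # is) f = partial_deriv i (partials is f)"
  and partials_append: "partials (is @ js) f = partials is (partials js f)"
  by (simp_all add: partials_def)

lemma smooth_fun_differentiable: "smooth_fun f \<Longrightarrow> f differentiable (at x)"
  unfolding smooth_fun_def by (metis partials_Nil)

lemma smooth_fun_partials: "smooth_fun f \<Longrightarrow> smooth_fun (partials is f)"
  unfolding smooth_fun_def by (metis partials_append)

lemma smooth_fun_partial_deriv: "smooth_fun f \<Longrightarrow> smooth_fun (partial_deriv i f)"
  using smooth_fun_partials[of f "[i]"] by simp

lemma smooth_fun_continuous: "smooth_fun f \<Longrightarrow> continuous_on UNIV f"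
  by (meson differentiable_at_withinI differentiable_imp_continuous_on differentiable_on_def
      smooth_fun_differentiable)

lemma smooth_fun_measurable: "smooth_fun f \<Longrightarrow> f \<in> borel_measurable borel"
  by (rule borel_measurable_continuous_onI[OF smooth_fun_continuous])

lemma partial_deriv_add:
  assumes "f differentiable (at x)" "g differentiable (at x)"
  shows "partial_deriv i (\<lambda>x. f x + g x) x = partial_deriv i f x + partial_deriv i g x"
  by (rule partial_deriv_eqI[OF has_derivative_add[OF has_derivative_partials[OF assms(1)]
    has_derivative_partials[OF assms(2)]], THEN trans]) simp

lemma partial_deriv_diff:
  assumes "f differentiable (at x)" "g differentiable (at x)"
  shows "partial_deriv i (\<lambda>x. f x - g x) x = partial_deriv i f x - partial_deriv i g x"
  by (rule partial_deriv_eqI[OF has_derivative_diff[OF has_derivative_partials[OF assms(1)]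
    has_derivative_partials[OF assms(2)]], THEN trans]) simp

lemma partial_deriv_mult:
  assumes "f differentiable (at x)" "g differentiable (at x)"
  shows "partial_deriv i (\<lambda>x. f x * g x) x = partial_deriv i f x * g x + f x * partial_deriv i g x"
  by (rule partial_deriv_eqI[OF has_derivative_mult[OF has_derivative_partials[OF assms(1)]
    has_derivative_partials[OF assms(2)]], THEN trans]) simp

lemma partial_deriv_const [simp]: "partial_deriv i (\<lambda>x. c) = (\<lambda>x. 0)"
  by (rule ext, rule partial_deriv_eqI[OF has_derivative_const])

lemma partials_add:
  assumes "smooth_fun f" "smooth_fun g"
  shows "partials is (\<lambda>x. f x + g x) = (\<lambda>x. partials is f x + partials is g x)"
proof (induction "is")
  case (Cons i "is")
  show ?case
    using assms by (auto simp: Cons smooth_fun_def intro!: ext partial_deriv_add)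
qed auto

lemma partials_cmult:
  assumes "smooth_fun f"
  shows "partials is (\<lambda>x. c * f x) = (\<lambda>x. c * partials is f x)"
proof (induction "is")
  case (Cons i "is")
  have "partial_deriv i (\<lambda>x. c * partials is f x) x = c * partial_deriv i (partials is f) x" for x
    using partial_deriv_mult[of "\<lambda>_. c" x "partials is f" i] assms by (simp add: smooth_fun_def)
  with Cons show ?case by auto
qed auto

subsection \<open>Symbol classes\<close>

text \<open>\<open>jap x\<close> is the square of the Japanese bracket, so a coordinate has order
  1/2. All derivatives are asked to have the same order \<open>K\<close>, with no gain per
  derivative; the class is therefore stable under \<open>partial_deriv\<close> without
  bookkeeping.\<close>

definition symbols :: "real \<Rightarrow> (real^'n::finite \<Rightarrow> complex) set" where
  "symbols K = {f. smooth_fun f \<and> (\<forall>is. \<exists>C. \<forall>x. norm (partials is f x) \<le> C * jap x powr K)}"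

lemma symbols_smooth: "f \<in> symbols K \<Longrightarrow> smooth_fun f"
  by (simp add: symbols_def)

lemma symbols_differentiable: "f \<in> symbols K \<Longrightarrow> f differentiable (at x)"
  by (simp add: symbols_smooth smooth_fun_differentiable)

lemma symbols_partials: "f \<in> symbols K \<Longrightarrow> partials is f \<in> symbols K"
  unfolding symbols_def by (auto intro: smooth_fun_partials simp: partials_append[symmetric])

lemma symbols_partial_deriv: "f \<in> symbols K \<Longrightarrow> partial_deriv i f \<in> symbols K"
  using symbols_partials[of f K "[i]"] by simp

lemma symbols_bound:
  assumes "f \<in> symbols K"
  obtains C where "0 \<le> C" "\<And>x. norm (f x) \<le> C * jap x powr K"
proof -
  obtain C where C: "\<And>x. norm (partials [] f x) \<le> C * jap x powr K"
    using assms unfolding symbols_def by blast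
  have "0 \<le> C * jap (0::real^'a) powr K"
    using C[of 0] norm_ge_zero order_trans by blast
  then have "0 \<le> C" by simp
  with C show ?thesis using that by simp
qed

lemma symbols_mono:
  assumes "f \<in> symbols K" "K \<le> L"
  shows "f \<in> symbols L"
proof -
  have "\<exists>C. \<forall>x. norm (partials is f x) \<le> C * jap x powr L" for "is"
  proof -
    obtain C where C: "0 \<le> C" "\<And>x. norm (partials is f x) \<le> C * jap x powr K"
      using symbols_bound[OF symbols_partials[OF assms(1)]] by blast
    have "C * jap x powr K \<le> C * jap x powr L" for x :: "real^'a"
      using C(1) assms(2) by (intro mult_left_mono powr_mono) auto
    then show ?thesis using C(2) order_trans by blast
  qed
  then show ?thesis using assms(1) by (simp add: symbols_def)
qed

text \<open>A set closed under single partial derivatives contains all iterated ones, by induction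
  on the list of directions. Bounds on the members themselves then suffice, which replaces explicit
  formulas for higher derivatives.\<close>

lemma symbols_coinduct:
  assumes f: "f \<in> A"
    and diff: "\<And>f x. f \<in> A \<Longrightarrow> f differentiable (at x)"
    and bound: "\<And>f. f \<in> A \<Longrightarrow> \<exists>C. \<forall>x. norm (f x) \<le> C * jap x powr K"
    and deriv: "\<And>f i. f \<in> A \<Longrightarrow> partial_deriv i f \<in> A"
  shows "f \<in> symbols K"
proof -
  have "partials is f \<in> A" for "is"
    by (induction "is") (auto simp: f deriv)
  then show ?thesis
    unfolding symbols_def smooth_fun_def using diff bound by blast
qed

lemma symbols_add:
  assumes "f \<in> symbols K" "g \<in> symbols K"
  shows "(\<lambda>x. f x + g x) \<in> symbols K"
proof (rule symbols_coinduct[of _ "{(\<lambda>x. f x + g x) | f g. f \<in> symbols K \<and> g \<in> symbols K}"])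
  fix h :: "real^'a \<Rightarrow> complex" assume "h \<in> {(\<lambda>x. f x + g x) | f g. f \<in> symbols K \<and> g \<in> symbols K}"
  then obtain f g where h: "h = (\<lambda>x. f x + g x)" "f \<in> symbols K" "g \<in> symbols K" by blast
  show "h differentiable (at x)" for x
    unfolding h(1) by (intro differentiable_add symbols_differentiable[OF h(2)] symbols_differentiable[OF h(3)])
  obtain C where C: "\<And>x. norm (f x) \<le> C * jap x powr K" using symbols_bound[OF h(2)] by blast
  obtain D where D: "\<And>x. norm (g x) \<le> D * jap x powr K" using symbols_bound[OF h(3)] by blast
  have "norm (h x) \<le> (C + D) * jap x powr K" for x
    unfolding h(1) using norm_triangle_le[of "f x" "g x"] C[of x] D[of x] by (simp add: distrib_right)
  then show "\<exists>C. \<forall>x. norm (h x) \<le> C * jap x powr K" by blast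
  show "partial_deriv i h \<in> {(\<lambda>x. f x + g x) | f g. f \<in> symbols K \<and> g \<in> symbols K}" for i
  proof -
    have "partial_deriv i h = (\<lambda>x. partial_deriv i f x + partial_deriv i g x)"
      unfolding h(1) by (intro ext partial_deriv_add symbols_differentiable[OF h(2)] symbols_differentiable[OF h(3)])
    then show ?thesis using symbols_partial_deriv h(2,3) by blast
  qed
qed (use assms in blast)

text \<open>The derivative of a product is a sum of two products, so the products alone are not a
  closed set for \<open>symbols_coinduct\<close>; their finite sums are.\<close>

inductive_set prod_sums :: "real \<Rightarrow> real \<Rightarrow> (real^'n::finite \<Rightarrow> complex) set" for K L where
  prod: "f \<in> symbols K \<Longrightarrow> g \<in> symbols L \<Longrightarrow> (\<lambda>x. f x * g x) \<in> prod_sums K L"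
| add: "u \<in> prod_sums K L \<Longrightarrow> v \<in> prod_sums K L \<Longrightarrow> (\<lambda>x. u x + v x) \<in> prod_sums K L"

lemma prod_sums_props:
  assumes "u \<in> prod_sums K L"
  shows "(\<forall>x. u differentiable (at x)) \<and> (\<exists>C. \<forall>x. norm (u x) \<le> C * jap x powr (K + L)) \<and>
         (\<forall>i. partial_deriv i u \<in> prod_sums K L)"
  using assms
proof induction
  case (prod f g)
  note d = symbols_differentiable[OF prod(1)] symbols_differentiable[OF prod(2)]
  obtain C where C: "0 \<le> C" "\<And>x. norm (f x) \<le> C * jap x powr K" using symbols_bound[OF prod(1)] by blast
  obtain D where D: "\<And>x. norm (g x) \<le> D * jap x powr L" using symbols_bound[OF prod(2)] by blast
  have "norm (f x * g x) \<le> (C * D) * jap x powr (K + L)" for x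
    using mult_mono[OF C(2) D, of x x] C(1) by (simp add: norm_mult powr_add mult_ac)
  moreover have "partial_deriv i (\<lambda>x. f x * g x) = (\<lambda>x. partial_deriv i f x * g x + f x * partial_deriv i g x)" for i
    by (intro ext partial_deriv_mult d)
  ultimately show ?case
    using d prod by (auto intro!: differentiable_mult prod_sums.intros symbols_partial_deriv)
next
  case (add u v)
  obtain C where C: "\<And>x. norm (u x) \<le> C * jap x powr (K + L)" using add by blast
  obtain D where D: "\<And>x. norm (v x) \<le> D * jap x powr (K + L)" using add by blast
  have "norm (u x + v x) \<le> (C + D) * jap x powr (K + L)" for x
    using norm_triangle_le[of "u x" "v x"] C[of x] D[of x] by (simp add: distrib_right)
  moreover have "partial_deriv i (\<lambda>x. u x + v x) = (\<lambda>x. partial_deriv i u x + partial_deriv i v x)" for i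
    using add by (intro ext partial_deriv_add) auto
  ultimately show ?case
    using add by (auto intro!: differentiable_add prod_sums.intros)
qed

lemma symbols_mult:
  assumes "f \<in> symbols K" "g \<in> symbols L"
  shows "(\<lambda>x. f x * g x) \<in> symbols (K + L)"
  by (rule symbols_coinduct[of _ "prod_sums K L"]) (use prod_sums_props assms in \<open>blast intro: prod_sums.prod\<close>)+

lemma symbols_const: "0 \<le> K \<Longrightarrow> (\<lambda>x. c) \<in> symbols K"
proof (rule symbols_mono[of _ 0], rule symbols_coinduct[of _ "range (\<lambda>c x. c)"])
  fix h :: "real^'a \<Rightarrow> complex" assume "h \<in> range (\<lambda>c x. c)"
  then obtain c where h: "h = (\<lambda>x. c)" by blast
  show "h differentiable (at x)" for x by (simp add: h)
  show "\<exists>C. \<forall>x. norm (h x) \<le> C * jap x powr 0" unfolding h by (intro exI[of _ "norm c"]) simp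
  show "partial_deriv i h \<in> range (\<lambda>c x. c)" for i unfolding h by simp
qed auto

lemma symbols_cmult: "f \<in> symbols K \<Longrightarrow> (\<lambda>x. c * f x) \<in> symbols K"
  using symbols_mult[OF symbols_const[of 0 c]] by fastforce

lemma symbols_diff:
  assumes "f \<in> symbols K" "g \<in> symbols K"
  shows "(\<lambda>x. f x - g x) \<in> symbols K"
  using symbols_add[OF assms(1) symbols_cmult[OF assms(2), of "-1"]] by simp

lemma symbols_sum:
  assumes "finite I" "\<And>i. i \<in> I \<Longrightarrow> f i \<in> symbols K" "0 \<le> K"
  shows "(\<lambda>x. \<Sum>i\<in>I. f i x) \<in> symbols K"
  using assms(1,2)
proof (induction I)
  case empty
  show ?case using symbols_const[OF assms(3), of 0] by simp
next
  case (insert i I)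
  then show ?case using symbols_add[of "f i" K "\<lambda>x. \<Sum>i\<in>I. f i x"] by simp
qed

lemma symbols_power:
  assumes "f \<in> symbols K"
  shows "(\<lambda>x. f x ^ m) \<in> symbols (real m * K)"
proof (induction m)
  case 0
  show ?case using symbols_const[of 0 1] by simp
next
  case (Suc m)
  show ?case using symbols_mult[OF assms Suc] by (simp add: algebra_simps)
qed

lemma norm_component_le_jap: "\<bar>x $ i\<bar> \<le> jap x powr (1/2)"
proof -
  have "\<bar>x $ i\<bar> \<le> sqrt ((norm x)\<^sup>2)" using component_le_norm_cart[of x i] by simp
  also have "\<dots> \<le> sqrt (jap x)" by (rule real_sqrt_le_mono) simp
  finally show ?thesis by (simp add: powr_half_sqrt)
qed

lemma has_derivative_coord:
  "((\<lambda>x::real^'n::finite. complex_of_real (x $ i)) has_derivative (\<lambda>h. of_real (h $ i))) (at x)"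
  by (intro has_derivative_of_real bounded_linear.has_derivative[OF bounded_linear_vec_nth] has_derivative_ident)

lemma partial_deriv_coord:
  "partial_deriv j (\<lambda>x. complex_of_real (x $ i)) = (\<lambda>x. if i = j then 1 else 0)"
proof
  fix x :: "real^'a"
  show "partial_deriv j (\<lambda>x. complex_of_real (x $ i)) x = (if i = j then 1 else 0)"
    using partial_deriv_eqI[OF has_derivative_coord[of i x], of j] by (simp add: axis_def)
qed

lemma symbols_coord: "(\<lambda>x::real^'n::finite. complex_of_real (x $ i)) \<in> symbols (1/2)"
proof (rule symbols_coinduct[of _ "insert (\<lambda>x. complex_of_real (x $ i)) (symbols (1/2))"])
  fix h :: "real^'n \<Rightarrow> complex" assume h: "h \<in> insert (\<lambda>x. complex_of_real (x $ i)) (symbols (1/2))"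
  show "h differentiable (at x)" for x
    using h has_derivative_coord symbols_differentiable unfolding differentiable_def by blast
  show "\<exists>C. \<forall>x. norm (h x) \<le> C * jap x powr (1/2)"
  proof (cases "h \<in> symbols (1/2)")
    case False
    then have "h = (\<lambda>x. complex_of_real (x $ i))" using h by blast
    then show ?thesis using norm_component_le_jap[of _ i] by (intro exI[of _ 1]) simp
  qed (meson symbols_bound)
  show "partial_deriv j h \<in> insert (\<lambda>x. complex_of_real (x $ i)) (symbols (1/2))" for j
    using h by (auto simp: partial_deriv_coord symbols_const intro: symbols_partial_deriv)
qed auto

lemma norm_power2_vec: "(norm x)\<^sup>2 = (\<Sum>i\<in>UNIV. (x $ i)\<^sup>2)" for x :: "real^'n::finite"
  by (simp add: norm_vec_def L2_set_def sum_nonneg)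

lemma symbols_norm2: "(\<lambda>x::real^'n::finite. complex_of_real ((norm x)\<^sup>2)) \<in> symbols 1"
proof -
  have "(\<lambda>x::real^'n. \<Sum>i\<in>UNIV. complex_of_real (x $ i) ^ 2) \<in> symbols 1"
    by (intro symbols_sum) (use symbols_power[OF symbols_coord, where m = 2] in auto)
  then show ?thesis by (simp add: norm_power2_vec)
qed

lemma symbols_jap: "(\<lambda>x::real^'n::finite. complex_of_real (jap x)) \<in> symbols 1"
  using symbols_add[OF symbols_const[of 1 1] symbols_norm2] by simp

lemma has_derivative_jap_powr:
  "((\<lambda>x::real^'n::finite. complex_of_real (jap x powr r)) has_derivative
     (\<lambda>h. \<Sum>i\<in>UNIV. (h $ i) *\<^sub>R of_real (2 * r * (x $ i) * jap x powr (r - 1)))) (at x)"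
proof -
  have j: "((\<lambda>x::real^'n. jap x) has_derivative (\<lambda>h. 2 * (x \<bullet> h))) (at x)"
    unfolding power2_norm_eq_inner by (auto intro!: derivative_eq_intros simp: inner_commute)
  have p: "((\<lambda>y. y powr r) has_derivative (\<lambda>h. h * (r * jap x powr (r - 1)))) (at (jap x))"
    using has_real_derivative_powr[of "jap x" r]
    by (simp add: has_field_derivative_def mult.commute[of _ "r * _"])
  have "((\<lambda>x::real^'n. complex_of_real (jap x powr r)) has_derivative
     (\<lambda>h. of_real (2 * (x \<bullet> h) * (r * jap x powr (r - 1))))) (at x)"
    by (rule has_derivative_of_real[OF has_derivative_compose[OF j p]])
  moreover have "complex_of_real (2 * (x \<bullet> h) * (r * jap x powr (r - 1))) =
      (\<Sum>i\<in>UNIV. (h $ i) *\<^sub>R of_real (2 * r * (x $ i) * jap x powr (r - 1)))" for h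
    by (simp add: inner_vec_def scaleR_conv_of_real sum_distrib_left sum_distrib_right mult_ac)
  ultimately show ?thesis by simp
qed

text \<open>The closed set consists of the products of a symbol of order \<open>a\<close> with
  \<open>jap x powr r\<close>, where \<open>a + r = s\<close>. Differentiating the power lowers
  \<open>r\<close> by one and brings down a coordinate; the other term of the product rule is
  brought to the same shape by splitting off one factor \<open>jap x\<close>. Thus \<open>a\<close>
  rises by one as \<open>r\<close> falls by one.\<close>

lemma symbols_jap_powr: "(\<lambda>x::real^'n::finite. complex_of_real (jap x powr s)) \<in> symbols s"
proof (rule symbols_coinduct[of _ "{(\<lambda>x. p x * of_real (jap x powr r)) | p a r. p \<in> symbols a \<and> a + r = s}"])
  have "(\<lambda>x. (1::complex)) \<in> symbols 0" by (rule symbols_const) simp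
  then show "(\<lambda>x::real^'n. complex_of_real (jap x powr s)) \<in>
    {(\<lambda>x. p x * of_real (jap x powr r)) | p a r. p \<in> symbols a \<and> a + r = s}"
    by (intro CollectI exI[of _ "\<lambda>x. 1"] exI[of _ 0] exI[of _ s]) auto
next
  fix h :: "real^'n \<Rightarrow> complex"
  assume "h \<in> {(\<lambda>x. p x * of_real (jap x powr r)) | p a r. p \<in> symbols a \<and> a + r = s}"
  then obtain p a r where h: "h = (\<lambda>x. p x * of_real (jap x powr r))" "p \<in> symbols a" "a + r = s"
    by blast
  note hd = has_derivative_jap_powr[of r]
  have hdiff: "(\<lambda>x::real^'n. complex_of_real (jap x powr r)) differentiable (at x)" for x
    using hd unfolding differentiable_def by blast
  show "h differentiable (at x)" for x
    unfolding h(1) by (intro differentiable_mult symbols_differentiable[OF h(2)] hdiff)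
  obtain C where C: "\<And>x. norm (p x) \<le> C * jap x powr a" using symbols_bound[OF h(2)] by blast
  have "norm (h x) \<le> C * jap x powr s" for x
    using mult_right_mono[OF C[of x], of "jap x powr r"] h(3)
    by (simp add: h(1) norm_mult powr_add[symmetric] mult.assoc)
  then show "\<exists>C. \<forall>x. norm (h x) \<le> C * jap x powr s" by blast
  show "partial_deriv i h \<in> {(\<lambda>x. p x * of_real (jap x powr r)) | p a r. p \<in> symbols a \<and> a + r = s}" for i
  proof -
    define p' where "p' = (\<lambda>x. partial_deriv i p x * of_real (jap x) + (2 * of_real r) * (of_real (x $ i) * p x))"
    have "(\<lambda>x::real^'n. of_real (x $ i) * p x) \<in> symbols (a + 1)"
      by (rule symbols_mono[OF symbols_mult[OF symbols_coord h(2)]]) simp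
    then have "p' \<in> symbols (a + 1)"
      unfolding p'_def
      by (intro symbols_add symbols_mult[OF symbols_partial_deriv symbols_jap] h(2) symbols_cmult)
    moreover have "partial_deriv i h = (\<lambda>x. p' x * of_real (jap x powr (r - 1)))"
    proof
      fix x :: "real^'n"
      have e: "jap x powr r = jap x * jap x powr (r - 1)"
        by (simp add: powr_diff)
      show "partial_deriv i h x = p' x * of_real (jap x powr (r - 1))"
        unfolding h(1) partial_deriv_mult[OF symbols_differentiable[OF h(2)] hdiff]
          partial_deriv_eq_sumI[OF hd] p'_def unfolding e
        by (simp add: algebra_simps)
    qed
    ultimately show ?thesis using h(3)
      by (intro CollectI exI[of _ p'] exI[of _ "a + 1"] exI[of _ "r - 1"]) auto
  qed
qed

section \<open>Even Schwartz functions as even symbols of every order\<close>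

lemma schwartz_even_iff: "f \<in> schwartz_even \<longleftrightarrow> even_fun f \<and> (\<forall>K. f \<in> symbols K)"
proof
  assume f: "f \<in> schwartz_even"
  then have s: "smooth_fun f" and e: "even_fun f" by (auto simp: schwartz_even_def)
  have "f \<in> symbols K" for K
  proof -
    \<comment> \<open>The seminorms only know natural exponents, so the real order \<open>K\<close>
      is rounded down to an order \<open>- real m\<close>, which lies below it.\<close>
    define m where "m = nat \<lceil>- K\<rceil>"
    have m: "- real m \<le> K" unfolding m_def by linarith
    have "\<exists>C. \<forall>x. norm (partials is f x) \<le> C * jap x powr (- real m)" for "is"
    proof -
      obtain C where C: "\<And>x. norm (jap x ^ m *\<^sub>R partials is f x) \<le> C"
        using f unfolding schwartz_even_def bounded_iff by blast
      have "norm (partials is f x) \<le> C * jap x powr (- real m)" for x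
        using C[of x] by (simp add: powr_minus powr_realpow field_simps)
      then show ?thesis by blast
    qed
    then have "f \<in> symbols (- real m)" using s by (simp add: symbols_def)
    then show ?thesis using m by (rule symbols_mono)
  qed
  with e show "even_fun f \<and> (\<forall>K. f \<in> symbols K)" by blast
next
  assume f: "even_fun f \<and> (\<forall>K. f \<in> symbols K)"
  have "bounded (range (\<lambda>x. jap x ^ m *\<^sub>R partials is f x))" for m "is"
  proof -
    obtain C where C: "\<And>x. norm (partials is f x) \<le> C * jap x powr (- real m)"
      using f symbols_bound[OF symbols_partials] by blast
    have "norm (jap x ^ m *\<^sub>R partials is f x) \<le> C" for x
      using C[of x] by (simp add: powr_minus powr_realpow field_simps)
    then show ?thesis unfolding bounded_iff by blast
  qed
  then show "f \<in> schwartz_even"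
    using f symbols_smooth[of f 0] by (auto simp: schwartz_even_def)
qed

lemma schwartz_even_symbols: "f \<in> schwartz_even \<Longrightarrow> f \<in> symbols K"
  by (simp add: schwartz_even_iff)

lemma schwartz_even_diff:
  "f \<in> schwartz_even \<Longrightarrow> g \<in> schwartz_even \<Longrightarrow> (\<lambda>x. f x - g x) \<in> schwartz_even"
  by (auto simp: schwartz_even_iff even_fun_def intro: symbols_diff)

lemma schwartz_even_add:
  "f \<in> schwartz_even \<Longrightarrow> g \<in> schwartz_even \<Longrightarrow> (\<lambda>x. f x + g x) \<in> schwartz_even"
  by (auto simp: schwartz_even_iff even_fun_def intro: symbols_add)

lemma schwartz_even_symbol_mult:
  assumes "h \<in> symbols K" "even_fun h" "f \<in> schwartz_even"
  shows "(\<lambda>x. h x * f x) \<in> schwartz_even"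
proof -
  have "(\<lambda>x. h x * f x) \<in> symbols L" for L
    using symbols_mult[OF assms(1) schwartz_even_symbols[OF assms(3), of "L - K"]] by simp
  then show ?thesis using assms by (auto simp: schwartz_even_iff even_fun_def)
qed

lemma schwartz_even_cmult: "f \<in> schwartz_even \<Longrightarrow> (\<lambda>x. c * f x) \<in> schwartz_even"
  by (rule schwartz_even_symbol_mult[OF symbols_const[OF order_refl]]) (simp_all add: even_fun_def)

abbreviation flip :: "'n::finite \<Rightarrow> real^'n \<Rightarrow> real^'n" where
  "flip i x \<equiv> (\<chi> j. if j = i then - (x $ j) else x $ j)"

lemma norm_flip: "norm (flip i x) = norm x"
  unfolding norm_vec_def by (rule L2_set_cong) auto

lemma even_fun_radial: "even_fun (\<lambda>x. f (norm x))"
  by (simp add: even_fun_def norm_flip)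

lemma schwartz_even_jap_powr_mult:
  "f \<in> schwartz_even \<Longrightarrow> (\<lambda>x. of_real (jap x powr s) * f x) \<in> schwartz_even"
  by (rule schwartz_even_symbol_mult[OF symbols_jap_powr even_fun_radial[of "\<lambda>r. of_real ((1 + r\<^sup>2) powr s)"]])

lemma schwartz_even_norm2_mult:
  "f \<in> schwartz_even \<Longrightarrow> (\<lambda>x. of_real ((norm x)\<^sup>2) * f x) \<in> schwartz_even"
  by (rule schwartz_even_symbol_mult[OF symbols_norm2 even_fun_radial[of "\<lambda>r. of_real (r\<^sup>2)"]])

subsection \<open>Normalized Bessel functions\<close>

definition bessel_coeff :: "real \<Rightarrow> nat \<Rightarrow> real" where
  "bessel_coeff \<gamma> k = (-1) ^ k / (fact k * pochhammer (\<gamma> + 1) k)"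

text \<open>This is the hypergeometric function 0F1 with parameter \<gamma> + 1 at the argument -u,
  an entire function with j obtained at u = (t/2)^2. Pochhammer symbols keep the Gamma function out
  of the recurrences.\<close>

definition bessel_series :: "real \<Rightarrow> real \<Rightarrow> real" where
  "bessel_series \<gamma> u = (\<Sum>k. bessel_coeff \<gamma> k * u ^ k)"

text \<open>Only the first factor can be below 1, and it is at least 1/2. In the series this gives
  comparison with twice the exponential series, uniformly in \<gamma>.\<close>

lemma pochhammer_ge_half:
  assumes "a \<ge> (1/2::real)"
  shows "pochhammer a k \<ge> 1/2"
proof (cases k)
  case (Suc m)
  have "pochhammer b n \<ge> 1" if "b \<ge> 1" for b :: real and n
    using that by (induction n) (auto simp: pochhammer_rec' intro!: mult_ge1_I order_trans[OF _ mult_mono[of 1 _ 1]])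
  then have "1 \<le> pochhammer (a + 1) m" using assms by simp
  then have "1 / 2 * 1 \<le> a * pochhammer (a + 1) m"
    using assms by (intro mult_mono) auto
  then show ?thesis by (simp add: Suc pochhammer_rec)
qed simp

lemma summable_bessel_coeff:
  assumes "\<gamma> \<ge> - 1/2"
  shows "summable (\<lambda>k. bessel_coeff \<gamma> k * u ^ k)"
proof (rule summable_comparison_test')
  show "summable (\<lambda>k. 2 * (inverse (fact k) * \<bar>u\<bar> ^ k))"
    by (intro summable_mult summable_exp)
  fix k :: nat
  have p: "pochhammer (\<gamma> + 1) k \<ge> 1/2"
    using assms by (intro pochhammer_ge_half) auto
  then have "1 / pochhammer (\<gamma> + 1) k \<le> 2"
    by (simp add: field_simps)
  then have "(1 / pochhammer (\<gamma> + 1) k) * (inverse (fact k) * \<bar>u\<bar> ^ k) \<le> 2 * (inverse (fact k) * \<bar>u\<bar> ^ k)"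
    by (rule mult_right_mono) simp
  moreover have "norm (bessel_coeff \<gamma> k * u ^ k) = (1 / pochhammer (\<gamma> + 1) k) * (inverse (fact k) * \<bar>u\<bar> ^ k)"
    using p by (simp add: bessel_coeff_def abs_mult power_abs field_simps)
  ultimately show "norm (bessel_coeff \<gamma> k * u ^ k) \<le> 2 * (inverse (fact k) * \<bar>u\<bar> ^ k)"
    by simp
qed

lemma diffs_bessel_coeff:
  assumes "\<gamma> \<ge> - 1/2"
  shows "diffs (bessel_coeff \<gamma>) k = (- 1 / (\<gamma> + 1)) * bessel_coeff (\<gamma> + 1) k"
proof -
  have "pochhammer (\<gamma> + 2) k \<ge> 1/2" using assms by (intro pochhammer_ge_half) auto
  then have nz: "pochhammer (\<gamma> + 2) k \<noteq> 0" by auto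
  have "\<gamma> + 1 \<noteq> 0" using assms by auto
  then show ?thesis
    using nz by (simp add: diffs_def bessel_coeff_def pochhammer_rec add.commute divide_simps)
qed

lemma bessel_series_deriv:
  assumes "\<gamma> \<ge> - 1/2"
  shows "(bessel_series \<gamma> has_real_derivative (- 1 / (\<gamma> + 1)) * bessel_series (\<gamma> + 1) u) (at u)"
proof -
  have "((\<lambda>u. \<Sum>k. bessel_coeff \<gamma> k * u ^ k) has_real_derivative (\<Sum>k. diffs (bessel_coeff \<gamma>) k * u ^ k)) (at u)"
    by (rule termdiffs_strong_converges_everywhere) (rule summable_bessel_coeff[OF assms])
  moreover have "(\<Sum>k. diffs (bessel_coeff \<gamma>) k * u ^ k) = (- 1 / (\<gamma> + 1)) * bessel_series (\<gamma> + 1) u"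
    unfolding bessel_series_def diffs_bessel_coeff[OF assms] mult.assoc
    using assms by (intro suminf_mult summable_bessel_coeff) auto
  ultimately show ?thesis
    by (simp add: bessel_series_def[abs_def])
qed

text \<open>A contiguous relation of 0F1, carrying the content of Bessel's equation without a
  division by the argument.\<close>

lemma bessel_series_contiguous:
  assumes "\<gamma> \<ge> - 1/2"
  shows "bessel_series \<gamma> u = bessel_series (\<gamma> + 1) u - u / ((\<gamma> + 1) * (\<gamma> + 2)) * bessel_series (\<gamma> + 2) u"
proof -
  have s: "summable (\<lambda>k. bessel_coeff (\<gamma> + 1) k * u ^ k)" "summable (\<lambda>k. bessel_coeff (\<gamma> + 2) k * u ^ k)"
    "summable (\<lambda>k. bessel_coeff \<gamma> k * u ^ k)"
    using assms by (auto intro!: summable_bessel_coeff)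
  have g: "\<gamma> + 1 \<noteq> 0" "\<gamma> + 2 \<noteq> 0" using assms by auto
  have s0: "bessel_series \<delta> u = 1 + (\<Sum>k. bessel_coeff \<delta> (Suc k) * u ^ Suc k)" if "\<delta> \<ge> - 1/2" for \<delta>
    using suminf_split_head[OF summable_bessel_coeff[OF that, of u]]
    by (simp add: bessel_series_def bessel_coeff_def)
  \<comment> \<open>The factor u in front of the last series shifts its index by one; the constant
    terms of the two other series are both 1 and cancel.\<close>
  have coeff: "bessel_coeff \<gamma> (Suc k) * u ^ Suc k = bessel_coeff (\<gamma> + 1) (Suc k) * u ^ Suc k
       - u / ((\<gamma> + 1) * (\<gamma> + 2)) * (bessel_coeff (\<gamma> + 2) k * u ^ k)" for k
  proof -
    define P where "P = pochhammer (\<gamma> + 3) k"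
    have "P \<ge> 1/2" unfolding P_def using assms by (intro pochhammer_ge_half) auto
    then have P: "P \<noteq> 0" by auto
    have "pochhammer (\<gamma> + 2) (Suc k) = (\<gamma> + 2) * P" by (simp add: P_def pochhammer_rec add.commute)
    moreover have "pochhammer (\<gamma> + 2) (Suc k) = pochhammer (\<gamma> + 2) k * (\<gamma> + 2 + real k)"
      by (simp add: pochhammer_rec')
    ultimately have Q: "pochhammer (\<gamma> + 2) k = (\<gamma> + 2) * P / (\<gamma> + 2 + real k)"
      using assms by (simp add: field_simps)
    have gk: "\<gamma> + 2 + real k \<noteq> 0" using assms by auto
    have 1: "bessel_coeff \<gamma> (Suc k) = - ((-1) ^ k) * (\<gamma> + 2 + real k) / (fact (Suc k) * ((\<gamma> + 1) * ((\<gamma> + 2) * P)))"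
      unfolding bessel_coeff_def pochhammer_rec using Q gk by (simp add: add.commute add.assoc)
    have 2: "bessel_coeff (\<gamma> + 1) (Suc k) = - ((-1) ^ k) / (fact (Suc k) * ((\<gamma> + 2) * P))"
      unfolding bessel_coeff_def pochhammer_rec P_def by (simp add: add.commute)
    have 3: "bessel_coeff (\<gamma> + 2) k = (-1) ^ k / (fact k * P)"
      unfolding bessel_coeff_def P_def by (simp add: add.commute)
    have F: "fact (Suc k) = (1 + real k) * fact k" by simp
    have k1: "1 + real k \<noteq> 0" by auto
    show ?thesis unfolding 1 2 3 F using P g k1
      by (simp add: divide_simps) (simp add: algebra_simps)
  qed
  have "(\<Sum>k. bessel_coeff \<gamma> (Suc k) * u ^ Suc k) = (\<Sum>k. bessel_coeff (\<gamma> + 1) (Suc k) * u ^ Suc k)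
       - (\<Sum>k. u / ((\<gamma> + 1) * (\<gamma> + 2)) * (bessel_coeff (\<gamma> + 2) k * u ^ k))"
    unfolding coeff
    by (intro suminf_diff[symmetric] summable_mult s(2) s(1)[unfolded summable_Suc_iff[symmetric, of "\<lambda>k. bessel_coeff (\<gamma> + 1) k * u ^ k"]])
  also have "(\<Sum>k. u / ((\<gamma> + 1) * (\<gamma> + 2)) * (bessel_coeff (\<gamma> + 2) k * u ^ k))
     = u / ((\<gamma> + 1) * (\<gamma> + 2)) * bessel_series (\<gamma> + 2) u"
    unfolding bessel_series_def by (rule suminf_mult[OF s(2)])
  finally show ?thesis using assms by (simp add: s0)
qed

lemma bessel_j_series:
  assumes "\<gamma> \<ge> - 1/2"
  shows "bessel_j \<gamma> t = bessel_series \<gamma> ((t / 2)\<^sup>2)"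
proof -
  have G: "Gamma (\<gamma> + 1) > 0" using assms by (intro Gamma_real_pos) auto
  have "(-1) ^ k / (fact k * Gamma (real k + \<gamma> + 1)) * (t / 2) ^ (2 * k)
      = bessel_coeff \<gamma> k * ((t / 2)\<^sup>2) ^ k / Gamma (\<gamma> + 1)" for k
  proof -
    have "\<gamma> + 1 \<notin> \<int>\<^sub>\<le>\<^sub>0" using assms by (auto elim!: nonpos_Ints_cases)
    then have "pochhammer (\<gamma> + 1) k = Gamma (\<gamma> + 1 + real k) / Gamma (\<gamma> + 1)"
      by (rule pochhammer_Gamma)
    then have "Gamma (real k + \<gamma> + 1) = pochhammer (\<gamma> + 1) k * Gamma (\<gamma> + 1)"
      using G by (simp add: add_ac)
    then show ?thesis
      unfolding bessel_coeff_def power_mult by simp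
  qed
  then show ?thesis
    unfolding bessel_j_def bessel_series_def
    using suminf_divide[OF summable_bessel_coeff[OF assms], of "(t / 2)\<^sup>2" "Gamma (\<gamma> + 1)"] G
    by simp
qed

text \<open>The derivatives of \<open>j\<^sub>\<gamma>\<close>: the recursion comes from \<open>j\<^sub>\<gamma>'' = - j\<^sub>\<gamma> + (2\<gamma> + 1) / (2\<gamma> + 2) j\<^bsub>\<gamma>+1\<^esub>\<close>, which has
  constant coefficients, so that all of them are bounded as soon as \<open>j\<close> and \<open>j'\<close> are.\<close>

fun bessel_d :: "nat \<Rightarrow> real \<Rightarrow> real \<Rightarrow> real" where
  "bessel_d 0 \<gamma> t = bessel_j \<gamma> t"
| "bessel_d (Suc 0) \<gamma> t = - (t / (2 * (\<gamma> + 1))) * bessel_j (\<gamma> + 1) t"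
| "bessel_d (Suc (Suc m)) \<gamma> t = - bessel_d m \<gamma> t + (2 * \<gamma> + 1) / (2 * \<gamma> + 2) * bessel_d m (\<gamma> + 1) t"

lemma bessel_j_deriv:
  assumes "\<gamma> \<ge> - 1/2"
  shows "(bessel_j \<gamma> has_real_derivative bessel_d 1 \<gamma> t) (at t)"
proof -
  have "((\<lambda>t. (t / 2)\<^sup>2) has_real_derivative t / 2) (at t)"
    by (auto intro!: derivative_eq_intros simp: field_simps)
  from DERIV_chain2[OF bessel_series_deriv[OF assms] this]
  have "((\<lambda>t. bessel_series \<gamma> ((t / 2)\<^sup>2)) has_real_derivative
     (- 1 / (\<gamma> + 1)) * bessel_series (\<gamma> + 1) ((t / 2)\<^sup>2) * (t / 2)) (at t)" .
  moreover have "bessel_j \<gamma> = (\<lambda>t. bessel_series \<gamma> ((t / 2)\<^sup>2))"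
    using assms by (intro ext bessel_j_series) auto
  ultimately show ?thesis
    using assms by (simp add: bessel_j_series mult_ac)
qed

text \<open>Differentiating the product of t and the function at \<gamma> + 1 leaves a term with t^2
  and \<gamma> + 2. The contiguous relation trades it for the functions at \<gamma> and \<gamma> +
  1, with coefficients free of t.\<close>

lemma bessel_j_deriv2:
  assumes "\<gamma> \<ge> - 1/2"
  shows "(bessel_d (Suc 0) \<gamma> has_real_derivative bessel_d (Suc (Suc 0)) \<gamma> t) (at t)"
proof -
  have c: "bessel_j \<gamma> t = bessel_j (\<gamma> + 1) t - (t / 2)\<^sup>2 / ((\<gamma> + 1) * (\<gamma> + 2)) * bessel_j (\<gamma> + 2) t"
    using bessel_series_contiguous[OF assms] assms by (simp add: bessel_j_series)
  have g: "\<gamma> + 1 \<noteq> 0" "\<gamma> + 2 \<noteq> 0" using assms by auto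
  have "((\<lambda>t. - (t / (2 * (\<gamma> + 1))) * bessel_j (\<gamma> + 1) t) has_real_derivative
    - (1 / (2 * (\<gamma> + 1))) * bessel_j (\<gamma> + 1) t + bessel_d 1 (\<gamma> + 1) t * (- (t / (2 * (\<gamma> + 1))))) (at t)"
    using assms by (intro DERIV_mult bessel_j_deriv) (auto intro!: derivative_eq_intros)
  moreover have "- (1 / (2 * (\<gamma> + 1))) * bessel_j (\<gamma> + 1) t + bessel_d 1 (\<gamma> + 1) t * (- (t / (2 * (\<gamma> + 1))))
      = bessel_d (Suc (Suc 0)) \<gamma> t"
  proof -
    define a where "a = 1 / (\<gamma> + 1)"
    define b where "b = 1 / (\<gamma> + 2)"
    have 0: "(2 * \<gamma> + 1) / (2 * \<gamma> + 2) = 1 - a / 2"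
      using g by (simp add: a_def divide_simps) (simp add: algebra_simps)
    have 1: "1 / (2 * (\<gamma> + 1)) = a / 2" "t / (2 * (\<gamma> + 1)) = t * a / 2"
      "t / (2 * (\<gamma> + 1 + 1)) = t * b / 2" "(t / 2)\<^sup>2 / ((\<gamma> + 1) * (\<gamma> + 2)) = t\<^sup>2 / 4 * a * b"
      using g by (auto simp: a_def b_def divide_simps power2_eq_square)
    have "bessel_j (\<gamma> + 1 + 1) t = bessel_j (\<gamma> + 2) t" by (simp add: add.assoc)
    then show ?thesis
      by (simp only: One_nat_def bessel_d.simps c 0 1) (simp add: algebra_simps power2_eq_square)
  qed
  moreover have "bessel_d (Suc 0) \<gamma> = (\<lambda>t. - (t / (2 * (\<gamma> + 1))) * bessel_j (\<gamma> + 1) t)"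
    by (rule ext) (rule bessel_d.simps)
  ultimately show ?thesis by (simp only:)
qed

lemma bessel_d_deriv:
  assumes "\<gamma> \<ge> - 1/2"
  shows "(bessel_d m \<gamma> has_real_derivative bessel_d (Suc m) \<gamma> t) (at t)"
  using assms
proof (induction m \<gamma> t rule: bessel_d.induct)
  case (1 \<gamma> t)
  moreover have "bessel_d 0 \<gamma> = bessel_j \<gamma>" by auto
  ultimately show ?case using bessel_j_deriv[of \<gamma> t] by simp
next
  case (2 \<gamma> t)
  then show ?case using bessel_j_deriv2 by blast
next
  case (3 m \<gamma> t)
  have "((\<lambda>t. - bessel_d m \<gamma> t + (2 * \<gamma> + 1) / (2 * \<gamma> + 2) * bessel_d m (\<gamma> + 1) t)
     has_real_derivative (- bessel_d (Suc m) \<gamma> t + (2 * \<gamma> + 1) / (2 * \<gamma> + 2) * bessel_d (Suc m) (\<gamma> + 1) t)) (at t)"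
    using 3 by (intro DERIV_add DERIV_minus DERIV_cmult) auto
  then show ?case by simp
qed

lemma bessel_j_even: "bessel_j \<gamma> (- t) = bessel_j \<gamma> t"
  by (simp add: bessel_j_def)

lemma bessel_j_0: "\<gamma> \<ge> - 1/2 \<Longrightarrow> bessel_j \<gamma> 0 = 1"
  using powser_zero[of "bessel_coeff \<gamma>"]
  by (simp add: bessel_j_series bessel_series_def bessel_coeff_def)

lemma bessel_equation:
  assumes "\<gamma> \<ge> - 1/2" "t \<noteq> 0"
  shows "bessel_d 2 \<gamma> t + (2 * \<gamma> + 1) / t * bessel_d 1 \<gamma> t = - bessel_j \<gamma> t"
proof -
  have g: "\<gamma> + 1 \<noteq> 0" using assms by auto
  then show ?thesis using assms(2) by (simp add: numeral_2_eq_2 divide_simps)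
qed

text \<open>The energy \<open>j\<^sup>2 + j'\<^sup>2\<close> is nonincreasing on the positive half-line by Bessel's equation.\<close>

lemma bessel_energy:
  assumes "\<gamma> \<ge> - 1/2"
  shows "(bessel_j \<gamma> t)\<^sup>2 + (bessel_d 1 \<gamma> t)\<^sup>2 \<le> 1"
proof -
  have pos: "(bessel_j \<gamma> t)\<^sup>2 + (bessel_d 1 \<gamma> t)\<^sup>2 \<le> 1" if t: "0 \<le> t" for t
  proof -
    define e where "e t = (bessel_j \<gamma> t)\<^sup>2 + (bessel_d 1 \<gamma> t)\<^sup>2" for t
    have d: "(e has_real_derivative 2 * bessel_d 1 \<gamma> t * (bessel_j \<gamma> t + bessel_d 2 \<gamma> t)) (at t)" for t
      unfolding e_def
      by (rule DERIV_cong[OF DERIV_add[OF DERIV_power[OF bessel_j_deriv[OF assms]]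
            DERIV_power[OF bessel_d_deriv[OF assms]]]])
        (simp add: numeral_2_eq_2 distrib_left mult_ac del: bessel_d.simps)
    have "e t \<le> e 0"
    proof (rule DERIV_nonpos_imp_nonincreasing[OF t])
      fix s assume s: "0 \<le> s" "s \<le> t"
      have "2 * bessel_d 1 \<gamma> s * (bessel_j \<gamma> s + bessel_d 2 \<gamma> s) \<le> 0"
      \<comment> \<open>Bessel's equation is singular at 0, but there the factor
        \<open>bessel_d 1 \<gamma> s\<close> vanishes.\<close>
      proof (cases "s = 0")
        case False
        then have "bessel_j \<gamma> s + bessel_d 2 \<gamma> s = - ((2 * \<gamma> + 1) / s * bessel_d 1 \<gamma> s)"
          using bessel_equation[OF assms, of s] by simp
        then have "2 * bessel_d 1 \<gamma> s * (bessel_j \<gamma> s + bessel_d 2 \<gamma> s) = - (2 * ((2 * \<gamma> + 1) / s) * (bessel_d 1 \<gamma> s)\<^sup>2)"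
          by (simp add: power2_eq_square)
        moreover have "0 \<le> 2 * ((2 * \<gamma> + 1) / s) * (bessel_d 1 \<gamma> s)\<^sup>2"
          using s assms by (intro mult_nonneg_nonneg divide_nonneg_nonneg) auto
        ultimately show ?thesis by linarith
      qed auto
      then show "\<exists>y. DERIV e s :> y \<and> y \<le> 0" using d by blast
    qed
    moreover have "e 0 = 1" using assms by (simp add: e_def bessel_j_0)
    ultimately show ?thesis by (simp add: e_def)
  qed
  show ?thesis
  proof (cases "0 \<le> t")
    case False
    then show ?thesis using pos[of "- t"] by (simp add: bessel_j_even)
  qed (rule pos)
qed

lemma bessel_abs_le_1:
  assumes "\<gamma> \<ge> - 1/2"
  shows "\<bar>bessel_j \<gamma> t\<bar> \<le> 1" "\<bar>bessel_d 1 \<gamma> t\<bar> \<le> 1"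
proof -
  have "(bessel_j \<gamma> t)\<^sup>2 \<le> 1" "(bessel_d 1 \<gamma> t)\<^sup>2 \<le> 1"
    using bessel_energy[OF assms, of t] zero_le_power2[of "bessel_j \<gamma> t"] zero_le_power2[of "bessel_d 1 \<gamma> t"] by linarith+
  then show "\<bar>bessel_j \<gamma> t\<bar> \<le> 1" "\<bar>bessel_d 1 \<gamma> t\<bar> \<le> 1" by (simp_all only: abs_square_le_1)
qed

text \<open>The recursion raises both the order and the parameter, so the two-step induction on
  \<open>m\<close> has to run over all \<gamma>; the base cases are the energy bound.\<close>

lemma bessel_d_bounded:
  assumes "\<gamma> \<ge> - 1/2"
  shows "\<exists>C\<ge>0. \<forall>t. \<bar>bessel_d m \<gamma> t\<bar> \<le> C"
  using assms
proof (induction m arbitrary: \<gamma> rule: induct_nat_012)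
  case 0
  show ?case using bessel_abs_le_1(1)[OF 0] by (intro exI[of _ 1]) auto
next
  case 1
  show ?case using bessel_abs_le_1(2)[OF 1] by (intro exI[of _ 1]) auto
next
  case (ge2 m)
  obtain C where C: "C \<ge> 0" "\<And>t. \<bar>bessel_d m \<gamma> t\<bar> \<le> C" using ge2.IH(1) ge2.prems by blast
  obtain D where D: "D \<ge> 0" "\<And>t. \<bar>bessel_d m (\<gamma> + 1) t\<bar> \<le> D" using ge2.IH(1)[of "\<gamma> + 1"] ge2.prems by force
  define c where "c = (2 * \<gamma> + 1) / (2 * \<gamma> + 2)"
  have "\<bar>bessel_d (Suc (Suc m)) \<gamma> t\<bar> \<le> C + \<bar>c\<bar> * D" for t
  proof -
    have "\<bar>bessel_d (Suc (Suc m)) \<gamma> t\<bar> \<le> \<bar>bessel_d m \<gamma> t\<bar> + \<bar>c * bessel_d m (\<gamma> + 1) t\<bar>"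
      unfolding bessel_d.simps c_def by (rule order_trans[OF abs_triangle_ineq]) simp
    also have "\<dots> \<le> C + \<bar>c\<bar> * D"
      unfolding abs_mult using C(2) D(2) by (intro add_mono mult_left_mono) auto
    finally show ?thesis .
  qed
  then show ?case using C(1) D(1) by (intro exI[of _ "C + \<bar>c\<bar> * D"]) auto
qed

lemma bessel_d_measurable:
  assumes "\<gamma> \<ge> - 1/2"
  shows "(\<lambda>x::real^'n::finite. bessel_d k \<gamma> (c * x $ i)) \<in> borel_measurable borel"
proof (rule borel_measurable_continuous_onI)
  have "continuous_on UNIV (bessel_d k \<gamma>)"
    using bessel_d_deriv[OF assms] by (intro DERIV_continuous_on) (auto intro: has_field_derivative_at_within)
  then show "continuous_on UNIV (\<lambda>x::real^'n. bessel_d k \<gamma> (c * x $ i))"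
    by (rule continuous_on_compose2) (auto intro!: continuous_intros)
qed

subsection \<open>Differentiation under the integral sign\<close>

lemma onorm_sum_component_le:
  fixes d :: "'n::finite \<Rightarrow> complex"
  assumes "\<And>i. norm (d i) \<le> B"
  shows "onorm (\<lambda>h::real^'n. \<Sum>i\<in>UNIV. (h $ i) *\<^sub>R d i) \<le> real CARD('n) * B"
proof (rule onorm_le)
  fix h :: "real^'n"
  have "norm (\<Sum>i\<in>UNIV. (h $ i) *\<^sub>R d i) \<le> (\<Sum>i\<in>(UNIV::'n set). B * norm h)"
  proof (rule sum_norm_le)
    fix i
    have B0: "0 \<le> B" using assms[of i] norm_ge_zero[of "d i"] by linarith
    have "norm ((h $ i) *\<^sub>R d i) = norm (d i) * \<bar>h $ i\<bar>" by simp
    also have "\<dots> \<le> B * norm h"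
      using assms[of i] component_le_norm_cart[of h i] B0 by (intro mult_mono) auto
    finally show "norm ((h $ i) *\<^sub>R d i) \<le> B * norm h" .
  qed
  then show "norm (\<Sum>i\<in>UNIV. (h $ i) *\<^sub>R d i) \<le> real CARD('n) * B * norm h" by simp
qed

text \<open>The bound on the second derivatives makes each \<open>k1 i\<close> Lipschitz; the
  linearized mean value inequality on the ball of radius \<open>norm (y - x)\<close> then gives a
  quadratic remainder. Each of the two steps bounds an operator norm by a sum over coordinates,
  whence the square of the dimension.\<close>

lemma taylor_bound:
  fixes k :: "real^'n::finite \<Rightarrow> complex"
  assumes k: "\<And>y. (k has_derivative (\<lambda>h. \<Sum>i\<in>UNIV. (h $ i) *\<^sub>R k1 i y)) (at y)"
    and k1: "\<And>i y. (k1 i has_derivative (\<lambda>h. \<Sum>j\<in>UNIV. (h $ j) *\<^sub>R k2 i j y)) (at y)"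
    and B: "\<And>i j y. norm (k2 i j y) \<le> B"
  shows "norm (k y - k x - (\<Sum>i\<in>UNIV. ((y - x) $ i) *\<^sub>R k1 i x)) \<le> (real CARD('n))\<^sup>2 * (norm (y - x))\<^sup>2 * B"
proof -
  have B0: "0 \<le> B" using B[of undefined undefined undefined] norm_ge_zero order_trans by blast
  have lip: "norm (k1 i z - k1 i x) \<le> real CARD('n) * B * norm (z - x)" for i z
    by (rule differentiable_bound[of UNIV "k1 i" "\<lambda>y h. \<Sum>j\<in>UNIV. (h $ j) *\<^sub>R k2 i j y"])
      (auto intro: k1 onorm_sum_component_le B)
  have "norm (k y - k x - (\<Sum>i\<in>UNIV. ((y - x) $ i) *\<^sub>R k1 i x))
     \<le> norm (y - x) * (real CARD('n) * (real CARD('n) * B * norm (y - x)))"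
  proof (rule differentiable_bound_linearization[of x y "cball x (norm (y - x))" k "\<lambda>z h. \<Sum>i\<in>UNIV. (h $ i) *\<^sub>R k1 i z" x])
    fix t :: real assume "t \<in> {0..1}"
    then show "x + t *\<^sub>R (y - x) \<in> cball x (norm (y - x))"
      by (simp add: dist_norm mult_left_le_one_le)
  next
    fix z assume z: "z \<in> cball x (norm (y - x))"
    have "onorm (\<lambda>h::real^'n. \<Sum>i\<in>UNIV. (h $ i) *\<^sub>R (k1 i z - k1 i x)) \<le> real CARD('n) * (real CARD('n) * B * norm (y - x))"
    proof (rule onorm_sum_component_le)
      fix i
      have "norm (k1 i z - k1 i x) \<le> real CARD('n) * B * norm (z - x)" by (rule lip)
      also have "\<dots> \<le> real CARD('n) * B * norm (y - x)"
        using z B0 by (intro mult_left_mono) (auto simp: dist_norm norm_minus_commute)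
      finally show "norm (k1 i z - k1 i x) \<le> real CARD('n) * B * norm (y - x)" .
    qed
    moreover have "((\<lambda>h::real^'n. \<Sum>i\<in>UNIV. (h $ i) *\<^sub>R k1 i z) - (\<lambda>h. \<Sum>i\<in>UNIV. (h $ i) *\<^sub>R k1 i x)) =
       (\<lambda>h. \<Sum>i\<in>UNIV. (h $ i) *\<^sub>R (k1 i z - k1 i x))"
      by (auto simp: fun_eq_iff sum_subtractf scaleR_diff_right)
    ultimately show "onorm ((\<lambda>h. \<Sum>i\<in>UNIV. (h $ i) *\<^sub>R k1 i z) - (\<lambda>h. \<Sum>i\<in>UNIV. (h $ i) *\<^sub>R k1 i x))
      \<le> real CARD('n) * (real CARD('n) * B * norm (y - x))" by simp
  qed (auto intro: has_derivative_at_withinI k)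
  then show ?thesis by (simp add: power2_eq_square mult_ac)
qed

text \<open>Integrating the quadratic Taylor remainder gives the Frechet derivative in all variables
  at once. The price is an integrable bound for the second derivatives, which is harmless here
  because the kernels can be differentiated any number of times.\<close>

lemma has_derivative_integral:
  fixes k :: "real^'n::finite \<Rightarrow> 'b::euclidean_space \<Rightarrow> complex"
  assumes k: "\<And>y t. t \<in> space M \<Longrightarrow> ((\<lambda>y. k y t) has_derivative (\<lambda>h. \<Sum>i\<in>UNIV. (h $ i) *\<^sub>R k1 i y t)) (at y)"
    and k1: "\<And>i y t. t \<in> space M \<Longrightarrow> ((\<lambda>y. k1 i y t) has_derivative (\<lambda>h. \<Sum>j\<in>UNIV. (h $ j) *\<^sub>R k2 i j y t)) (at y)"
    and B: "\<And>i j y t. t \<in> space M \<Longrightarrow> norm (k2 i j y t) \<le> B t"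
    and int: "\<And>y. integrable M (k y)" "\<And>i y. integrable M (k1 i y)" "integrable M B"
  shows "((\<lambda>y. \<integral>t. k y t \<partial>M) has_derivative (\<lambda>h. \<Sum>i\<in>UNIV. (h $ i) *\<^sub>R (\<integral>t. k1 i x t \<partial>M))) (at x)"
proof -
  define D where "D = (real CARD('n))\<^sup>2 * (\<integral>t. B t \<partial>M)"
  have bound: "norm ((\<integral>t. k y t \<partial>M) - (\<integral>t. k x t \<partial>M) - (\<Sum>i\<in>UNIV. ((y - x) $ i) *\<^sub>R (\<integral>t. k1 i x t \<partial>M)))
     \<le> D * (norm (y - x))\<^sup>2" for y
  proof -
    have i1: "integrable M (\<lambda>t. \<Sum>i\<in>UNIV. ((y - x) $ i) *\<^sub>R k1 i x t)"
      using int by (intro Bochner_Integration.integrable_sum integrable_scaleR_right) auto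
    have "(\<integral>t. k y t \<partial>M) - (\<integral>t. k x t \<partial>M) - (\<Sum>i\<in>UNIV. ((y - x) $ i) *\<^sub>R (\<integral>t. k1 i x t \<partial>M))
      = (\<integral>t. k y t - k x t - (\<Sum>i\<in>UNIV. ((y - x) $ i) *\<^sub>R k1 i x t) \<partial>M)"
      using int i1 by (simp add: Bochner_Integration.integral_diff Bochner_Integration.integral_sum)
    also have "norm \<dots> \<le> (\<integral>t. (real CARD('n))\<^sup>2 * (norm (y - x))\<^sup>2 * B t \<partial>M)"
    proof (rule Bochner_Integration.integral_norm_bound_integral)
      show "integrable M (\<lambda>t. k y t - k x t - (\<Sum>i\<in>UNIV. ((y - x) $ i) *\<^sub>R k1 i x t))"
        using int i1 by (intro Bochner_Integration.integrable_diff) auto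
      show "integrable M (\<lambda>t. (real CARD('n))\<^sup>2 * (norm (y - x))\<^sup>2 * B t)" using int by simp
      fix t assume t: "t \<in> space M"
      show "norm (k y t - k x t - (\<Sum>i\<in>UNIV. ((y - x) $ i) *\<^sub>R k1 i x t)) \<le> (real CARD('n))\<^sup>2 * (norm (y - x))\<^sup>2 * B t"
        by (rule taylor_bound[of "\<lambda>y. k y t" "\<lambda>i y. k1 i y t" "\<lambda>i j y. k2 i j y t"]) (use t k k1 B in auto)
    qed
    also have "\<dots> = D * (norm (y - x))\<^sup>2" by (simp add: D_def mult_ac)
    finally show ?thesis .
  qed
  have lin: "bounded_linear (\<lambda>h::real^'n. \<Sum>i\<in>UNIV. (h $ i) *\<^sub>R (\<integral>t. k1 i x t \<partial>M))"
    by (intro bounded_linear_sum bounded_linear_scaleR_const bounded_linear_vec_nth)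
  show ?thesis
    unfolding has_derivative_at_alt
  proof (intro conjI lin allI impI)
    fix e :: real assume e: "0 < e"
    show "\<exists>d>0. \<forall>y. norm (y - x) < d \<longrightarrow>
        norm ((\<integral>t. k y t \<partial>M) - (\<integral>t. k x t \<partial>M) - (\<Sum>i\<in>UNIV. ((y - x) $ i) *\<^sub>R (\<integral>t. k1 i x t \<partial>M))) \<le> e * norm (y - x)"
    proof (intro exI[of _ "e / (\<bar>D\<bar> + 1)"] conjI allI impI)
      show "0 < e / (\<bar>D\<bar> + 1)" using e by simp
      fix y assume y: "norm (y - x) < e / (\<bar>D\<bar> + 1)"
      then have "(\<bar>D\<bar> + 1) * norm (y - x) \<le> e" by (simp add: field_simps)
      moreover have "D * norm (y - x) \<le> (\<bar>D\<bar> + 1) * norm (y - x)" by (intro mult_right_mono) auto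
      ultimately have "D * norm (y - x) * norm (y - x) \<le> e * norm (y - x)"
        by (intro mult_right_mono) auto
      then show "norm ((\<integral>t. k y t \<partial>M) - (\<integral>t. k x t \<partial>M) - (\<Sum>i\<in>UNIV. ((y - x) $ i) *\<^sub>R (\<integral>t. k1 i x t \<partial>M))) \<le> e * norm (y - x)"
        using bound[of y] by (simp add: power2_eq_square mult_ac)
    qed
  qed
qed

subsection \<open>Integrability of rapidly decreasing functions\<close>

lemma powr_minus_le_of_square:
  fixes J r :: real
  assumes "0 < J" "0 < r" "r\<^sup>2 \<le> 2 * J"
  shows "J powr (- (real N + 2)) \<le> 2 ^ (N + 2) / r ^ (2 * N + 4)"
proof -
  have "(r\<^sup>2) ^ (N + 2) \<le> (2 * J) ^ (N + 2)" by (rule power_mono[OF assms(3)]) simp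
  moreover have "(r\<^sup>2) ^ (N + 2) = r ^ (2 * N + 4)" unfolding power_mult[symmetric] by (rule arg_cong[where f = "\<lambda>m. r ^ m"]) simp
  ultimately have le: "r ^ (2 * N + 4) \<le> 2 ^ (N + 2) * J ^ (N + 2)"
    unfolding power_mult_distrib by (simp only:)
  have "J powr (- (real N + 2)) = inverse (J powr (real (N + 2)))" unfolding powr_minus[symmetric] by (simp add: algebra_simps)
  also have "\<dots> = 1 / J ^ (N + 2)" using assms(1) by (simp only: powr_realpow inverse_eq_divide)
  also have "\<dots> \<le> 2 ^ (N + 2) / r ^ (2 * N + 4)"
  proof -
    have p: "0 < J ^ (N + 2)" "0 < r ^ (2 * N + 4)" using assms by (auto intro: zero_less_power)
    have gen: "1 / X \<le> A / R" if "0 < X" "0 < R" "R \<le> A * X" for X R A :: real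
      using that by (simp add: field_simps)
    show ?thesis by (rule gen[OF p le])
  qed
  finally show ?thesis .
qed

text \<open>On the layer k \<le> |x| < k + 1 the function is at most \<open>b k\<close>, and the
  layer lies in a ball of volume \<open>c * (real k + 1) ^ N\<close>. The resulting series has terms
  of order (k + 1)^(-N-4), dominated by 1 / (k + 1)^2.\<close>

lemma integrable_jap_powr:
  "integrable lborel (\<lambda>x::real^'n::finite. jap x powr (- (real CARD('n) + 2)))"
proof -
  define N where "N = CARD('n)"
  define c where "c = unit_ball_vol (real N)"
  define f where "f x = jap x powr (- (real N + 2))" for x :: "real^'n"
  define b where "b k = 2 ^ (N + 2) / (real k + 1) ^ (2 * N + 4)" for k
  have le: "ennreal (f x) \<le> (\<Sum>k. ennreal (b k) * indicator (ball 0 (real k + 1)) x)" for x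
  proof -
    define k where "k = nat \<lfloor>norm x\<rfloor>"
    have k: "real k \<le> norm x" "norm x < real k + 1" unfolding k_def by simp_all
    \<comment> \<open>Equivalent to (k - 1)^2 \<ge> 0; it converts the outer radius k + 1 into the
      inner radius k at the cost of a factor 2.\<close>
    have "(real k + 1)\<^sup>2 \<le> 2 * (1 + (real k)\<^sup>2)"
      using zero_le_power2[of "real k - 1"] by (simp add: power2_eq_square algebra_simps)
    also have "\<dots> \<le> 2 * jap x" using k(1) by (simp add: power_mono)
    finally have "f x \<le> b k"
      unfolding f_def b_def by (intro powr_minus_le_of_square) auto
    then have "ennreal (f x) \<le> ennreal (b k) * indicator (ball 0 (real k + 1)) x"
      using k(2) by (simp add: ennreal_leI)
    also have "\<dots> \<le> (\<Sum>k. ennreal (b k) * indicator (ball 0 (real k + 1)) x)"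
    proof -
      have "(\<Sum>k\<in>{k}. ennreal (b k) * indicator (ball 0 (real k + 1)) x) \<le> (\<Sum>k. ennreal (b k) * indicator (ball 0 (real k + 1)) x)"
        by (rule sum_le_suminf) auto
      then show ?thesis by (simp only: sum.insert sum.empty finite.emptyI empty_iff not_False_eq_True add_0_right)
    qed
    finally show ?thesis .
  qed
  have b0: "0 \<le> b k" for k unfolding b_def by (intro divide_nonneg_nonneg zero_le_power) auto
  have c0: "0 \<le> c" unfolding c_def by simp
  have "(\<integral>\<^sup>+x. ennreal (f x) \<partial>lborel) \<le> (\<integral>\<^sup>+x. (\<Sum>k. ennreal (b k) * indicator (ball (0::real^'n) (real k + 1)) x) \<partial>lborel)"
    by (intro nn_integral_mono le)
  also have "\<dots> = (\<Sum>k. \<integral>\<^sup>+x. ennreal (b k) * indicator (ball (0::real^'n) (real k + 1)) x \<partial>lborel)"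
    by (rule nn_integral_suminf) (auto intro!: borel_measurable_times_ennreal borel_measurable_indicator)
  also have "\<dots> = (\<Sum>k. ennreal (b k * (c * (real k + 1) ^ N)))"
  proof (rule suminf_cong)
    fix k
    have "(\<integral>\<^sup>+x. ennreal (b k) * indicator (ball (0::real^'n) (real k + 1)) x \<partial>lborel)
       = ennreal (b k) * emeasure lborel (ball (0::real^'n) (real k + 1))"
      by (rule nn_integral_cmult_indicator) auto
    also have "emeasure lborel (ball (0::real^'n) (real k + 1)) = ennreal (c * (real k + 1) ^ N)"
      by (subst emeasure_ball) (auto simp: c_def N_def)
    finally show "(\<integral>\<^sup>+x. ennreal (b k) * indicator (ball (0::real^'n) (real k + 1)) x \<partial>lborel) = ennreal (b k * (c * (real k + 1) ^ N))"
      using b0 by (simp add: ennreal_mult')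
  qed
  also have "\<dots> < \<infinity>"
  proof -
    have "summable (\<lambda>k. b k * (c * (real k + 1) ^ N))"
    proof (rule summable_comparison_test')
      have "summable (\<lambda>k. 1 / (real (Suc k))\<^sup>2)"
        using inverse_power_summable[of 2, where 'a = real] summable_Suc_iff[of "\<lambda>k. inverse ((real k)\<^sup>2)"]
        by (simp add: inverse_eq_divide)
      then show "summable (\<lambda>k. 2 ^ (N + 2) * c * (1 / (real (Suc k))\<^sup>2))" by (rule summable_mult)
      fix k
      have le: "(real k + 1) ^ N * (real k + 1)\<^sup>2 \<le> 1 * (real k + 1) ^ (2 * N + 4)"
        unfolding power_add[symmetric] mult_1 by (rule power_increasing) auto
      have gen: "A / X \<le> B / R" if "0 < X" "0 < R" "A * R \<le> B * X" for A B X R :: real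
        using that by (simp add: field_simps)
      have "(real k + 1) ^ N / (real k + 1) ^ (2 * N + 4) \<le> 1 / (real k + 1)\<^sup>2"
        by (rule gen[OF _ _ le]) auto
      then have "2 ^ (N + 2) * c * ((real k + 1) ^ N / (real k + 1) ^ (2 * N + 4)) \<le> 2 ^ (N + 2) * c * (1 / (real k + 1)\<^sup>2)"
        using c0 by (intro mult_left_mono) auto
      moreover have "norm (b k * (c * (real k + 1) ^ N)) = b k * (c * (real k + 1) ^ N)"
        using b0[of k] c0 by (simp only: real_norm_def abs_mult abs_of_nonneg) simp
      moreover have "b k * (c * (real k + 1) ^ N) = 2 ^ (N + 2) * c * ((real k + 1) ^ N / (real k + 1) ^ (2 * N + 4))"
        unfolding b_def by (simp only: times_divide_eq_left times_divide_eq_right mult.assoc)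
      moreover have "real (Suc k) = real k + 1" by simp
      ultimately show "norm (b k * (c * (real k + 1) ^ N)) \<le> 2 ^ (N + 2) * c * (1 / (real (Suc k))\<^sup>2)"
        by (simp only:)
    qed
    then have "(\<Sum>k. ennreal (b k * (c * (real k + 1) ^ N))) \<noteq> top"
      using b0 c0 by (intro ennreal_suminf_neq_top) auto
    then show ?thesis by (simp add: top.not_eq_extremum)
  qed
  finally have "(\<integral>\<^sup>+x. ennreal (f x) \<partial>lborel) < \<infinity>" .
  then have "integrable lborel f"
    by (intro integrableI_nonneg) (auto simp: f_def[abs_def])
  then show ?thesis by (simp add: f_def[abs_def] N_def)
qed

text \<open>Extends the density of \<open>mu \<alpha>\<close> by zero off the open orthant, since \<open>0 powr a = 0\<close>.\<close>

definition weight :: "real^'n::finite \<Rightarrow> real^'n \<Rightarrow> real" where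
  "weight \<alpha> x = (\<Prod>i\<in>UNIV. max 0 (x $ i) powr (2 * \<alpha> $ i + 1))"

lemma weight_measurable [measurable]: "weight \<alpha> \<in> borel_measurable borel"
proof -
  have [measurable]: "(\<lambda>x::real^'n. x $ i) \<in> borel_measurable borel" for i
    by (intro borel_measurable_continuous_onI continuous_intros)
  show ?thesis unfolding weight_def[abs_def] by measurable
qed

lemma weight_nonneg: "0 \<le> weight \<alpha> x"
  unfolding weight_def by (intro prod_nonneg) auto

lemma weight_le_jap:
  assumes "\<forall>i. \<alpha> $ i > - 1 / 2"
  shows "weight \<alpha> x \<le> jap x powr (\<Sum>i\<in>UNIV. 2 * \<alpha> $ i + 1)"
proof -
  have "weight \<alpha> x \<le> (\<Prod>i\<in>UNIV. jap x powr (2 * \<alpha> $ i + 1))"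
    unfolding weight_def
  proof (intro prod_mono conjI)
    fix i
    have "0 \<le> 2 * \<alpha> $ i + 1" using assms[rule_format, of i] by simp
    moreover have "max 0 (x $ i) \<le> jap x"
    proof -
      have "\<bar>x $ i\<bar> \<le> jap x powr (1/2)" by (rule norm_component_le_jap)
      also have "\<dots> \<le> jap x powr 1" by (rule powr_mono) auto
      finally show ?thesis by simp
    qed
    ultimately show "max 0 (x $ i) powr (2 * \<alpha> $ i + 1) \<le> jap x powr (2 * \<alpha> $ i + 1)"
      by (intro powr_mono2) auto
  qed auto
  then show ?thesis by (simp add: powr_sum)
qed

lemma pos_orthant_borel [measurable]: "(pos_orthant :: (real^'n::finite) set) \<in> sets borel"
proof -
  have "open (pos_orthant :: (real^'n) set)"
    unfolding pos_orthant_def Collect_all_eq by (auto intro!: open_INT open_Collect_less continuous_intros)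
  then show ?thesis by simp
qed

lemma weight_eq: "weight \<alpha> x = indicator pos_orthant x * (\<Prod>i\<in>UNIV. x $ i powr (2 * \<alpha> $ i + 1))"
proof (cases "x \<in> pos_orthant")
  case True
  then have "max 0 (x $ i) = x $ i" for i unfolding pos_orthant_def by (simp add: less_imp_le)
  then show ?thesis using True by (simp add: weight_def)
next
  case False
  then obtain i where "x $ i \<le> 0" unfolding pos_orthant_def by (auto simp: not_less)
  then have "\<exists>i\<in>UNIV. max 0 (x $ i) powr (2 * \<alpha> $ i + 1) = 0" by (intro bexI[of _ i]) auto
  then have "weight \<alpha> x = 0" unfolding weight_def by (intro prod_zero) auto
  then show ?thesis using False by simp
qed

lemma sets_mu: "sets (mu \<alpha>) = sets (restrict_space borel pos_orthant)"
  by (simp add: mu_def sets_restrict_space)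

lemma space_mu: "space (mu \<alpha>) = pos_orthant"
  by (simp add: mu_def space_restrict_space)

lemma measurable_mu_borel: "f \<in> borel_measurable borel \<Longrightarrow> f \<in> borel_measurable (mu \<alpha>)"
  using measurable_restrict_space1[of f borel borel pos_orthant]
    measurable_cong_sets[OF sets_mu[of \<alpha>] refl, of borel] by blast

text \<open>Moves every integral to Lebesgue measure on the whole space, where translation
  invariance is available for the integration by parts.\<close>

lemma
  fixes f :: "real^'n::finite \<Rightarrow> 'b::{banach, second_countable_topology}"
  assumes f: "f \<in> borel_measurable borel"
  shows integrable_mu_iff: "integrable (mu \<alpha>) f \<longleftrightarrow> integrable lborel (\<lambda>x. weight \<alpha> x *\<^sub>R f x)"
    and integral_mu: "(\<integral>x. f x \<partial>mu \<alpha>) = (\<integral>x. weight \<alpha> x *\<^sub>R f x \<partial>lborel)"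
proof -
  let ?R = "restrict_space (lborel :: (real^'n) measure) pos_orthant"
  let ?w = "\<lambda>x::real^'n. \<Prod>i\<in>UNIV. x $ i powr (2 * \<alpha> $ i + 1)"
  have c[measurable]: "(\<lambda>x::real^'n. x $ i) \<in> borel_measurable borel" for i
    by (intro borel_measurable_continuous_onI continuous_intros)
  have w: "?w \<in> borel_measurable ?R"
    by (rule measurable_restrict_space1) measurable
  have w0: "AE x in ?R. 0 \<le> ?w x" by (intro AE_I2 prod_nonneg) auto
  have f': "f \<in> borel_measurable ?R" using f by (intro measurable_restrict_space1) simp
  have e: "indicator pos_orthant x *\<^sub>R (?w x *\<^sub>R f x) = weight \<alpha> x *\<^sub>R f x" for x
    by (simp add: weight_eq)
  have O: "pos_orthant \<inter> space lborel \<in> sets (lborel :: (real^'n) measure)" by simp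
  show "integrable (mu \<alpha>) f \<longleftrightarrow> integrable lborel (\<lambda>x. weight \<alpha> x *\<^sub>R f x)"
    unfolding mu_def integrable_density[OF f' w w0] integrable_restrict_space[OF O] set_integrable_def e ..
  show "(\<integral>x. f x \<partial>mu \<alpha>) = (\<integral>x. weight \<alpha> x *\<^sub>R f x \<partial>lborel)"
    unfolding mu_def integral_density[OF f' w w0] integral_restrict_space[OF O] set_lebesgue_integral_def e ..
qed

lemma integrable_lborel_decay:
  fixes f :: "real^'n::finite \<Rightarrow> 'b::{banach, second_countable_topology}"
  assumes "f \<in> borel_measurable borel" "\<And>x. norm (f x) \<le> C * jap x powr (- (real CARD('n) + 2))"
  shows "integrable lborel f"
  by (rule Bochner_Integration.integrable_bound[OF integrable_mult_right[OF integrable_jap_powr, of C]])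
    (use assms in \<open>auto intro!: AE_I2 intro: order_trans[OF _ abs_ge_self]\<close>)

text \<open>A function decaying at this rate is integrable against \<open>weight \<alpha>\<close>.\<close>

definition decay_rate :: "real^'n::finite \<Rightarrow> real" where
  "decay_rate \<alpha> = - (real CARD('n) + 2) - (\<Sum>i\<in>UNIV. 2 * \<alpha> $ i + 1)"

lemma weight_decay:
  fixes f :: "real^'n::finite \<Rightarrow> 'b::real_normed_vector"
  assumes a: "\<forall>i. \<alpha> $ i > - 1 / 2" and "norm (f x) \<le> C * jap x powr decay_rate \<alpha>"
  shows "norm (weight \<alpha> x *\<^sub>R f x) \<le> C * jap x powr (- (real CARD('n) + 2))"
proof -
  have "norm (weight \<alpha> x *\<^sub>R f x) = weight \<alpha> x * norm (f x)" by (simp add: weight_nonneg)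
  also have "\<dots> \<le> jap x powr (\<Sum>i\<in>UNIV. 2 * \<alpha> $ i + 1) * (C * jap x powr decay_rate \<alpha>)"
    using assms by (intro mult_mono weight_le_jap) auto
  also have "\<dots> = C * jap x powr (- (real CARD('n) + 2))"
    by (simp add: decay_rate_def mult.left_commute powr_add[symmetric])
  finally show ?thesis .
qed

lemma integrable_mu_decay:
  fixes f :: "real^'n::finite \<Rightarrow> 'b::{banach, second_countable_topology}"
  assumes a: "\<forall>i. \<alpha> $ i > - 1 / 2"
    and f: "f \<in> borel_measurable borel" and b: "\<And>x. norm (f x) \<le> C * jap x powr decay_rate \<alpha>"
  shows "integrable (mu \<alpha>) f"
  unfolding integrable_mu_iff[OF f]
proof (rule integrable_lborel_decay)
  show "(\<lambda>x. weight \<alpha> x *\<^sub>R f x) \<in> borel_measurable borel" using f by measurable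
qed (rule weight_decay[OF a b])

subsection \<open>Continuity of linear maps for seminorm topologies\<close>

text \<open>The estimate speaks of all common upper bounds \<open>r\<close> of the seminorms in
  \<open>F\<close> instead of their maximum. This covers an empty \<open>F\<close> and asks nothing
  of the members of \<open>P\<close> beyond the estimate itself, so that it applies to
  \<open>E_norm\<close> directly.\<close>

lemma continuous_map_seminorm_topology:
  assumes A: "\<And>x. x \<in> V \<Longrightarrow> A x \<in> V'"
    and sub: "\<And>x y. x \<in> V \<Longrightarrow> y \<in> V \<Longrightarrow> y - x \<in> V"
    and lin: "\<And>x y. x \<in> V \<Longrightarrow> y \<in> V \<Longrightarrow> A (y - x) = A y - A x"
    and b: "\<And>q. q \<in> P' \<Longrightarrow> \<exists>F C. finite F \<and> F \<subseteq> P \<and> 0 \<le> C \<and>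
              (\<forall>x\<in>V. \<forall>r\<ge>0. (\<forall>p\<in>F. p x \<le> r) \<longrightarrow> q (A x) \<le> C * r)"
  shows "continuous_map (seminorm_topology V P) (seminorm_topology V' P') A"
  unfolding continuous_map topspace_seminorm_topology
proof (intro conjI allI impI)
  show "A ` V \<subseteq> V'" using A by blast
  fix U assume U: "openin (seminorm_topology V' P') U"
  show "openin (seminorm_topology V P) {x \<in> V. A x \<in> U}"
    unfolding openin_seminorm_topology
  proof (intro conjI ballI)
    fix x assume "x \<in> {x \<in> V. A x \<in> U}"
    then have x: "x \<in> V" "A x \<in> U" by auto
    obtain F' r where F': "finite F'" "F' \<subseteq> P'" "0 < r" "{y \<in> V'. \<forall>q\<in>F'. q (y - A x) < r} \<subseteq> U"
      using U x(2) unfolding openin_seminorm_topology by meson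
    have "\<forall>q\<in>F'. \<exists>F C. finite F \<and> F \<subseteq> P \<and> 0 \<le> C \<and>
              (\<forall>x\<in>V. \<forall>r\<ge>0. (\<forall>p\<in>F. p x \<le> r) \<longrightarrow> q (A x) \<le> C * r)"
      using b F'(2) by blast
    then obtain FF CC where FC: "\<And>q. q \<in> F' \<Longrightarrow> finite (FF q) \<and> FF q \<subseteq> P \<and> 0 \<le> CC q \<and>
              (\<forall>x\<in>V. \<forall>r\<ge>0. (\<forall>p\<in>FF q. p x \<le> r) \<longrightarrow> q (A x) \<le> CC q * r)"
      by metis
    define S where "S = (\<Sum>q\<in>F'. CC q)"
    have S: "0 \<le> S" "\<And>q. q \<in> F' \<Longrightarrow> CC q \<le> S"
      unfolding S_def using FC F'(1) by (auto intro: sum_nonneg member_le_sum)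
    show "\<exists>F r. finite F \<and> F \<subseteq> P \<and> 0 < r \<and> {y \<in> V. \<forall>q\<in>F. q (y - x) < r} \<subseteq> {x \<in> V. A x \<in> U}"
    \<comment> \<open>The denominator 1 + S instead of S keeps the radius meaningful when all
      constants vanish and makes the final inequality strict.\<close>
    proof (intro exI[of _ "\<Union>q\<in>F'. FF q"] exI[of _ "r / (1 + S)"] conjI subsetI)
      show "finite (\<Union>q\<in>F'. FF q)" using F'(1) FC by blast
      show "\<And>p. p \<in> (\<Union>q\<in>F'. FF q) \<Longrightarrow> p \<in> P" using FC by blast
      show "0 < r / (1 + S)" using F'(3) S(1) by simp
      fix y assume y: "y \<in> {y \<in> V. \<forall>q\<in>(\<Union>q\<in>F'. FF q). q (y - x) < r / (1 + S)}"
      have "q (A y - A x) < r" if q: "q \<in> F'" for q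
      proof -
        have "\<forall>p\<in>FF q. p (y - x) \<le> r / (1 + S)" using y q by (auto intro: less_imp_le)
        moreover have "y - x \<in> V" "0 \<le> r / (1 + S)" using y sub[OF x(1)] F'(3) S(1) by auto
        ultimately have "q (A (y - x)) \<le> CC q * (r / (1 + S))"
          using FC[OF q] by blast
        also have "\<dots> \<le> S * (r / (1 + S))"
          using S(2)[OF q] S(1) F'(3) by (intro mult_right_mono) auto
        also have "\<dots> < r" using S(1) F'(3) by (simp add: field_simps)
        finally show ?thesis using lin[OF x(1)] y by simp
      qed
      then have "A y \<in> U" using F'(4) y A by blast
      then show "y \<in> {x \<in> V. A x \<in> U}" using y by blast
    qed
  qed auto
qed

subsection \<open>Estimates by Schwartz seminorms\<close>

text \<open>Says that \<open>Q f x\<close> is bounded, uniformly in \<open>x\<close>, by a constant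
  times the maximum of finitely many Schwartz seminorms of \<open>f\<close>. As a property of
  \<open>Q\<close> it is closed under sums and multiples, so continuity estimates can be assembled
  without carrying constants and finite sets.\<close>

definition schwartz_dominated :: "((real^'n::finite \<Rightarrow> complex) \<Rightarrow> real^'n \<Rightarrow> real) \<Rightarrow> bool" where
  "schwartz_dominated Q \<longleftrightarrow> (\<exists>F C. finite F \<and> 0 \<le> C \<and> (\<forall>f\<in>schwartz_even. \<forall>r\<ge>0.
     (\<forall>p\<in>F. schwartz_seminorm (fst p) (snd p) f \<le> r) \<longrightarrow> (\<forall>x. Q f x \<le> C * r)))"

lemma schwartz_dominatedI:
  assumes "finite F" "0 \<le> C" "\<And>f r x. f \<in> schwartz_even \<Longrightarrow> 0 \<le> r \<Longrightarrow>
     \<forall>p\<in>F. schwartz_seminorm (fst p) (snd p) f \<le> r \<Longrightarrow> Q f x \<le> C * r"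
  shows "schwartz_dominated Q"
  unfolding schwartz_dominated_def
  by (intro exI[of _ F] exI[of _ C] conjI ballI allI impI assms(1,2)) (rule assms(3))

lemma schwartz_dominatedE:
  assumes "schwartz_dominated Q"
  obtains F C where "finite F" "0 \<le> C" "\<forall>f r x. f \<in> schwartz_even \<longrightarrow> 0 \<le> r \<longrightarrow>
     (\<forall>p\<in>F. schwartz_seminorm (fst p) (snd p) f \<le> r) \<longrightarrow> Q f x \<le> C * r"
  using assms unfolding schwartz_dominated_def by blast

lemma bdd_above_schwartz_seminorm:
  assumes "f \<in> schwartz_even"
  shows "bdd_above (range (\<lambda>x. jap x ^ m * norm (partials is f x)))"
proof -
  obtain C where "\<And>x. norm (jap x ^ m *\<^sub>R partials is f x) \<le> C"
    using assms unfolding schwartz_even_def bounded_iff by blast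
  then have "jap x ^ m * norm (partials is f x) \<le> C" for x by (simp add: abs_of_nonneg)
  then show ?thesis by (intro bdd_aboveI2)
qed

lemma schwartz_seminorm_upper:
  assumes "f \<in> schwartz_even"
  shows "jap x ^ m * norm (partials is f x) \<le> schwartz_seminorm m is f"
  unfolding schwartz_seminorm_def by (rule cSUP_upper[OF UNIV_I bdd_above_schwartz_seminorm[OF assms]])

lemma schwartz_dominated_schwartz_seminorm: "schwartz_dominated (\<lambda>f x. schwartz_seminorm m is f)"
  by (rule schwartz_dominatedI[of "{(m, is)}" 1]) auto

lemma schwartz_dominated_mono:
  assumes "schwartz_dominated Q" "\<And>f x. f \<in> schwartz_even \<Longrightarrow> R f x \<le> Q f x"
  shows "schwartz_dominated R"
proof -
  obtain F C where FC: "finite F" "0 \<le> C" "\<forall>f r x. f \<in> schwartz_even \<longrightarrow> 0 \<le> r \<longrightarrow>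
     (\<forall>p\<in>F. schwartz_seminorm (fst p) (snd p) f \<le> r) \<longrightarrow> Q f x \<le> C * r"
    by (rule schwartz_dominatedE[OF assms(1)])
  show ?thesis
    by (rule schwartz_dominatedI[OF FC(1,2)]) (use order_trans[OF assms(2)] FC(3) in blast)
qed

lemma schwartz_dominated_seminorm:
  "schwartz_dominated (\<lambda>f x. jap x ^ m * norm (partials is f x))"
  by (rule schwartz_dominated_mono[OF schwartz_dominated_schwartz_seminorm schwartz_seminorm_upper])

lemma schwartz_dominated_add:
  assumes "schwartz_dominated Q" "schwartz_dominated R"
  shows "schwartz_dominated (\<lambda>f x. Q f x + R f x)"
proof -
  obtain F C where FC: "finite F" "0 \<le> C" "\<forall>f r x. f \<in> schwartz_even \<longrightarrow> 0 \<le> r \<longrightarrow>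
     (\<forall>p\<in>F. schwartz_seminorm (fst p) (snd p) f \<le> r) \<longrightarrow> Q f x \<le> C * r"
    by (rule schwartz_dominatedE[OF assms(1)])
  obtain G D where GD: "finite G" "0 \<le> D" "\<forall>f r x. f \<in> schwartz_even \<longrightarrow> 0 \<le> r \<longrightarrow>
     (\<forall>p\<in>G. schwartz_seminorm (fst p) (snd p) f \<le> r) \<longrightarrow> R f x \<le> D * r"
    by (rule schwartz_dominatedE[OF assms(2)])
  show ?thesis
  proof (rule schwartz_dominatedI[of "F \<union> G" "C + D"])
    fix f :: "real^'a \<Rightarrow> complex" and r x
    assume f: "f \<in> schwartz_even" "0 \<le> r" and m: "\<forall>p\<in>F \<union> G. schwartz_seminorm (fst p) (snd p) f \<le> r"
    have "Q f x \<le> C * r" using FC(3) f m by blast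
    moreover have "R f x \<le> D * r" using GD(3) f m by blast
    ultimately show "Q f x + R f x \<le> (C + D) * r" by (simp add: distrib_right)
  qed (use FC(1,2) GD(1,2) in auto)
qed

lemma schwartz_dominated_cmult:
  assumes "schwartz_dominated Q" "0 \<le> c"
  shows "schwartz_dominated (\<lambda>f x. c * Q f x)"
proof -
  obtain F C where FC: "finite F" "0 \<le> C" "\<forall>f r x. f \<in> schwartz_even \<longrightarrow> 0 \<le> r \<longrightarrow>
     (\<forall>p\<in>F. schwartz_seminorm (fst p) (snd p) f \<le> r) \<longrightarrow> Q f x \<le> C * r"
    by (rule schwartz_dominatedE[OF assms(1)])
  show ?thesis
  proof (rule schwartz_dominatedI[of F "c * C"])
    fix f :: "real^'a \<Rightarrow> complex" and r x
    assume f: "f \<in> schwartz_even" "0 \<le> r" and m: "\<forall>p\<in>F. schwartz_seminorm (fst p) (snd p) f \<le> r"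
    show "c * Q f x \<le> c * C * r"
      using mult_left_mono[OF FC(3)[rule_format, OF f] assms(2)] m by (simp add: mult.assoc)
  qed (use FC(1,2) assms(2) in auto)
qed

lemma schwartz_dominated_zero: "schwartz_dominated (\<lambda>f x. 0)"
  by (rule schwartz_dominatedI[of "{}" 0]) auto

lemma schwartz_dominated_sum:
  "finite I \<Longrightarrow> (\<And>i. i \<in> I \<Longrightarrow> schwartz_dominated (Q i)) \<Longrightarrow> schwartz_dominated (\<lambda>f x. \<Sum>i\<in>I. Q i f x)"
proof (induction rule: finite_induct)
  case empty
  show ?case using schwartz_dominated_zero by simp
next
  case (insert i I)
  then show ?case using schwartz_dominated_add[of "Q i" "\<lambda>f x. \<Sum>i\<in>I. Q i f x"] by simp
qed

lemma schwartz_dominated_sum_list: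
  "(\<And>i. i \<in> set I \<Longrightarrow> schwartz_dominated (Q i)) \<Longrightarrow> schwartz_dominated (\<lambda>f x. \<Sum>i\<leftarrow>I. Q i f x)"
proof (induction I)
  case Nil
  show ?case using schwartz_dominated_zero by simp
next
  case (Cons i I)
  then show ?case using schwartz_dominated_add[of "Q i" "\<lambda>f x. \<Sum>i\<leftarrow>I. Q i f x"] by simp
qed

lemma schwartz_dominated_bound:
  assumes "schwartz_dominated Q" "f \<in> schwartz_even"
  obtains C where "\<And>x. Q f x \<le> C"
proof -
  obtain F C where FC: "finite F" "0 \<le> C" "\<forall>f r x. f \<in> schwartz_even \<longrightarrow> 0 \<le> r \<longrightarrow>
     (\<forall>p\<in>F. schwartz_seminorm (fst p) (snd p) f \<le> r) \<longrightarrow> Q f x \<le> C * r"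
    by (rule schwartz_dominatedE[OF assms(1)])
  \<comment> \<open>A sum of absolute values is nonnegative and exceeds each of the finitely many
    seminorms.\<close>
  define r where "r = (\<Sum>p\<in>F. \<bar>schwartz_seminorm (fst p) (snd p) f\<bar>)"
  have "schwartz_seminorm (fst p) (snd p) f \<le> r" if "p \<in> F" for p
  proof -
    have "\<bar>schwartz_seminorm (fst p) (snd p) f\<bar> \<le> r"
      unfolding r_def by (rule member_le_sum[OF that _ FC(1)]) auto
    then show ?thesis by linarith
  qed
  moreover have "0 \<le> r" unfolding r_def by (intro sum_nonneg) auto
  ultimately have "Q f x \<le> C * r" for x using FC(3) assms(2) by blast
  then show ?thesis by (rule that)
qed

subsection \<open>Division of an odd derivative by the coordinate\<close>

text \<open>For even \<open>f\<close>, the quotient \<open>q = \<partial>\<^sub>i f / x\<^sub>i\<close> is the average of \<open>\<partial>\<^sub>i\<^sup>2 f\<close> over the dilations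
  \<open>x\<^sub>i \<mapsto> t x\<^sub>i\<close>. This shows smoothness but loses the decay in \<open>x\<^sub>i\<close>; for \<open>|x\<^sub>i| \<ge> 1\<close> the decay is
  recovered by differentiating the identity \<open>x\<^sub>i q = \<partial>\<^sub>i f\<close>.\<close>

abbreviation shrink :: "'n::finite \<Rightarrow> real \<Rightarrow> real^'n \<Rightarrow> real^'n" where
  "shrink i t x \<equiv> (\<chi> j. if j = i then t * x $ j else x $ j)"

text \<open>Every derivative in direction \<open>i\<close> of \<open>g (shrink i t x)\<close> brings
  out a factor t; the exponent \<open>c\<close> counts these factors.\<close>

abbreviation shrink_term :: "'n::finite \<Rightarrow> nat \<Rightarrow> (real^'n \<Rightarrow> complex) \<Rightarrow> real^'n \<Rightarrow> real \<Rightarrow> complex" where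
  "shrink_term i c g x t \<equiv> indicator {0..1} t *\<^sub>R (t ^ c *\<^sub>R g (shrink i t x))"

definition shrink_avg :: "'n::finite \<Rightarrow> nat \<Rightarrow> (real^'n \<Rightarrow> complex) \<Rightarrow> real^'n \<Rightarrow> complex" where
  "shrink_avg i c g x = (integral\<^sup>L lborel (shrink_term i c g x))"

lemma shrink_eq: "shrink i t x = x + ((t - 1) * x $ i) *\<^sub>R axis i 1"
  by (auto simp: vec_eq_iff axis_def algebra_simps)

lemma continuous_shrink: "continuous_on UNIV (\<lambda>t. shrink i t x)"
  unfolding shrink_eq by (intro continuous_intros)

lemma shrink_integrand_measurable:
  assumes "smooth_fun g"
  shows "(shrink_term i c g x) \<in> borel_measurable borel"
proof -
  have "continuous_on UNIV (\<lambda>t. g (shrink i t x))"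
    using continuous_on_compose2[OF smooth_fun_continuous[OF assms] continuous_shrink] by auto
  then have [measurable]: "(\<lambda>t. g (shrink i t x)) \<in> borel_measurable borel"
    by (rule borel_measurable_continuous_onI)
  show ?thesis by measurable
qed

lemma shrink_integrand_bound:
  assumes "t \<in> {0..1} \<Longrightarrow> norm (g (shrink i t x)) \<le> C"
  shows "norm (shrink_term i c g x t) \<le> indicator {0..1} t *\<^sub>R C"
proof (cases "t \<in> {0..1}")
  case True
  then have "\<bar>t\<bar> ^ c * norm (g (shrink i t x)) \<le> 1 * C"
    using assms by (intro mult_mono power_le_one) auto
  then show ?thesis using True by (simp add: power_abs)
qed auto

lemma integrable_indicator_unit: "integrable lborel (\<lambda>t::real. indicator {0..1} t *\<^sub>R (C::real))"
  by (intro integrable_scaleR_left integrable_real_indicator) auto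

lemma symbols0_bound:
  assumes "g \<in> symbols 0"
  obtains C where "\<And>x. norm (g x) \<le> C"
proof -
  obtain C where "\<And>x. norm (g x) \<le> C * jap x powr 0" using symbols_bound[OF assms] by blast
  then have "norm (g x) \<le> C" for x by (metis jap_pos(2) mult.right_neutral powr_zero_eq_one)
  with that show ?thesis by blast
qed

lemma shrink_integrand_integrable:
  assumes "g \<in> symbols 0"
  shows "integrable lborel (shrink_term i c g x)"
proof -
  obtain C where C: "\<And>x. norm (g x) \<le> C" using symbols0_bound[OF assms] by blast
  show ?thesis
    by (rule Bochner_Integration.integrable_bound[OF integrable_indicator_unit[of C]])
      (use shrink_integrand_measurable[OF symbols_smooth[OF assms]] shrink_integrand_bound[of _ g i x C, OF C]
        in \<open>auto intro!: AE_I2 intro: order_trans[OF _ abs_ge_self]\<close>)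
qed

lemma norm_shrink_avg_le:
  assumes "g \<in> symbols 0" and C: "\<And>t. t \<in> {0..1} \<Longrightarrow> norm (g (shrink i t x)) \<le> C"
  shows "norm (shrink_avg i c g x) \<le> C"
proof -
  have "norm (shrink_avg i c g x) \<le> (\<integral>t. indicator {0..1::real} t *\<^sub>R C \<partial>lborel)"
    unfolding shrink_avg_def
  proof (rule Bochner_Integration.integral_norm_bound_integral)
    show "norm (shrink_term i c g x t) \<le> indicator {0..1} t *\<^sub>R C" for t
      by (rule shrink_integrand_bound) (rule C)
  qed (rule shrink_integrand_integrable[OF assms(1)] integrable_indicator_unit)+
  then show ?thesis by simp
qed

lemma has_derivative_shrink_integrand:
  assumes "smooth_fun g"
  shows "((\<lambda>y. shrink_term i c g y t) has_derivative
    (\<lambda>h. \<Sum>j\<in>UNIV. (h $ j) *\<^sub>R (shrink_term i (if j = i then Suc c else c) (partial_deriv j g) y t))) (at y)"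
proof -
  have "bounded_linear (shrink i t)"
    unfolding linear_conv_bounded_linear[symmetric]
    by (rule linearI) (auto simp: vec_eq_iff algebra_simps)
  then have "(shrink i t has_derivative shrink i t) (at y)"
    by (rule bounded_linear_imp_has_derivative)
  from has_derivative_compose[OF this has_derivative_partials[OF smooth_fun_differentiable[OF assms]]]
  have "((\<lambda>y. g (shrink i t y)) has_derivative
      (\<lambda>h. \<Sum>j\<in>UNIV. (shrink i t h $ j) *\<^sub>R partial_deriv j g (shrink i t y))) (at y)" .
  then have "((\<lambda>y. shrink_term i c g y t) has_derivative
    (\<lambda>h. indicator {0..1} t *\<^sub>R (t ^ c *\<^sub>R (\<Sum>j\<in>UNIV. (shrink i t h $ j) *\<^sub>R partial_deriv j g (shrink i t y))))) (at y)"
    by (intro has_derivative_scaleR_right)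
  moreover have "indicator {0..1} t *\<^sub>R (t ^ c *\<^sub>R (\<Sum>j\<in>UNIV. (shrink i t h $ j) *\<^sub>R partial_deriv j g (shrink i t y)))
    = (\<Sum>j\<in>UNIV. (h $ j) *\<^sub>R (shrink_term i (if j = i then Suc c else c) (partial_deriv j g) y t))" for h
    unfolding scaleR_sum_right by (rule sum.cong) (auto simp: mult_ac)
  ultimately show ?thesis by simp
qed

lemma has_derivative_shrink_avg:
  assumes g: "g \<in> symbols 0"
  shows "(shrink_avg i c g has_derivative
    (\<lambda>h. \<Sum>j\<in>UNIV. (h $ j) *\<^sub>R shrink_avg i (if j = i then Suc c else c) (partial_deriv j g) x)) (at x)"
proof -
  note s = symbols_smooth[OF g]
  have "\<exists>C. \<forall>x. norm (partial_deriv l (partial_deriv j g) x) \<le> C" for l j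
    using symbols0_bound[OF symbols_partial_deriv[OF symbols_partial_deriv[OF g]]] by blast
  then obtain CC where CC: "\<And>l j x. norm (partial_deriv l (partial_deriv j g) x) \<le> CC l j" by metis
  define C where "C = (\<Sum>l\<in>UNIV. \<Sum>j\<in>UNIV. CC l j)"
  have CC0: "0 \<le> CC l j" for l j using CC norm_ge_zero order_trans by blast
  have C: "norm (partial_deriv l (partial_deriv j g) x) \<le> C" for l j x
  proof -
    have "CC l j \<le> (\<Sum>j\<in>UNIV. CC l j)" using CC0 by (intro member_le_sum) auto
    also have "\<dots> \<le> C" unfolding C_def
      using CC0 by (intro member_le_sum[of l UNIV "\<lambda>l. \<Sum>j\<in>UNIV. CC l j"]) (auto intro: sum_nonneg)
    finally show ?thesis using CC order_trans by blast
  qed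
  show ?thesis
    unfolding shrink_avg_def
  proof (rule has_derivative_integral)
    fix j l y and t :: real
    show "((\<lambda>y. shrink_term i (if j = i then Suc c else c) (partial_deriv j g) y t) has_derivative
      (\<lambda>h. \<Sum>l\<in>UNIV. (h $ l) *\<^sub>R (shrink_term i (if l = i then Suc (if j = i then Suc c else c) else (if j = i then Suc c else c)) (partial_deriv l (partial_deriv j g)) y t))) (at y)"
      by (rule has_derivative_shrink_integrand[OF smooth_fun_partial_deriv[OF s]])
    show "norm (shrink_term i (if l = i then Suc (if j = i then Suc c else c) else (if j = i then Suc c else c)) (partial_deriv l (partial_deriv j g)) y t) \<le> indicator {0..1} t *\<^sub>R C"
      by (rule shrink_integrand_bound) (rule C)
  qed (intro has_derivative_shrink_integrand s shrink_integrand_integrable symbols_partial_deriv g integrable_indicator_unit)+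
qed

lemma partial_deriv_shrink_avg:
  "g \<in> symbols 0 \<Longrightarrow> partial_deriv j (shrink_avg i c g) = shrink_avg i (if j = i then Suc c else c) (partial_deriv j g)"
  using partial_deriv_eq_sumI[OF has_derivative_shrink_avg] by blast

text \<open>The new exponent stays existential because on the unit interval any power of t is at
  most 1, and no estimate depends on which one it is.\<close>

lemma partials_shrink_avg:
  "\<exists>c'. \<forall>g\<in>symbols 0. partials is (shrink_avg i c g) = shrink_avg i c' (partials is g)"
proof (induction "is")
  case Nil
  show ?case by (intro exI[of _ c]) simp
next
  case (Cons j "is")
  then obtain c' where "\<forall>g\<in>symbols 0. partials is (shrink_avg i c g) = shrink_avg i c' (partials is g)" by blast
  then show ?case
    by (intro exI[of _ "if j = i then Suc c' else c'"]) (auto simp: partial_deriv_shrink_avg symbols_partials)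
qed

lemma smooth_shrink_avg:
  assumes "g \<in> symbols 0"
  shows "smooth_fun (shrink_avg i c g)"
proof -
  have "shrink_avg i c g \<in> symbols 0"
  proof (rule symbols_coinduct[of _ "{shrink_avg i c g | c g. g \<in> symbols 0}"])
    fix h assume "h \<in> {shrink_avg i c g | c g. g \<in> symbols 0}"
    then obtain c g where h: "h = shrink_avg i c g" and g: "g \<in> symbols 0" by blast
    show "h differentiable (at x)" for x
      unfolding h differentiable_def using has_derivative_shrink_avg[OF g] by blast
    obtain C where "\<And>x. norm (g x) \<le> C" using symbols0_bound[OF g] by blast
    then have "norm (h x) \<le> C * jap x powr 0" for x unfolding h by (simp add: norm_shrink_avg_le[OF g])
    then show "\<exists>C. \<forall>x. norm (h x) \<le> C * jap x powr 0" by blast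
    show "partial_deriv j h \<in> {shrink_avg i c g | c g. g \<in> symbols 0}" for j
      unfolding h partial_deriv_shrink_avg[OF g] using symbols_partial_deriv[OF g] by blast
  qed (use assms in blast)
  then show ?thesis by (rule symbols_smooth)
qed

section \<open>Parity and the quotient by a coordinate\<close>

lemma partial_deriv_flip:
  fixes f :: "real^'n::finite \<Rightarrow> complex"
  assumes "smooth_fun f" and c: "\<And>x. f (flip i x) = c * f x"
  shows "partial_deriv j f (flip i x) = (if j = i then - c else c) * partial_deriv j f x"
proof -
  have "bounded_linear (flip i)"
    unfolding linear_conv_bounded_linear[symmetric]
    by (rule linearI) (auto simp: vec_eq_iff)
  then have "(flip i has_derivative flip i) (at x)"
    by (rule bounded_linear_imp_has_derivative)
  from has_derivative_compose[OF this has_derivative_partials[OF smooth_fun_differentiable[OF assms(1)]]]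
  have "((\<lambda>x. f (flip i x)) has_derivative
      (\<lambda>h. \<Sum>l\<in>UNIV. (flip i h $ l) *\<^sub>R partial_deriv l f (flip i x))) (at x)" .
  then have "partial_deriv j (\<lambda>x. f (flip i x)) x = (\<Sum>l\<in>UNIV. (flip i (axis j 1) $ l) *\<^sub>R partial_deriv l f (flip i x))"
    by (rule partial_deriv_eqI)
  also have "\<dots> = (\<Sum>l\<in>UNIV. (axis j 1 $ l) *\<^sub>R ((if l = i then - 1 else 1) * partial_deriv l f (flip i x)))"
    by (rule sum.cong) auto
  finally have "partial_deriv j (\<lambda>x. f (flip i x)) x = (if j = i then - 1 else 1) * partial_deriv j f (flip i x)"
    unfolding sum_axis_scaleR .
  moreover have "partial_deriv j (\<lambda>x. f (flip i x)) x = c * partial_deriv j f x"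
    using partials_cmult[OF assms(1), of "[j]" c] by (simp add: c)
  ultimately show ?thesis by (auto split: if_splits simp: minus_equation_iff)
qed

definition radial_quot :: "'n::finite \<Rightarrow> (real^'n \<Rightarrow> complex) \<Rightarrow> real^'n \<Rightarrow> complex" where
  "radial_quot i f x = (if x $ i = 0 then partial_deriv i (partial_deriv i f) x
        else partial_deriv i f x / of_real (x $ i))"

definition axial_laplace :: "real^'n::finite \<Rightarrow> 'n \<Rightarrow> (real^'n \<Rightarrow> complex) \<Rightarrow> real^'n \<Rightarrow> complex" where
  "axial_laplace \<alpha> i f x = partial_deriv i (partial_deriv i f) x + of_real (2 * \<alpha> $ i + 1) * radial_quot i f x"

lemma laplace_axial: "laplace \<alpha> f x = (\<Sum>i\<in>UNIV. axial_laplace \<alpha> i f x)"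
  by (simp add: laplace_def axial_laplace_def radial_quot_def)

lemma partial_deriv_even_zero:
  assumes "smooth_fun f" "even_fun f" "x $ i = 0"
  shows "partial_deriv i f x = 0"
proof -
  have "flip i x = x" using assms(3) by (auto simp: vec_eq_iff)
  moreover have "partial_deriv i f (flip i x) = - 1 * partial_deriv i f x"
    using partial_deriv_flip[OF assms(1), of i 1 i x] assms(2) by (simp add: even_fun_def)
  ultimately show ?thesis by simp
qed

text \<open>\<open>partial_deriv i f\<close> is odd in the i-th coordinate, so it vanishes at the
  start t = 0 of the dilation path, and the fundamental theorem of calculus yields the coordinate
  times the average. On the hyperplane itself the dilations fix x, and the average is the value that
  \<open>laplace\<close> prescribes there.\<close>

lemma radial_quot_eq_avg:
  assumes "smooth_fun f" "even_fun f"
  shows "radial_quot i f = shrink_avg i 0 (partial_deriv i (partial_deriv i f))"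
proof
  fix x
  show "radial_quot i f x = shrink_avg i 0 (partial_deriv i (partial_deriv i f)) x"
  proof (cases "x $ i = 0")
    case True
    then have "shrink i t x = x" for t by (auto simp: vec_eq_iff)
    then show ?thesis using True by (simp add: radial_quot_def shrink_avg_def)
  next
    case False
    let ?g = "partial_deriv i f" and ?x0 = "shrink i 0 x"
    note sg = smooth_fun_partial_deriv[OF assms(1), of i]
    have "((\<lambda>t. ?g (shrink i t x)) has_vector_derivative (x $ i) *\<^sub>R partial_deriv i ?g (shrink i t x)) (at t)" for t
    proof -
      have "((\<lambda>t. (t - 1) * x $ i) has_vector_derivative x $ i) (at t)"
        by (auto intro!: derivative_eq_intros simp: has_real_derivative_iff_has_vector_derivative[symmetric])
      from vector_diff_chain_at[OF this has_vector_derivative_line[OF smooth_fun_differentiable[OF sg]]]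
      show ?thesis unfolding shrink_eq o_def .
    qed
    moreover have "continuous_on UNIV (\<lambda>t. partial_deriv i ?g (shrink i t x))"
      using continuous_on_compose2[OF smooth_fun_continuous[OF smooth_fun_partial_deriv[OF sg]] continuous_shrink] by auto
    ultimately have "(\<integral>t. indicator {0..1} t *\<^sub>R ((x $ i) *\<^sub>R partial_deriv i ?g (shrink i t x)) \<partial>lborel) =
      ?g (shrink i 1 x) - ?g (shrink i 0 x)"
      by (intro integral_FTC_Icc[where F = "\<lambda>t. ?g (shrink i t x)"])
        (auto intro: has_vector_derivative_at_within continuous_on_subset intro!: continuous_intros)
    also have "?g (shrink i 0 x) = 0"
      by (rule partial_deriv_even_zero[OF assms]) simp
    also have "shrink i 1 x = x" by (auto simp: vec_eq_iff)
    also have "(\<integral>t. indicator {0..1} t *\<^sub>R ((x $ i) *\<^sub>R partial_deriv i ?g (shrink i t x)) \<partial>lborel)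
      = (x $ i) *\<^sub>R shrink_avg i 0 (partial_deriv i ?g) x"
      unfolding shrink_avg_def integral_scaleR_right[symmetric]
      by (rule Bochner_Integration.integral_cong) auto
    finally have "of_real (x $ i) * shrink_avg i 0 (partial_deriv i ?g) x = ?g x"
      by (simp add: scaleR_conv_of_real)
    then show ?thesis using False by (simp add: radial_quot_def field_simps)
  qed
qed

text \<open>Lists the results of deleting one occurrence of \<open>i\<close>, with multiplicity: the
  terms of the commutator of \<open>partials is\<close> with multiplication by the i-th
  coordinate.\<close>

fun deletions :: "'a \<Rightarrow> 'a list \<Rightarrow> 'a list list" where
  "deletions i [] = []"
| "deletions i (j # is) = (if j = i then [is] else []) @ map ((#) j) (deletions i is)"

lemma length_deletions: "l \<in> set (deletions i is) \<Longrightarrow> Suc (length l) = length is"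
  by (induction "is" arbitrary: l) (auto split: if_splits)

lemma partial_deriv_sum_list:
  assumes "\<And>l. l \<in> set ls \<Longrightarrow> smooth_fun (f l)"
  shows "(\<forall>x. (\<lambda>x. \<Sum>l\<leftarrow>ls. f l x) differentiable (at x)) \<and>
    partial_deriv j (\<lambda>x. \<Sum>l\<leftarrow>ls. f l x) = (\<lambda>x. \<Sum>l\<leftarrow>ls. partial_deriv j (f l) x)"
  using assms
proof (induction ls)
  case (Cons l ls)
  then have IH: "(\<forall>x. (\<lambda>x. \<Sum>l\<leftarrow>ls. f l x) differentiable (at x))"
    "partial_deriv j (\<lambda>x. \<Sum>l\<leftarrow>ls. f l x) = (\<lambda>x. \<Sum>l\<leftarrow>ls. partial_deriv j (f l) x)" by auto
  have d: "f l differentiable (at x)" for x using Cons.prems smooth_fun_differentiable by auto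
  have "partial_deriv j (\<lambda>x. f l x + (\<Sum>l\<leftarrow>ls. f l x)) x = partial_deriv j (f l) x + (\<Sum>l\<leftarrow>ls. partial_deriv j (f l) x)" for x
    using partial_deriv_add[OF d, of "\<lambda>x. \<Sum>l\<leftarrow>ls. f l x" x j] IH by simp
  then show ?case using IH(1) d by (auto intro: differentiable_add)
qed auto

lemma norm_sum_list_le: "norm (\<Sum>l\<leftarrow>ls. f l) \<le> (\<Sum>l\<leftarrow>ls. norm (f l))"
  for f :: "'a \<Rightarrow> 'b::real_normed_vector"
  by (induction ls) (auto intro: order_trans[OF norm_triangle_ineq])

text \<open>In the Leibniz rule at most one derivative can fall on a linear factor. Solved for the
  top term, the rule bounds a derivative of \<open>q\<close>, multiplied by the coordinate, by a
  derivative of \<open>g\<close> and by derivatives of \<open>q\<close> of one order less.\<close>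

lemma coord_times_partials:
  assumes q: "smooth_fun q" and eq: "\<And>x. of_real (x $ i) * q x = g x" and g: "smooth_fun g"
  shows "of_real (x $ i) * partials is q x = partials is g x - (\<Sum>l\<leftarrow>deletions i is. partials l q x)"
proof (induction "is" arbitrary: x)
  case (Cons j "is")
  let ?S = "\<lambda>x. \<Sum>l\<leftarrow>deletions i is. partials l q x"
  have S: "?S differentiable (at x)" "partial_deriv j ?S = (\<lambda>x. \<Sum>l\<leftarrow>deletions i is. partials (j # l) q x)" for x
    using partial_deriv_sum_list[of "deletions i is" "\<lambda>l. partials l q" j] smooth_fun_partials[OF q] by auto
  have c: "(\<lambda>x. complex_of_real (x $ i)) differentiable (at x)" for x
    using has_derivative_coord unfolding differentiable_def by blast
  have "(\<lambda>x. of_real (x $ i) * partials is q x) = (\<lambda>x. partials is g x - ?S x)"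
    using Cons by blast
  then have "partial_deriv j (\<lambda>x. of_real (x $ i) * partials is q x) x = partial_deriv j (\<lambda>x. partials is g x - ?S x) x"
    by simp
  moreover have "partial_deriv j (\<lambda>x. of_real (x $ i) * partials is q x) x =
     (if i = j then 1 else 0) * partials is q x + of_real (x $ i) * partial_deriv j (partials is q) x"
    using partial_deriv_mult[OF c smooth_fun_differentiable[OF smooth_fun_partials[OF q]]] by (simp add: partial_deriv_coord)
  moreover have "partial_deriv j (\<lambda>x. partials is g x - ?S x) x = partial_deriv j (partials is g) x - (\<Sum>l\<leftarrow>deletions i is. partials (j # l) q x)"
    using partial_deriv_diff[OF smooth_fun_differentiable[OF smooth_fun_partials[OF g]] S(1)] S(2) by simp
  ultimately show ?case
    by (auto simp: o_def algebra_simps)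
qed (simp add: eq)

text \<open>Only the i-th square is affected, and it is at most 1. Near the hyperplane the dilations
  therefore cost a factor 2 at most, and the average keeps the decay in the remaining
  coordinates.\<close>

lemma jap_shrink:
  assumes "\<bar>x $ i\<bar> \<le> 1"
  shows "jap x \<le> 2 * jap (shrink i t x)"
proof -
  have "(norm x)\<^sup>2 = (\<Sum>j\<in>UNIV. (x $ j)\<^sup>2)" by (rule norm_power2_vec)
  also have "\<dots> \<le> (\<Sum>j\<in>UNIV. (shrink i t x $ j)\<^sup>2 + (if j = i then 1 else 0))"
    using assms by (intro sum_mono) (auto simp: abs_square_le_1 add_increasing)
  also have "\<dots> = (norm (shrink i t x))\<^sup>2 + 1" by (simp add: sum.distrib norm_power2_vec)
  finally have "(norm x)\<^sup>2 \<le> (norm (shrink i t x))\<^sup>2 + 1" .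
  moreover have "0 \<le> (norm (shrink i t x))\<^sup>2" by (rule zero_le_power2)
  moreover have "1 + a \<le> 2 * (1 + b)" if "a \<le> b + 1" "0 \<le> b" for a b :: real using that by simp
  ultimately show ?thesis by blast
qed

lemma radial_quot_smooth:
  assumes "f \<in> schwartz_even"
  shows "smooth_fun (radial_quot i f)"
proof -
  have "smooth_fun f" "even_fun f" using assms by (auto simp: schwartz_even_def)
  then show ?thesis
    unfolding radial_quot_eq_avg[OF \<open>smooth_fun f\<close> \<open>even_fun f\<close>]
    by (intro smooth_shrink_avg symbols_partial_deriv schwartz_even_symbols assms)
qed

lemma radial_quot_near:
  "\<exists>C\<ge>0. \<forall>f\<in>schwartz_even. \<forall>x. \<bar>x $ i\<bar> \<le> 1 \<longrightarrow>
     jap x ^ m * norm (partials is (radial_quot i f) x) \<le> C * schwartz_seminorm m (is @ [i, i]) f"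
proof (intro exI[of _ "2 ^ m"] conjI ballI allI impI)
  fix f :: "real^'a \<Rightarrow> complex" and x :: "real^'a" assume f: "f \<in> schwartz_even" and x: "\<bar>x $ i\<bar> \<le> 1"
  obtain c' where c': "\<forall>g\<in>symbols 0. partials is (shrink_avg i 0 g) = shrink_avg i c' (partials is g)"
    using partials_shrink_avg[of "is" i 0] by blast
  have s: "smooth_fun f" "even_fun f" using f by (auto simp: schwartz_even_def)
  let ?g = "partial_deriv i (partial_deriv i f)"
  have g: "?g \<in> symbols 0" by (intro symbols_partial_deriv schwartz_even_symbols f)
  have pg: "partials is ?g = partials (is @ [i, i]) f" by (simp add: partials_append)
  let ?C = "2 ^ m * schwartz_seminorm m (is @ [i, i]) f / jap x ^ m"
  have "norm (shrink_avg i c' (partials is ?g) x) \<le> ?C"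
  proof (rule norm_shrink_avg_le)
    show "partials is ?g \<in> symbols 0" by (rule symbols_partials[OF g])
    fix t :: real
    let ?y = "shrink i t x"
    have "jap x ^ m * norm (partials is ?g ?y) \<le> (2 * jap ?y) ^ m * norm (partials is ?g ?y)"
      by (intro mult_right_mono power_mono jap_shrink x) auto
    also have "\<dots> = 2 ^ m * (jap ?y ^ m * norm (partials (is @ [i, i]) f ?y))"
      unfolding power_mult_distrib pg by (simp only: mult.assoc)
    also have "\<dots> \<le> 2 ^ m * schwartz_seminorm m (is @ [i, i]) f"
      by (intro mult_left_mono schwartz_seminorm_upper f) auto
    finally show "norm (partials is ?g ?y) \<le> ?C"
      by (subst pos_le_divide_eq) (auto simp: mult.commute)
  qed
  then show "jap x ^ m * norm (partials is (radial_quot i f) x) \<le> 2 ^ m * schwartz_seminorm m (is @ [i, i]) f"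
    unfolding radial_quot_eq_avg[OF s] c'[rule_format, OF g]
    by (subst (asm) pos_le_divide_eq) (auto simp: mult.commute)
qed auto

text \<open>Induction on the number of derivatives. Where |x_i| \<le> 1 the average representation
  gives the bound; elsewhere multiplication by x_i only enlarges, and
  \<open>coord_times_partials\<close> reduces to shorter lists.\<close>

lemma schwartz_dominated_radial_quot:
  "schwartz_dominated (\<lambda>f x. jap x ^ m * norm (partials is (radial_quot i f) x))"
proof (induction "length is" arbitrary: "is" rule: less_induct)
  case less
  obtain C where C: "C \<ge> 0" "\<forall>f\<in>schwartz_even. \<forall>x. \<bar>x $ i\<bar> \<le> 1 \<longrightarrow>
     jap x ^ m * norm (partials is (radial_quot i f) x) \<le> C * schwartz_seminorm m (is @ [i, i]) f"
    using radial_quot_near by blast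
  have near: "schwartz_dominated (\<lambda>f x. C * schwartz_seminorm m (is @ [i, i]) f)"
    by (rule schwartz_dominated_cmult[OF schwartz_dominated_schwartz_seminorm C(1)])
  have "schwartz_dominated (\<lambda>f x. \<Sum>l\<leftarrow>deletions i is. jap x ^ m * norm (partials l (radial_quot i f) x))"
    by (rule schwartz_dominated_sum_list, rule less) (use length_deletions in fastforce)
  then have far: "schwartz_dominated (\<lambda>f x. jap x ^ m * norm (partials (is @ [i]) f x) +
      (\<Sum>l\<leftarrow>deletions i is. jap x ^ m * norm (partials l (radial_quot i f) x)))"
    by (rule schwartz_dominated_add[OF schwartz_dominated_seminorm])
  show ?case
  proof (rule schwartz_dominated_mono[OF schwartz_dominated_add[OF near far]])
    fix f :: "real^'a \<Rightarrow> complex" and x assume f: "f \<in> schwartz_even"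
    then have s: "smooth_fun f" "even_fun f" by (auto simp: schwartz_even_def)
    let ?q = "radial_quot i f"
    let ?far = "jap x ^ m * norm (partials (is @ [i]) f x) + (\<Sum>l\<leftarrow>deletions i is. jap x ^ m * norm (partials l ?q x))"
    let ?near = "C * schwartz_seminorm m (is @ [i, i]) f"
    \<comment> \<open>The two regional bounds are added to obtain one bound valid everywhere, so
      each must be nonnegative where the other one does the work.\<close>
    have near0: "0 \<le> ?near"
      using C(1) schwartz_seminorm_upper[OF f, of 0 m "is @ [i, i]"]
      by (intro mult_nonneg_nonneg) (auto intro: order_trans[rotated])
    have far0: "0 \<le> ?far" by (intro add_nonneg_nonneg sum_list_nonneg) auto
    show "jap x ^ m * norm (partials is ?q x) \<le> ?near + ?far"
    proof (cases "\<bar>x $ i\<bar> \<le> 1")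
      case True
      then show ?thesis using C(2) f far0 by fastforce
    next
      case False
      have eq: "of_real (x $ i) * ?q x = partial_deriv i f x" for x
        using partial_deriv_even_zero[OF s, of x i] by (auto simp: radial_quot_def)
      have "norm (partials is ?q x) = 1 * norm (partials is ?q x)" by simp
      also have "\<dots> \<le> \<bar>x $ i\<bar> * norm (partials is ?q x)"
        using False by (intro mult_right_mono) auto
      also have "\<dots> = norm (of_real (x $ i) * partials is ?q x)" by (simp add: norm_mult)
      also have "\<dots> = norm (partials is (partial_deriv i f) x - (\<Sum>l\<leftarrow>deletions i is. partials l ?q x))"
        by (subst coord_times_partials[OF radial_quot_smooth[OF f] eq smooth_fun_partial_deriv[OF s(1)]]) (rule refl)
      also have "\<dots> \<le> norm (partials is (partial_deriv i f) x) + norm (\<Sum>l\<leftarrow>deletions i is. partials l ?q x)"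
        by (rule norm_triangle_ineq4)
      also have "norm (\<Sum>l\<leftarrow>deletions i is. partials l ?q x) \<le> (\<Sum>l\<leftarrow>deletions i is. norm (partials l ?q x))"
        by (rule norm_sum_list_le)
      finally have "jap x ^ m * norm (partials is ?q x) \<le>
          jap x ^ m * (norm (partials is (partial_deriv i f) x) + (\<Sum>l\<leftarrow>deletions i is. norm (partials l ?q x)))"
        by (intro mult_left_mono) auto
      also have "\<dots> = ?far" by (simp add: partials_append distrib_left sum_list_const_mult)
      finally show ?thesis using near0 by linarith
    qed
  qed
qed

lemma radial_quot_symbols:
  assumes f: "f \<in> schwartz_even"
  shows "radial_quot i f \<in> symbols K"
proof -
  define m where "m = nat \<lceil>- K\<rceil>"
  have m: "- real m \<le> K" unfolding m_def by linarith
  have "\<exists>C. \<forall>x. norm (partials is (radial_quot i f) x) \<le> C * jap x powr (- real m)" for "is"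
  proof -
    obtain C where C: "\<And>x. jap x ^ m * norm (partials is (radial_quot i f) x) \<le> C"
      using schwartz_dominated_bound[OF schwartz_dominated_radial_quot f] by blast
    have "norm (partials is (radial_quot i f) x) \<le> C * jap x powr (- real m)" for x
      using C[of x] by (simp add: powr_minus powr_realpow field_simps)
    then show ?thesis by blast
  qed
  then have "radial_quot i f \<in> symbols (- real m)" using radial_quot_smooth[OF f] by (simp add: symbols_def)
  then show ?thesis using m by (rule symbols_mono)
qed

subsection \<open>The operator on even Schwartz functions\<close>

lemma partials_sum:
  assumes "finite I" "\<And>i. i \<in> I \<Longrightarrow> smooth_fun (f i)"
  shows "partials is (\<lambda>x. \<Sum>i\<in>I. f i x) = (\<lambda>x. \<Sum>i\<in>I. partials is (f i) x)"
  using assms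
proof (induction I arbitrary: "is")
  case empty
  show ?case by (induction "is") auto
next
  case (insert i I)
  have "smooth_fun (\<lambda>x. \<Sum>i\<in>I. f i x)"
    using insert by (auto simp: smooth_fun_def intro!: differentiable_sum)
  then show ?case using insert partials_add[of "f i" "\<lambda>x. \<Sum>i\<in>I. f i x" "is"] by simp
qed

lemma radial_quot_even:
  assumes f: "f \<in> schwartz_even"
  shows "even_fun (radial_quot i f)" "even_fun (partial_deriv i (partial_deriv i f))"
proof -
  have s: "smooth_fun f" "even_fun f" using f by (auto simp: schwartz_even_def)
  have 1: "partial_deriv i f (flip j x) = (if i = j then - 1 else 1) * partial_deriv i f x" for j x
    using partial_deriv_flip[OF s(1), of j 1 i x] s(2) by (simp add: even_fun_def)
  have 2: "partial_deriv i (partial_deriv i f) (flip j x) = partial_deriv i (partial_deriv i f) x" for j x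
    using partial_deriv_flip[OF smooth_fun_partial_deriv[OF s(1)], of i j "if i = j then - 1 else 1" i x] 1 by auto
  show "even_fun (partial_deriv i (partial_deriv i f))" using 2 by (simp add: even_fun_def)
  show "even_fun (radial_quot i f)" unfolding even_fun_def radial_quot_def by (auto simp: 1 2)
qed

lemma laplace_schwartz_even:
  assumes f: "f \<in> schwartz_even"
  shows "laplace \<alpha> f \<in> schwartz_even"
proof -
  have "(\<lambda>x. \<Sum>i\<in>I. partial_deriv i (partial_deriv i f) x + of_real (2 * \<alpha> $ i + 1) * radial_quot i f x) \<in> schwartz_even"
    if "finite I" for I
    using that
  proof (induction I)
    case empty
    show ?case using schwartz_even_cmult[OF f, of 0] by simp
  next
    case (insert i I)
    have "partial_deriv i (partial_deriv i f) \<in> schwartz_even" "radial_quot i f \<in> schwartz_even"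
      unfolding schwartz_even_iff
      by (intro conjI allI radial_quot_even radial_quot_symbols symbols_partial_deriv schwartz_even_symbols f)+
    from schwartz_even_add[OF schwartz_even_add[OF this(1) schwartz_even_cmult[OF this(2)]] insert.IH]
    show ?case using insert.hyps by simp
  qed
  from this[OF finite_class.finite_UNIV] show ?thesis unfolding laplace_axial[abs_def] axial_laplace_def .
qed

lemma radial_quot_lin:
  assumes "f \<in> schwartz_even" "g \<in> schwartz_even"
  shows "radial_quot i (\<lambda>x. a * f x + b * g x) x = a * radial_quot i f x + b * radial_quot i g x"
    "partial_deriv i (partial_deriv i (\<lambda>x. a * f x + b * g x)) x
      = a * partial_deriv i (partial_deriv i f) x + b * partial_deriv i (partial_deriv i g) x"
proof -
  have s: "smooth_fun f" "smooth_fun g" using assms by (auto simp: schwartz_even_def)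
  have s': "smooth_fun (\<lambda>x. a * f x)" "smooth_fun (\<lambda>x. b * g x)"
    using assms schwartz_even_cmult by (auto simp: schwartz_even_def)
  have p: "partials is (\<lambda>x. a * f x + b * g x) = (\<lambda>x. a * partials is f x + b * partials is g x)" for "is"
    using partials_add[OF s'] partials_cmult s by metis
  show "partial_deriv i (partial_deriv i (\<lambda>x. a * f x + b * g x)) x
      = a * partial_deriv i (partial_deriv i f) x + b * partial_deriv i (partial_deriv i g) x"
    using fun_cong[OF p[of "[i, i]"], of x] by simp
  then show "radial_quot i (\<lambda>x. a * f x + b * g x) x = a * radial_quot i f x + b * radial_quot i g x"
    using fun_cong[OF p[of "[i]"], of x] by (simp add: radial_quot_def add_divide_distrib)
qed

lemma laplace_lin:
  assumes "f \<in> schwartz_even" "g \<in> schwartz_even"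
  shows "laplace \<alpha> (\<lambda>x. a * f x + b * g x) = (\<lambda>x. a * laplace \<alpha> f x + b * laplace \<alpha> g x)"
  unfolding laplace_axial[abs_def] axial_laplace_def radial_quot_lin[OF assms]
  unfolding sum_distrib_left sum.distrib[symmetric]
  by (intro ext sum.cong refl) (simp only: distrib_left distrib_right mult_ac add_ac)

lemma schwartz_dominated_laplace:
  "schwartz_dominated (\<lambda>f x. jap x ^ m * norm (partials is (laplace \<alpha> f) x))"
proof (rule schwartz_dominated_mono)
  show "schwartz_dominated (\<lambda>f x. \<Sum>i\<in>UNIV. jap x ^ m * norm (partials (is @ [i, i]) f x) +
     \<bar>2 * \<alpha> $ i + 1\<bar> * (jap x ^ m * norm (partials is (radial_quot i f) x)))"
    by (intro schwartz_dominated_sum[where I = UNIV] schwartz_dominated_add[OF schwartz_dominated_seminorm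
      schwartz_dominated_cmult[OF schwartz_dominated_radial_quot]]) auto
  fix f :: "real^'a \<Rightarrow> complex" and x assume f: "f \<in> schwartz_even"
  then have s: "smooth_fun f" by (auto simp: schwartz_even_def)
  let ?c = "\<lambda>i. complex_of_real (2 * \<alpha> $ i + 1)"
  have s1: "smooth_fun (partial_deriv i (partial_deriv i f))" for i by (intro smooth_fun_partial_deriv s)
  have s2: "smooth_fun (\<lambda>x. ?c i * radial_quot i f x)" for i
    by (rule symbols_smooth[OF symbols_cmult[OF radial_quot_symbols[OF f, of i 0]]])
  have s3: "smooth_fun (\<lambda>x. partial_deriv i (partial_deriv i f) x + ?c i * radial_quot i f x)" for i
    by (intro symbols_smooth[of _ 0] symbols_add symbols_cmult radial_quot_symbols symbols_partial_deriv f schwartz_even_symbols)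
  have "partials is (laplace \<alpha> f) x = (\<Sum>i\<in>UNIV. partials (is @ [i, i]) f x + ?c i * partials is (radial_quot i f) x)"
    unfolding laplace_axial[abs_def] axial_laplace_def partials_sum[OF finite_class.finite_UNIV s3]
      partials_add[OF s1 s2] partials_cmult[OF radial_quot_smooth[OF f]] by (simp add: partials_append)
  also have "norm \<dots> \<le> (\<Sum>i\<in>UNIV. norm (partials (is @ [i, i]) f x) + \<bar>2 * \<alpha> $ i + 1\<bar> * norm (partials is (radial_quot i f) x))"
    by (intro sum_norm_le order_trans[OF norm_triangle_ineq]) (simp only: norm_mult norm_of_real order_refl)
  finally have "jap x ^ m * norm (partials is (laplace \<alpha> f) x) \<le>
     jap x ^ m * (\<Sum>i\<in>UNIV. norm (partials (is @ [i, i]) f x) + \<bar>2 * \<alpha> $ i + 1\<bar> * norm (partials is (radial_quot i f) x))"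
    by (intro mult_left_mono) auto
  then show "jap x ^ m * norm (partials is (laplace \<alpha> f) x) \<le> (\<Sum>i\<in>UNIV. jap x ^ m * norm (partials (is @ [i, i]) f x) +
     \<bar>2 * \<alpha> $ i + 1\<bar> * (jap x ^ m * norm (partials is (radial_quot i f) x)))"
    by (simp only: sum_distrib_left distrib_left mult.left_commute)
qed

lemma laplace_diff:
  assumes "f \<in> schwartz_even" "g \<in> schwartz_even"
  shows "laplace \<alpha> (f - g) = laplace \<alpha> f - laplace \<alpha> g"
  using laplace_lin[OF assms, of \<alpha> 1 "- 1"] by (simp add: fun_diff_def)

lemma continuous_map_laplace: "continuous_map schwartz_topology schwartz_topology (laplace \<alpha>)"
  unfolding schwartz_topology_def
proof (rule continuous_map_seminorm_topology)
  show "laplace \<alpha> f \<in> schwartz_even" if "f \<in> schwartz_even" for f using that by (rule laplace_schwartz_even)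
  show "g - f \<in> schwartz_even" if "f \<in> schwartz_even" "g \<in> schwartz_even" for f g :: "real^'a \<Rightarrow> complex"
    using schwartz_even_diff[OF that(2,1)] by (simp add: fun_diff_def)
  show "laplace \<alpha> (g - f) = laplace \<alpha> g - laplace \<alpha> f" if "f \<in> schwartz_even" "g \<in> schwartz_even" for f g
    by (rule laplace_diff[OF that(2,1)])
  fix q :: "(real^'a \<Rightarrow> complex) \<Rightarrow> real" assume "q \<in> range (\<lambda>(m, is). schwartz_seminorm m is)"
  then obtain m "is" where q: "q = schwartz_seminorm m is" by auto
  obtain F C where FC: "finite F" "0 \<le> C" "\<forall>f r x. f \<in> schwartz_even \<longrightarrow> 0 \<le> r \<longrightarrow>
     (\<forall>p\<in>F. schwartz_seminorm (fst p) (snd p) f \<le> r) \<longrightarrow> jap x ^ m * norm (partials is (laplace \<alpha> f) x) \<le> C * r"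
    by (rule schwartz_dominatedE[OF schwartz_dominated_laplace[of m "is" \<alpha>]])
  show "\<exists>F C. finite F \<and> F \<subseteq> range (\<lambda>(m, is). schwartz_seminorm m is) \<and> 0 \<le> C \<and>
       (\<forall>f\<in>schwartz_even. \<forall>r\<ge>0. (\<forall>p\<in>F. p f \<le> r) \<longrightarrow> q (laplace \<alpha> f) \<le> C * r)"
  proof (intro exI[of _ "(\<lambda>(m, is). schwartz_seminorm m is) ` F"] exI[of _ C] conjI ballI allI impI)
    fix f :: "real^'a \<Rightarrow> complex" and r :: real
    assume f: "f \<in> schwartz_even" "0 \<le> r" and F: "\<forall>p\<in>(\<lambda>(m, is). schwartz_seminorm m is) ` F. p f \<le> r"
    have "jap x ^ m * norm (partials is (laplace \<alpha> f) x) \<le> C * r" for x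
    proof -
      have "\<forall>p\<in>F. schwartz_seminorm (fst p) (snd p) f \<le> r" using F by (auto simp: split_beta)
      then show ?thesis using FC(3) f by blast
    qed
    then show "q (laplace \<alpha> f) \<le> C * r" unfolding q schwartz_seminorm_def by (intro cSUP_least) auto
  qed (use FC(1,2) in auto)
qed

text \<open>Membership in \<open>E_space\<close> includes being a tempered distribution, so this has
  to be known before any norm of the image is estimated.\<close>

lemma laplace_dist_tempered:
  assumes T: "T \<in> tempered_even"
  shows "laplace_dist \<alpha> T \<in> tempered_even"
  unfolding tempered_even_def
proof (intro CollectI conjI ballI allI impI)
  fix f g :: "real^'a \<Rightarrow> complex" and c :: complex
  assume f: "f \<in> schwartz_even"
  show "laplace_dist \<alpha> T (\<lambda>x. c * f x) = c * laplace_dist \<alpha> T f"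
    using T f laplace_lin[OF f f, of \<alpha> c 0] schwartz_even_cmult[OF f, of c] laplace_schwartz_even[OF f, of \<alpha>]
    by (simp add: laplace_dist_def dual_op_def tempered_even_def)
  assume g: "g \<in> schwartz_even"
  show "laplace_dist \<alpha> T (\<lambda>x. f x + g x) = laplace_dist \<alpha> T f + laplace_dist \<alpha> T g"
    using T f g laplace_lin[OF f g, of \<alpha> 1 1] schwartz_even_add[OF f g] laplace_schwartz_even[of _ \<alpha>]
    by (simp add: laplace_dist_def dual_op_def tempered_even_def)
next
  have "continuous_map schwartz_topology euclidean T" using T by (simp add: tempered_even_def)
  from continuous_map_compose[OF continuous_map_laplace[of \<alpha>] this]
  show "continuous_map schwartz_topology euclidean (laplace_dist \<alpha> T)"
    by (rule continuous_map_eq) (simp add: laplace_dist_def dual_op_def schwartz_topology_def)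
qed (simp add: laplace_dist_def dual_op_def)

subsection \<open>The Fourier-Bessel kernel\<close>

text \<open>\<open>fb_kernel \<alpha> m \<xi>\<close> is the kernel differentiated \<open>m i\<close> times in each variable \<open>\<xi>\<^sub>i\<close>.\<close>

definition fb_kernel :: "real^'n::finite \<Rightarrow> ('n \<Rightarrow> nat) \<Rightarrow> real^'n \<Rightarrow> real^'n \<Rightarrow> real" where
  "fb_kernel \<alpha> m \<xi> x = (\<Prod>i\<in>UNIV. (x $ i) ^ m i * bessel_d (m i) (\<alpha> $ i) (\<xi> $ i * x $ i))"

definition fb_rest :: "real^'n::finite \<Rightarrow> 'n \<Rightarrow> real^'n \<Rightarrow> real^'n \<Rightarrow> real" where
  "fb_rest \<alpha> i \<xi> x = (\<Prod>j\<in>UNIV - {i}. bessel_j (\<alpha> $ j) (\<xi> $ j * x $ j))"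

abbreviation inc :: "'n \<Rightarrow> ('n \<Rightarrow> nat) \<Rightarrow> 'n \<Rightarrow> nat" where
  "inc i m \<equiv> m(i := Suc (m i))"

lemma fb_kernel_upd:
  "fb_kernel \<alpha> ((\<lambda>_. 0)(i := k)) \<xi> x = (x $ i) ^ k * bessel_d k (\<alpha> $ i) (\<xi> $ i * x $ i) * fb_rest \<alpha> i \<xi> x"
  unfolding fb_kernel_def fb_rest_def by (subst prod.remove[of _ i]) auto

lemma fb_kernel_zero:
  "fb_kernel \<alpha> (\<lambda>_. 0) \<xi> x = bessel_j (\<alpha> $ i) (\<xi> $ i * x $ i) * fb_rest \<alpha> i \<xi> x"
  using fb_kernel_upd[of \<alpha> i 0 \<xi> x] by (simp add: fun_upd_idem)

lemma has_derivative_fb_kernel: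
  fixes \<alpha> :: "real^'n::finite"
  assumes a: "\<forall>i. \<alpha> $ i > - 1 / 2"
  shows "((\<lambda>\<xi>. fb_kernel \<alpha> m \<xi> x) has_derivative (\<lambda>h. \<Sum>i\<in>UNIV. (h $ i) *\<^sub>R fb_kernel \<alpha> (inc i m) \<xi> x)) (at \<xi>)"
proof -
  let ?f = "\<lambda>i \<xi>. (x $ i) ^ m i * bessel_d (m i) (\<alpha> $ i) (\<xi> $ i * x $ i)"
  let ?d = "\<lambda>i. (x $ i) ^ Suc (m i) * bessel_d (Suc (m i)) (\<alpha> $ i) (\<xi> $ i * x $ i)"
  have f: "(?f i has_derivative (\<lambda>h. (h $ i) * ?d i)) (at \<xi>)" for i
  proof -
    have l: "((\<lambda>\<xi>. \<xi> $ i * x $ i) has_derivative (\<lambda>h. h $ i * x $ i)) (at \<xi>)"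
      by (intro has_derivative_mult_left bounded_linear.has_derivative[OF bounded_linear_vec_nth] has_derivative_ident)
    have "\<alpha> $ i \<ge> - 1/2" using a[rule_format, of i] by linarith
    then have "(bessel_d (m i) (\<alpha> $ i) has_derivative (\<lambda>h. bessel_d (Suc (m i)) (\<alpha> $ i) (\<xi> $ i * x $ i) * h)) (at (\<xi> $ i * x $ i))"
      using bessel_d_deriv unfolding has_field_derivative_def by blast
    from has_derivative_mult_right[OF has_derivative_compose[OF l this], of "(x $ i) ^ m i"]
    show ?thesis by (simp add: mult_ac)
  qed
  have "((\<lambda>\<xi>. fb_kernel \<alpha> m \<xi> x) has_derivative
     (\<lambda>h. \<Sum>i\<in>UNIV. (h $ i * ?d i) * (\<Prod>j\<in>UNIV - {i}. ?f j \<xi>))) (at \<xi>)"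
    unfolding fb_kernel_def by (rule has_derivative_prod) (rule f)
  moreover have "(h $ i * ?d i) * (\<Prod>j\<in>UNIV - {i}. ?f j \<xi>) = (h $ i) *\<^sub>R fb_kernel \<alpha> (inc i m) \<xi> x" for h i
    unfolding fb_kernel_def by (subst (2) prod.remove[of _ i]) (auto intro!: prod.cong)
  ultimately show ?thesis by (simp only:)
qed

text \<open>Uniform in \<xi>: the derivatives of j are bounded on the whole line, and each
  differentiation in \<xi> only brings down a coordinate of x, which costs \<open>jap x\<close> to
  the power 1/2. The decay of the transformed function absorbs this growth.\<close>

lemma fb_kernel_bound:
  fixes \<alpha> :: "real^'n::finite"
  assumes a: "\<forall>i. \<alpha> $ i > - 1 / 2"
  obtains C M where "0 \<le> C" "\<And>\<xi> x. \<bar>fb_kernel \<alpha> m \<xi> x\<bar> \<le> C * jap x powr M"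
proof -
  have "\<exists>C\<ge>0. \<forall>t. \<bar>bessel_d (m i) (\<alpha> $ i) t\<bar> \<le> C" for i
    using a[rule_format, of i] by (intro bessel_d_bounded) linarith
  then obtain C where C: "\<And>i. 0 \<le> C i" "\<And>i t. \<bar>bessel_d (m i) (\<alpha> $ i) t\<bar> \<le> C i" by metis
  have "\<bar>fb_kernel \<alpha> m \<xi> x\<bar> \<le> (\<Prod>i\<in>UNIV. C i) * jap x powr (\<Sum>i\<in>UNIV. real (m i) / 2)" for \<xi> x
  proof -
    have "\<bar>fb_kernel \<alpha> m \<xi> x\<bar> = (\<Prod>i\<in>UNIV. \<bar>(x $ i) ^ m i * bessel_d (m i) (\<alpha> $ i) (\<xi> $ i * x $ i)\<bar>)"
      unfolding fb_kernel_def by (rule abs_prod)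
    also have "\<dots> \<le> (\<Prod>i\<in>UNIV. jap x powr (real (m i) / 2) * C i)"
    proof (intro prod_mono conjI)
      fix i
      have "\<bar>x $ i\<bar> ^ m i \<le> (jap x powr (1/2)) ^ m i" by (intro power_mono norm_component_le_jap) auto
      also have "\<dots> = jap x powr (real (m i) / 2)" by (simp add: powr_realpow[symmetric] powr_powr)
      finally show "\<bar>(x $ i) ^ m i * bessel_d (m i) (\<alpha> $ i) (\<xi> $ i * x $ i)\<bar> \<le> jap x powr (real (m i) / 2) * C i"
        unfolding abs_mult power_abs using C by (intro mult_mono) auto
    qed auto
    also have "\<dots> = (\<Prod>i\<in>UNIV. C i) * jap x powr (\<Sum>i\<in>UNIV. real (m i) / 2)"
      by (simp add: prod.distrib powr_sum)
    finally show ?thesis .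
  qed
  moreover have "0 \<le> (\<Prod>i\<in>UNIV. C i)" using C(1) by (intro prod_nonneg) auto
  ultimately show ?thesis using that by blast
qed

lemma fb_kernel_measurable:
  fixes \<alpha> :: "real^'n::finite"
  assumes a: "\<forall>i. \<alpha> $ i > - 1 / 2"
  shows "(\<lambda>x. fb_kernel \<alpha> m \<xi> x) \<in> borel_measurable borel"
proof -
  have [measurable]: "(\<lambda>x::real^'n. x $ i) \<in> borel_measurable borel" for i
    by (intro borel_measurable_continuous_onI continuous_intros)
  have "- 1/2 \<le> \<alpha> $ i" for i using a[rule_format, of i] by linarith
  from bessel_d_measurable[OF this]
  have [measurable]: "(\<lambda>x::real^'n. bessel_d k (\<alpha> $ i) (\<xi> $ i * x $ i)) \<in> borel_measurable borel" for k i .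
  show ?thesis unfolding fb_kernel_def by measurable
qed

lemma schwartz_mult_integrable:
  fixes \<alpha> :: "real^'n::finite" and g :: "real^'n \<Rightarrow> 'b::{banach, second_countable_topology}"
  assumes a: "\<forall>i. \<alpha> $ i > - 1 / 2" and f: "f \<in> schwartz_even"
    and g: "g \<in> borel_measurable borel" "\<And>x. norm (g x) \<le> norm (f x) * (C * jap x powr M)" and C: "0 \<le> C"
  shows "integrable (mu \<alpha>) g"
proof -
  obtain D where D: "\<And>x. norm (f x) \<le> D * jap x powr (decay_rate \<alpha> - M)"
    using symbols_bound[OF schwartz_even_symbols[OF f]] by blast
  have "norm (g x) \<le> (D * C) * jap x powr decay_rate \<alpha>" for x
  proof -
    have "norm (g x) \<le> (D * jap x powr (decay_rate \<alpha> - M)) * (C * jap x powr M)"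
      using order_trans[OF g(2) mult_right_mono[OF D]] C by simp
    also have "\<dots> = (D * C) * (jap x powr (decay_rate \<alpha> - M) * jap x powr M)" by (simp only: mult_ac)
    also have "\<dots> = (D * C) * jap x powr decay_rate \<alpha>" by (simp add: powr_add[symmetric])
    finally show ?thesis .
  qed
  then show ?thesis by (rule integrable_mu_decay[OF a g(1)])
qed

lemma schwartz_even_measurable: "f \<in> schwartz_even \<Longrightarrow> f \<in> borel_measurable borel"
  by (auto simp: schwartz_even_def intro: smooth_fun_measurable)

definition fb_deriv :: "real^'n::finite \<Rightarrow> ('n \<Rightarrow> nat) \<Rightarrow> (real^'n \<Rightarrow> complex) \<Rightarrow> real^'n \<Rightarrow> complex" where
  "fb_deriv \<alpha> m f \<xi> = (\<integral>x. f x * of_real (fb_kernel \<alpha> m \<xi> x) \<partial>mu \<alpha>)"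

lemma fourier_bessel_eq: "fourier_bessel \<alpha> f = fb_deriv \<alpha> (\<lambda>_. 0) f"
  by (simp add: fun_eq_iff fourier_bessel_def fb_deriv_def fb_kernel_def)

context
  fixes \<alpha> :: "real^'n::finite"
  assumes a: "\<forall>i. \<alpha> $ i > - 1 / 2"
begin

lemma fb_integrand_measurable:
  assumes "f \<in> schwartz_even"
  shows "(\<lambda>x. f x * of_real (fb_kernel \<alpha> m \<xi> x)) \<in> borel_measurable borel"
  using schwartz_even_measurable[OF assms] fb_kernel_measurable[OF a, of m \<xi>] by measurable

lemma fb_integrand_integrable:
  assumes f: "f \<in> schwartz_even"
  shows "integrable (mu \<alpha>) (\<lambda>x. f x * of_real (fb_kernel \<alpha> m \<xi> x))"
proof -
  obtain C M where C: "0 \<le> C" "\<And>\<xi> x. \<bar>fb_kernel \<alpha> m \<xi> x\<bar> \<le> C * jap x powr M"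
    using fb_kernel_bound[OF a] by blast
  show ?thesis
    by (rule schwartz_mult_integrable[OF a f fb_integrand_measurable[OF f] _ C(1)])
      (auto simp: norm_mult intro!: mult_left_mono C(2))
qed

lemma has_derivative_fb_deriv:
  assumes f: "f \<in> schwartz_even"
  shows "(fb_deriv \<alpha> m f has_derivative (\<lambda>h. \<Sum>i\<in>UNIV. (h $ i) *\<^sub>R fb_deriv \<alpha> (inc i m) f \<xi>)) (at \<xi>)"
proof -
  have k: "((\<lambda>\<xi>. f x * complex_of_real (fb_kernel \<alpha> m \<xi> x)) has_derivative
     (\<lambda>h. \<Sum>i\<in>UNIV. (h $ i) *\<^sub>R (f x * of_real (fb_kernel \<alpha> (inc i m) \<xi> x)))) (at \<xi>)" for m x \<xi>
  proof -
    have "((\<lambda>\<xi>. f x * complex_of_real (fb_kernel \<alpha> m \<xi> x)) has_derivative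
      (\<lambda>h. f x * of_real (\<Sum>i\<in>UNIV. (h $ i) *\<^sub>R fb_kernel \<alpha> (inc i m) \<xi> x))) (at \<xi>)"
      by (intro has_derivative_mult_right has_derivative_of_real has_derivative_fb_kernel a)
    moreover have "f x * complex_of_real (\<Sum>i\<in>UNIV. (h $ i) *\<^sub>R fb_kernel \<alpha> (inc i m) \<xi> x) =
      (\<Sum>i\<in>UNIV. (h $ i) *\<^sub>R (f x * of_real (fb_kernel \<alpha> (inc i m) \<xi> x)))" for h
      by (simp add: sum_distrib_left scaleR_conv_of_real mult_ac)
    ultimately show ?thesis by simp
  qed
  have "\<exists>C M. 0 \<le> C \<and> (\<forall>\<xi> x. \<bar>fb_kernel \<alpha> (inc j (inc i m)) \<xi> x\<bar> \<le> C * jap x powr M)" for i j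
    using fb_kernel_bound[OF a] by metis
  then obtain CC MM where CM: "\<And>i j. 0 \<le> CC i j" "\<And>i j \<xi> x. \<bar>fb_kernel \<alpha> (inc j (inc i m)) \<xi> x\<bar> \<le> CC i j * jap x powr MM i j"
    by metis
  \<comment> \<open>Summing over all pairs of directions gives one integrable bound that serves
    every second derivative at once.\<close>
  define B where "B x = (\<Sum>i\<in>UNIV. \<Sum>j\<in>UNIV. norm (f x) * (CC i j * jap x powr MM i j))" for x
  have t0: "0 \<le> norm (f x) * (CC i j * jap x powr MM i j)" for i j x using CM(1) by simp
  have B: "norm (f x * complex_of_real (fb_kernel \<alpha> (inc j (inc i m)) \<xi> x)) \<le> B x" for i j \<xi> x
  proof -
    have "norm (f x * complex_of_real (fb_kernel \<alpha> (inc j (inc i m)) \<xi> x)) \<le> norm (f x) * (CC i j * jap x powr MM i j)"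
      unfolding norm_mult norm_of_real by (intro mult_left_mono CM(2)) auto
    also have "\<dots> \<le> (\<Sum>j\<in>UNIV. norm (f x) * (CC i j * jap x powr MM i j))"
      using t0 by (intro member_le_sum[of j UNIV "\<lambda>j. norm (f x) * (CC i j * jap x powr MM i j)"]) auto
    also have "\<dots> \<le> B x" unfolding B_def
      by (intro member_le_sum[of i UNIV "\<lambda>i. \<Sum>j\<in>UNIV. norm (f x) * (CC i j * jap x powr MM i j)"] sum_nonneg t0) auto
    finally show ?thesis .
  qed
  have "integrable (mu \<alpha>) B"
    unfolding B_def
  proof (intro Bochner_Integration.integrable_sum)
    fix i j
    show "integrable (mu \<alpha>) (\<lambda>x. norm (f x) * (CC i j * jap x powr MM i j))"
      using schwartz_even_measurable[OF f] CM(1)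
      by (intro schwartz_mult_integrable[OF a f, of _ "CC i j" "MM i j"]) auto
  qed
  then show ?thesis
    unfolding fb_deriv_def
    by (intro has_derivative_integral[where ?k2.0 = "\<lambda>i j \<xi> x. f x * of_real (fb_kernel \<alpha> (inc j (inc i m)) \<xi> x)" and B = B]
        k B fb_integrand_integrable f)
qed

lemma partial_deriv_fb_deriv:
  "f \<in> schwartz_even \<Longrightarrow> partial_deriv i (fb_deriv \<alpha> m f) = fb_deriv \<alpha> (inc i m) f"
  using partial_deriv_eq_sumI[OF has_derivative_fb_deriv] by blast

lemma fourier_bessel_symbols0:
  assumes f: "f \<in> schwartz_even"
  shows "fourier_bessel \<alpha> f \<in> symbols 0"
  unfolding fourier_bessel_eq
proof (rule symbols_coinduct[of _ "range (\<lambda>m. fb_deriv \<alpha> m f)"])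
  fix h assume "h \<in> range (\<lambda>m. fb_deriv \<alpha> m f)"
  then obtain m where h: "h = fb_deriv \<alpha> m f" by blast
  show "h differentiable (at x)" for x
    unfolding h differentiable_def using has_derivative_fb_deriv[OF f] by blast
  show "partial_deriv i h \<in> range (\<lambda>m. fb_deriv \<alpha> m f)" for i
    unfolding h partial_deriv_fb_deriv[OF f] by blast
  obtain C M where C: "0 \<le> C" "\<And>\<xi> x. \<bar>fb_kernel \<alpha> m \<xi> x\<bar> \<le> C * jap x powr M"
    using fb_kernel_bound[OF a] by blast
  have "norm (h \<xi>) \<le> (\<integral>x. norm (f x) * (C * jap x powr M) \<partial>mu \<alpha>)" for \<xi>
    unfolding h fb_deriv_def
  proof (rule Bochner_Integration.integral_norm_bound_integral)
    show "integrable (mu \<alpha>) (\<lambda>x. norm (f x) * (C * jap x powr M))"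
      using schwartz_even_measurable[OF f] C(1)
      by (intro schwartz_mult_integrable[OF a f, of _ C M]) auto
    show "norm (f x * of_real (fb_kernel \<alpha> m \<xi> x)) \<le> norm (f x) * (C * jap x powr M)" for x
      unfolding norm_mult norm_of_real by (intro mult_left_mono C(2)) auto
  qed (rule fb_integrand_integrable[OF f])
  then show "\<exists>C. \<forall>\<xi>. norm (h \<xi>) \<le> C * jap \<xi> powr 0" by (auto simp: exI)
qed auto

text \<open>The kernel is an eigenfunction in each \<xi>_i with eigenvalue -(x_i)^2. Off the
  hyperplane the two terms with j at \<gamma> + 1 cancel. On it, the second derivative of j at 0 is
  -1 / (2 \<gamma> + 2) and is counted 1 + (2 \<gamma> + 1) times, precisely because the quotient is
  read as its limit there.\<close>

lemma laplace_fb_kernel: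
  "fb_kernel \<alpha> ((\<lambda>_. 0)(i := 2)) \<xi> x + (2 * \<alpha> $ i + 1) *
      (if \<xi> $ i = 0 then fb_kernel \<alpha> ((\<lambda>_. 0)(i := 2)) \<xi> x else fb_kernel \<alpha> ((\<lambda>_. 0)(i := 1)) \<xi> x / \<xi> $ i)
    = - ((x $ i)\<^sup>2 * fb_kernel \<alpha> (\<lambda>_. 0) \<xi> x)"
proof -
  define \<gamma> where "\<gamma> = \<alpha> $ i"
  have \<gamma>: "\<gamma> \<ge> - 1/2" "\<gamma> + 1 \<noteq> 0" using a[rule_format, of i] by (auto simp: \<gamma>_def)
  define c where "c = (2 * \<gamma> + 1) / (2 * \<gamma> + 2)"
  have c1: "(2 * \<gamma> + 1) / (2 * (\<gamma> + 1)) = c" by (simp add: c_def)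
  define R where "R = fb_rest \<alpha> i \<xi> x"
  define J where "J = bessel_j \<gamma> (\<xi> $ i * x $ i)"
  define J1 where "J1 = bessel_j (\<gamma> + 1) (\<xi> $ i * x $ i)"
  have k0: "fb_kernel \<alpha> (\<lambda>_. 0) \<xi> x = J * R"
    unfolding fb_kernel_zero[of \<alpha> \<xi> x i] J_def R_def \<gamma>_def ..
  have k1: "fb_kernel \<alpha> ((\<lambda>_. 0)(i := 1)) \<xi> x = x $ i * (- ((\<xi> $ i * x $ i) / (2 * (\<gamma> + 1))) * J1) * R"
    unfolding fb_kernel_upd J1_def R_def \<gamma>_def by simp
  have k2: "fb_kernel \<alpha> ((\<lambda>_. 0)(i := 2)) \<xi> x = (x $ i)\<^sup>2 * (- J + c * J1) * R"
    unfolding fb_kernel_upd J_def J1_def R_def \<gamma>_def c_def by (simp add: numeral_2_eq_2)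
  show ?thesis
  proof (cases "\<xi> $ i = 0")
    case True
    then have "J = 1" "J1 = 1" using \<gamma> by (auto simp: J_def J1_def bessel_j_0)
    moreover have "(1 + (2 * \<gamma> + 1)) * (- 1 + c) = - 1" using \<gamma>(2) by (simp add: c_def field_simps)
    ultimately have "(1 + (2 * \<gamma> + 1)) * ((x $ i)\<^sup>2 * (- J + c * J1) * R) = - ((x $ i)\<^sup>2 * (J * R))"
      by (metis (no_types, lifting) mult.assoc mult.commute mult.left_commute mult_1 mult_minus_left)
    then have "(x $ i)\<^sup>2 * (- J + c * J1) * R + (2 * \<gamma> + 1) * ((x $ i)\<^sup>2 * (- J + c * J1) * R) = - ((x $ i)\<^sup>2 * (J * R))"
      by (simp only: distrib_right[of 1] mult_1)
    then show ?thesis using True unfolding k0 k2 \<gamma>_def[symmetric] by (simp only: simp_thms if_True)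
  next
    case False
    have gen: "b * (y * (- ((t * y) / d) * J1) * R / t) = - (b / d) * (y\<^sup>2 * J1 * R)" if "t \<noteq> 0" for b d t y :: real
      using that by (simp add: power2_eq_square)
    have "(2 * \<gamma> + 1) * (x $ i * (- ((\<xi> $ i * x $ i) / (2 * (\<gamma> + 1))) * J1) * R / \<xi> $ i) = - c * ((x $ i)\<^sup>2 * J1 * R)"
      unfolding gen[OF False] c1 ..
    then show ?thesis using False unfolding k0 k1 k2 \<gamma>_def[symmetric] by (simp only: if_False) (simp add: algebra_simps)
  qed
qed

lemma laplace_fourier_bessel:
  assumes f: "f \<in> schwartz_even"
  shows "laplace \<alpha> (fourier_bessel \<alpha> f) = (\<lambda>\<xi>. - fourier_bessel \<alpha> (\<lambda>x. of_real ((norm x)\<^sup>2) * f x) \<xi>)"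
proof
  fix \<xi>
  let ?k = "\<lambda>m x. f x * complex_of_real (fb_kernel \<alpha> m \<xi> x)"
  let ?z = "\<lambda>_::'n. 0::nat"
  have p: "partial_deriv i (fourier_bessel \<alpha> f) = fb_deriv \<alpha> (?z(i := 1)) f"
    "partial_deriv i (fb_deriv \<alpha> (?z(i := 1)) f) = fb_deriv \<alpha> (?z(i := 2)) f" for i
    unfolding fourier_bessel_eq partial_deriv_fb_deriv[OF f] by (simp_all add: numeral_2_eq_2)
  have int: "integrable (mu \<alpha>) (?k m)" for m by (rule fb_integrand_integrable[OF f])
  have summand: "fb_deriv \<alpha> (?z(i := 2)) f \<xi> + of_real (2 * \<alpha> $ i + 1) *
       (if \<xi> $ i = 0 then fb_deriv \<alpha> (?z(i := 2)) f \<xi> else fb_deriv \<alpha> (?z(i := 1)) f \<xi> / of_real (\<xi> $ i))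
     = (\<integral>x. - (of_real ((x $ i)\<^sup>2) * ?k ?z x) \<partial>mu \<alpha>)" (is "?L = _")
    and intsq: "integrable (mu \<alpha>) (\<lambda>x. - (of_real ((x $ i)\<^sup>2) * ?k ?z x))" for i
  proof -
    \<comment> \<open>The case distinction concerns \<xi> only, so it is constant in the integration
      variable and can be taken under the integral.\<close>
    define G where "G x = ?k (?z(i := 2)) x + of_real (2 * \<alpha> $ i + 1) *
       (if \<xi> $ i = 0 then ?k (?z(i := 2)) x else ?k (?z(i := 1)) x / of_real (\<xi> $ i))" for x
    have G: "G = (\<lambda>x. - (of_real ((x $ i)\<^sup>2) * ?k ?z x))"
    proof
      fix x
      have "G x = f x * of_real (fb_kernel \<alpha> (?z(i := 2)) \<xi> x + (2 * \<alpha> $ i + 1) *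
        (if \<xi> $ i = 0 then fb_kernel \<alpha> (?z(i := 2)) \<xi> x else fb_kernel \<alpha> (?z(i := 1)) \<xi> x / \<xi> $ i))"
        unfolding G_def by (simp add: algebra_simps)
      also have "\<dots> = - (of_real ((x $ i)\<^sup>2) * ?k ?z x)" unfolding laplace_fb_kernel by simp
      finally show "G x = - (of_real ((x $ i)\<^sup>2) * ?k ?z x)" .
    qed
    have int2: "integrable (mu \<alpha>) (\<lambda>x. if \<xi> $ i = 0 then ?k (?z(i := 2)) x else ?k (?z(i := 1)) x / of_real (\<xi> $ i))"
      using int by (cases "\<xi> $ i = 0") auto
    have "integrable (mu \<alpha>) G" unfolding G_def
      by (intro Bochner_Integration.integrable_add int integrable_mult_right int2)
    then show "integrable (mu \<alpha>) (\<lambda>x. - (of_real ((x $ i)\<^sup>2) * ?k ?z x))" unfolding G .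
    have "(\<integral>x. G x \<partial>mu \<alpha>) = ?L"
      unfolding G_def Bochner_Integration.integral_add[OF int integrable_mult_right[OF int2]] integral_mult_right_zero fb_deriv_def
      by (cases "\<xi> $ i = 0") auto
    then show "?L = (\<integral>x. - (of_real ((x $ i)\<^sup>2) * ?k ?z x) \<partial>mu \<alpha>)" unfolding G ..
  qed
  have "laplace \<alpha> (fourier_bessel \<alpha> f) \<xi> = (\<Sum>i\<in>UNIV. \<integral>x. - (of_real ((x $ i)\<^sup>2) * ?k ?z x) \<partial>mu \<alpha>)"
    unfolding laplace_def p summand ..
  also have "\<dots> = (\<integral>x. (\<Sum>i\<in>UNIV. - (of_real ((x $ i)\<^sup>2) * ?k ?z x)) \<partial>mu \<alpha>)"
    by (rule Bochner_Integration.integral_sum[symmetric]) (rule intsq)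
  also have "\<dots> = (\<integral>x. - ((of_real ((norm x)\<^sup>2) * f x) * complex_of_real (fb_kernel \<alpha> ?z \<xi> x)) \<partial>mu \<alpha>)"
    by (rule Bochner_Integration.integral_cong)
      (auto simp: norm_power2_vec sum_negf sum_distrib_right sum_distrib_left mult.assoc)
  finally show "laplace \<alpha> (fourier_bessel \<alpha> f) \<xi> = - fourier_bessel \<alpha> (\<lambda>x. of_real ((norm x)\<^sup>2) * f x) \<xi>"
    by (simp add: fourier_bessel_eq fb_deriv_def)
qed

end

subsection \<open>Integration by parts\<close>

lemma has_vector_derivative_sequence:
  fixes g :: "real \<Rightarrow> 'b::real_normed_vector"
  assumes "(g has_vector_derivative D) (at 0)"
  shows "(\<lambda>n. real (Suc n) *\<^sub>R (g (inverse (real (Suc n))) - g 0)) \<longlonglongrightarrow> D"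
proof (rule LIMSEQ_I)
  fix e :: real assume e: "0 < e"
  have alt: "\<forall>e>0. \<exists>d>0. \<forall>y. norm (y - 0) < d \<longrightarrow> norm (g y - g 0 - (y - 0) *\<^sub>R D) \<le> e * norm (y - 0)"
    using assms unfolding has_vector_derivative_def has_derivative_at_alt by (rule conjunct2)
  obtain d where d: "0 < d" "\<And>y. norm (y - 0) < d \<Longrightarrow> norm (g y - g 0 - (y - 0) *\<^sub>R D) \<le> (e / 2) * norm (y - 0)"
    using alt[THEN spec, of "e / 2", THEN mp, OF half_gt_zero[OF e]] by blast
  obtain N where N: "inverse (real (Suc N)) < d" using reals_Archimedean[OF d(1)] by blast
  have "norm (real (Suc n) *\<^sub>R (g (inverse (real (Suc n))) - g 0) - D) < e" if n: "N \<le> n" for n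
  proof -
    define t where "t = inverse (real (Suc n))"
    have t: "0 < t" "real (Suc n) = inverse t" by (simp_all add: t_def)
    have "t \<le> inverse (real (Suc N))" unfolding t_def using n by (intro le_imp_inverse_le) auto
    then have "norm (t - 0) < d" using t N by simp
    then have *: "norm (g t - g 0 - t *\<^sub>R D) \<le> (e / 2) * t" using d(2)[of t] t by simp
    have "inverse t *\<^sub>R (g t - g 0) - D = inverse t *\<^sub>R (g t - g 0 - t *\<^sub>R D)"
      using t by (simp add: scaleR_diff_right)
    then have "norm (inverse t *\<^sub>R (g t - g 0) - D) = inverse t * norm (g t - g 0 - t *\<^sub>R D)"
      using t by simp
    also have "\<dots> \<le> inverse t * ((e / 2) * t)" using * t by (intro mult_left_mono) auto
    also have "\<dots> < e" using t e by simp
    finally show ?thesis using t(2) unfolding t_def by simp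
  qed
  then show "\<exists>N. \<forall>n\<ge>N. norm (real (Suc n) *\<^sub>R (g (inverse (real (Suc n))) - g 0) - D) < e" by blast
qed

lemma integral_translation_lborel:
  fixes g :: "real^'n::finite \<Rightarrow> complex"
  assumes "g \<in> borel_measurable borel"
  shows "(\<integral>x. g (x + c) \<partial>lborel) = (\<integral>x. g x \<partial>lborel)"
    "integrable lborel (\<lambda>x. g (x + c)) \<longleftrightarrow> integrable lborel g"
proof -
  have "(\<integral>x. g x \<partial>distr lborel borel ((+) c)) = (\<integral>x. g (c + x) \<partial>lborel)"
    using assms by (intro integral_distr) auto
  then show "(\<integral>x. g (x + c) \<partial>lborel) = (\<integral>x. g x \<partial>lborel)" by (simp add: lborel_distr_plus add.commute)
  have "integrable (distr lborel borel ((+) c)) g \<longleftrightarrow> integrable lborel (\<lambda>x. g (c + x))"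
    using assms by (intro integrable_distr_eq) auto
  then show "integrable lborel (\<lambda>x. g (x + c)) \<longleftrightarrow> integrable lborel g" by (simp add: lborel_distr_plus add.commute)
qed

text \<open>By translation invariance the integral of every difference quotient vanishes.\<close>

lemma integral_line_derivative_zero:
  fixes g :: "real^'n::finite \<Rightarrow> complex"
  assumes g: "integrable lborel g" and g': "g' \<in> borel_measurable borel"
    and deriv: "\<And>x. ((\<lambda>t. g (x + t *\<^sub>R e)) has_vector_derivative g' x) (at 0)"
    and D: "integrable lborel D" "\<And>x t. 0 \<le> t \<Longrightarrow> t \<le> 1 \<Longrightarrow> norm (g' (x + t *\<^sub>R e)) \<le> D x"
  shows "(\<integral>x. g' x \<partial>lborel) = 0"
proof -
  have gm[measurable]: "g \<in> borel_measurable borel" using borel_measurable_integrable[OF g] by simp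
  define s where "s n x = real (Suc n) *\<^sub>R (g (x + inverse (real (Suc n)) *\<^sub>R e) - g x)" for n x
  \<comment> \<open>The derivative is assumed at 0 only; moving the base point gives it along the
    whole line, which the mean value bound for the difference quotients requires.\<close>
  have deriv': "((\<lambda>t. g (x + t *\<^sub>R e)) has_vector_derivative g' (x + t *\<^sub>R e)) (at t)" for x t
  proof -
    have "((\<lambda>u. u - t) has_vector_derivative 1) (at t)"
      by (auto intro!: derivative_eq_intros)
    moreover have "((\<lambda>u. g ((x + t *\<^sub>R e) + u *\<^sub>R e)) has_vector_derivative g' (x + t *\<^sub>R e)) (at (t - t))"
      using deriv by simp
    ultimately have "((\<lambda>u. g ((x + t *\<^sub>R e) + u *\<^sub>R e)) \<circ> (\<lambda>u. u - t) has_vector_derivative 1 *\<^sub>R g' (x + t *\<^sub>R e)) (at t)"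
      by (rule vector_diff_chain_at)
    then show ?thesis by (simp add: o_def algebra_simps)
  qed
  have "(\<lambda>n. \<integral>x. s n x \<partial>lborel) \<longlonglongrightarrow> (\<integral>x. g' x \<partial>lborel)"
  proof (rule integral_dominated_convergence)
    show "g' \<in> borel_measurable lborel" using g' by simp
    show "s n \<in> borel_measurable lborel" for n unfolding s_def by measurable
    show "integrable lborel D" by (rule D)
    show "AE x in lborel. (\<lambda>n. s n x) \<longlonglongrightarrow> g' x"
    proof (rule AE_I2)
      fix x
      show "(\<lambda>n. s n x) \<longlonglongrightarrow> g' x"
        unfolding s_def using has_vector_derivative_sequence[OF deriv[of x]] by simp
    qed
    show "AE x in lborel. norm (s n x) \<le> D x" for n
    proof (rule AE_I2)
      fix x
      define t where "t = inverse (real (Suc n))"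
      have t: "0 < t" "t \<le> 1" "real (Suc n) = inverse t" by (auto simp: t_def inverse_le_1_iff)
      have "norm (g (x + t *\<^sub>R e) - g (x + 0 *\<^sub>R e)) \<le> D x * norm (t - 0)"
      proof (rule differentiable_bound[of "{0..1}" "\<lambda>t. g (x + t *\<^sub>R e)" "\<lambda>t h. h *\<^sub>R g' (x + t *\<^sub>R e)"])
        fix u :: real assume u: "u \<in> {0..1}"
        show "((\<lambda>t. g (x + t *\<^sub>R e)) has_derivative (\<lambda>h. h *\<^sub>R g' (x + u *\<^sub>R e))) (at u within {0..1})"
          using deriv'[of x u] unfolding has_vector_derivative_def by (rule has_derivative_at_withinI)
        show "onorm (\<lambda>h. h *\<^sub>R g' (x + u *\<^sub>R e)) \<le> D x"
          using D(2)[of u x] u by (intro onorm_le) (simp add: mult.commute[of "\<bar>_\<bar>"] mult_right_mono)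
      qed (use t in auto)
      then have "inverse t * norm (g (x + t *\<^sub>R e) - g x) \<le> inverse t * (D x * t)"
        using t by (intro mult_left_mono) auto
      moreover have "inverse t * (D x * t) = D x" using t(1) by simp
      moreover have "norm (s n x) = inverse t * norm (g (x + t *\<^sub>R e) - g x)"
        unfolding s_def t_def[symmetric] t(3) using t(1) by simp
      ultimately show "norm (s n x) \<le> D x" by simp
    qed
  qed
  moreover have "(\<integral>x. s n x \<partial>lborel) = 0" for n
    unfolding s_def using g integral_translation_lborel[OF gm] by simp
  ultimately show ?thesis by (simp add: LIMSEQ_const_iff)
qed

text \<open>For y > 0 this is the product rule and for y < 0 everything is zero. At y = 0 the power
  need not be differentiable when a \<le> 1, but it tends to 0 while v is of order t, so the product
  is o(t). The stated derivative is then 0 as well, since its prefactor vanishes whatever value the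
  division by y has.\<close>

lemma has_vector_derivative_max_powr:
  fixes v :: "real \<Rightarrow> complex"
  assumes v: "(v has_vector_derivative v') (at 0)" and a: "0 < a" and y: "y = 0 \<Longrightarrow> v 0 = 0"
  shows "((\<lambda>t. max 0 (y + t) powr a *\<^sub>R v t) has_vector_derivative
     (max 0 y powr a *\<^sub>R (v' + (a / y) *\<^sub>R v 0))) (at 0)"
proof (cases y "0::real" rule: linorder_cases)
  case less
  have "((\<lambda>t. 0) has_vector_derivative (0::complex)) (at 0)" by simp
  then have "((\<lambda>t. max 0 (y + t) powr a *\<^sub>R v t) has_vector_derivative 0) (at 0)"
    by (rule has_vector_derivative_transform_within_open[of _ _ _ "{..< - y}"]) (use less in auto)
  then show ?thesis using less by simp
next
  case greater
  have "((\<lambda>t. (y + t) powr a) has_field_derivative a * y powr (a - 1)) (at 0)"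
    using greater by (auto intro!: derivative_eq_intros simp: powr_diff)
  from has_vector_derivative_scaleR[OF this v]
  have "((\<lambda>t. (y + t) powr a *\<^sub>R v t) has_vector_derivative (y powr a *\<^sub>R v' + (a * y powr (a - 1)) *\<^sub>R v 0)) (at 0)"
    by simp
  then have "((\<lambda>t. max 0 (y + t) powr a *\<^sub>R v t) has_vector_derivative (y powr a *\<^sub>R v' + (a * y powr (a - 1)) *\<^sub>R v 0)) (at 0)"
    by (rule has_vector_derivative_transform_within_open[of _ _ _ "{- y <..}"]) (use greater in auto)
  moreover have "y powr a *\<^sub>R v' + (a * y powr (a - 1)) *\<^sub>R v 0 = max 0 y powr a *\<^sub>R (v' + (a / y) *\<^sub>R v 0)"
    using greater by (simp add: scaleR_add_right powr_diff mult.commute)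
  ultimately show ?thesis by simp
next
  case equal
  then have v0: "v 0 = 0" using y by simp
  have "((\<lambda>t. max 0 t powr a *\<^sub>R v t) has_vector_derivative 0) (at 0)"
    unfolding has_vector_derivative_def has_derivative_at_alt
  proof (intro conjI allI impI)
    show "bounded_linear (\<lambda>h::real. h *\<^sub>R (0::complex))" by simp
    fix e :: real assume e: "0 < e"
    have alt: "\<forall>e>0. \<exists>d>0. \<forall>y. norm (y - 0) < d \<longrightarrow> norm (v y - v 0 - (y - 0) *\<^sub>R v') \<le> e * norm (y - 0)"
      using v unfolding has_vector_derivative_def has_derivative_at_alt by (rule conjunct2)
    obtain d1 where d1: "0 < d1" "\<And>t. norm (t - 0) < d1 \<Longrightarrow> norm (v t - v 0 - (t - 0) *\<^sub>R v') \<le> 1 * norm (t - 0)"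
      using alt[THEN spec, of 1, THEN mp, OF zero_less_one] by blast
    define c where "c = 1 + norm v'"
    have c: "0 < c" by (simp add: c_def add_pos_nonneg)
    \<comment> \<open>Chosen so that the power factor stays below e / c on this range, while c
      bounds |v t| / |t| on the range given by \<open>d1\<close>.\<close>
    define d2 where "d2 = (e / c) powr (1 / a)"
    have d2: "0 < d2" "d2 powr a = e / c" using e c a by (auto simp: d2_def powr_powr)
    show "\<exists>d>0. \<forall>t. norm (t - 0) < d \<longrightarrow>
      norm (max 0 t powr a *\<^sub>R v t - max 0 0 powr a *\<^sub>R v 0 - (t - 0) *\<^sub>R 0) \<le> e * norm (t - 0)"
    proof (intro exI[of _ "min d1 d2"] conjI allI impI)
      show "0 < min d1 d2" using d1(1) d2(1) by simp
      fix t :: real assume t: "norm (t - 0) < min d1 d2"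
      have "norm (v t - t *\<^sub>R v') \<le> norm t" using d1(2)[of t] t v0 by simp
      then have "norm (v t) \<le> c * norm t"
        using norm_triangle_ineq2[of "v t" "t *\<^sub>R v'"] by (simp add: c_def algebra_simps)
      moreover have "max 0 t powr a \<le> e / c"
        unfolding d2(2)[symmetric] using t a by (intro powr_mono2) auto
      ultimately have "max 0 t powr a * norm (v t) \<le> (e / c) * (c * norm t)"
        using e c by (intro mult_mono) auto
      then show "norm (max 0 t powr a *\<^sub>R v t - max 0 0 powr a *\<^sub>R v 0 - (t - 0) *\<^sub>R 0) \<le> e * norm (t - 0)"
        using c v0 by simp
    qed
  qed
  then show ?thesis using equal by simp
qed

context
  fixes \<alpha> :: "real^'n::finite"
  assumes a: "\<forall>i. \<alpha> $ i > - 1 / 2"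
begin

lemma integrable_lborel_fb:
  assumes f: "f \<in> schwartz_even"
  shows "integrable lborel (\<lambda>x. weight \<alpha> x *\<^sub>R (f x * of_real (fb_kernel \<alpha> m \<xi> x)))"
  using fb_integrand_integrable[OF a f, of m \<xi>] integrable_mu_iff[OF fb_integrand_measurable[OF a f, of m \<xi>]] by simp

text \<open>\<open>G\<close> is the Wronskian of f and the kernel in the i-th variable. The axial
  operator is in Sturm-Liouville form with respect to the weight, so this is Lagrange's identity:
  the derivative of weight times Wronskian is the weight times (Lf k - f Lk), and Lk = -(\<xi>_i)^2
  k.\<close>

lemma fb_line_derivative:
  fixes i :: 'n and \<xi> x :: "real^'n"
  assumes f: "f \<in> schwartz_even"
  defines "G \<equiv> \<lambda>x. partial_deriv i f x * of_real (fb_kernel \<alpha> (\<lambda>_. 0) \<xi> x)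
        - f x * of_real (\<xi> $ i * bessel_d 1 (\<alpha> $ i) (\<xi> $ i * x $ i) * fb_rest \<alpha> i \<xi> x)"
  shows "((\<lambda>t. weight \<alpha> (x + t *\<^sub>R axis i 1) *\<^sub>R G (x + t *\<^sub>R axis i 1)) has_vector_derivative
     weight \<alpha> x *\<^sub>R ((axial_laplace \<alpha> i f x + of_real ((\<xi> $ i)\<^sup>2) * f x) * of_real (fb_kernel \<alpha> (\<lambda>_. 0) \<xi> x))) (at 0)"
proof -
  have s: "smooth_fun f" "even_fun f" using f by (auto simp: schwartz_even_def)
  define \<gamma> where "\<gamma> = \<alpha> $ i"
  have \<gamma>: "\<gamma> \<ge> - 1/2" "0 < 2 * \<gamma> + 1" using a[rule_format, of i] by (auto simp: \<gamma>_def)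
  define l where "l = \<xi> $ i"
  define y where "y = x $ i"
  define R where "R = fb_rest \<alpha> i \<xi> x"
  define W where "W = (\<Prod>j\<in>UNIV - {i}. max 0 (x $ j) powr (2 * \<alpha> $ j + 1))"
  have xi: "(x + t *\<^sub>R axis i 1) $ i = y + t" for t by (simp add: y_def axis_def)
  have rest: "fb_rest \<alpha> i \<xi> (x + t *\<^sub>R axis i 1) = R" for t
    unfolding fb_rest_def R_def by (rule prod.cong) (auto simp: axis_def)
  have w: "weight \<alpha> (x + t *\<^sub>R axis i 1) = max 0 (y + t) powr (2 * \<gamma> + 1) * W" for t
    unfolding weight_def by (subst prod.remove[of _ i]) (auto simp: axis_def y_def W_def \<gamma>_def intro!: prod.cong)
  have k: "fb_kernel \<alpha> (\<lambda>_. 0) \<xi> (x + t *\<^sub>R axis i 1) = bessel_j \<gamma> (l * (y + t)) * R" for t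
    unfolding fb_kernel_zero[of \<alpha> \<xi> _ i] rest xi l_def \<gamma>_def ..
  define v where "v t = partial_deriv i f (x + t *\<^sub>R axis i 1) * of_real (bessel_j \<gamma> (l * (y + t)) * R)
     - f (x + t *\<^sub>R axis i 1) * of_real (l * bessel_d 1 \<gamma> (l * (y + t)) * R)" for t
  have G: "G (x + t *\<^sub>R axis i 1) = v t" for t
    unfolding G_def v_def k rest xi l_def \<gamma>_def ..
  have bd: "((\<lambda>t. complex_of_real (c * bessel_d m \<gamma> (l * (y + t)) * R)) has_vector_derivative
      of_real (c * l * bessel_d (Suc m) \<gamma> (l * y) * R)) (at 0)" for m c
  proof -
    have "((\<lambda>t. l * (y + t)) has_real_derivative l) (at 0)" by (auto intro!: derivative_eq_intros)
    moreover have "(bessel_d m \<gamma> has_real_derivative bessel_d (Suc m) \<gamma> (l * y)) (at (l * (y + 0)))"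
      using bessel_d_deriv[OF \<gamma>(1)] by simp
    ultimately have "((\<lambda>t. bessel_d m \<gamma> (l * (y + t))) has_real_derivative bessel_d (Suc m) \<gamma> (l * y) * l) (at 0)"
      by (intro DERIV_chain2[where f = "bessel_d m \<gamma>" and g = "\<lambda>t. l * (y + t)"])
    from DERIV_cmult_right[OF DERIV_cmult[OF this, of c], of R]
    have "((\<lambda>t. c * bessel_d m \<gamma> (l * (y + t)) * R) has_real_derivative c * (bessel_d (Suc m) \<gamma> (l * y) * l) * R) (at 0)" .
    from has_vector_derivative_of_real[OF this] show ?thesis by (simp add: mult_ac)
  qed
  have f1: "((\<lambda>t. f (x + t *\<^sub>R axis i 1)) has_vector_derivative partial_deriv i f x) (at 0)"
    using has_vector_derivative_line[of f x 0 i] smooth_fun_differentiable[OF s(1)] by simp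
  have f2: "((\<lambda>t. partial_deriv i f (x + t *\<^sub>R axis i 1)) has_vector_derivative partial_deriv i (partial_deriv i f) x) (at 0)"
    using has_vector_derivative_line[of "partial_deriv i f" x 0 i] smooth_fun_differentiable[OF smooth_fun_partial_deriv[OF s(1)]] by simp
  define v' where "v' = partial_deriv i (partial_deriv i f) x * of_real (bessel_j \<gamma> (l * y) * R)
     - f x * of_real (l * l * bessel_d 2 \<gamma> (l * y) * R)"
  have "(v has_vector_derivative
      (partial_deriv i f (x + 0 *\<^sub>R axis i 1) * of_real (1 * l * bessel_d (Suc 0) \<gamma> (l * y) * R)
         + partial_deriv i (partial_deriv i f) x * of_real (1 * bessel_d 0 \<gamma> (l * (y + 0)) * R))
      - (f (x + 0 *\<^sub>R axis i 1) * of_real (l * l * bessel_d (Suc 1) \<gamma> (l * y) * R)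
         + partial_deriv i f x * of_real (l * bessel_d 1 \<gamma> (l * (y + 0)) * R))) (at 0)"
    using has_vector_derivative_diff[OF has_vector_derivative_mult[OF f2 bd[of 1 0]] has_vector_derivative_mult[OF f1 bd[of l 1]]]
    unfolding v_def[abs_def] by (simp only: bessel_d.simps mult_1)
  \<comment> \<open>The mixed terms with one derivative on each factor cancel, as always for a
    Wronskian.\<close>
  then have v: "(v has_vector_derivative v') (at 0)"
    by (simp add: v'_def numeral_2_eq_2 del: bessel_d.simps(2,3))
  \<comment> \<open>On the hyperplane the derivatives of both even functions, f and the Bessel
    factor, vanish.\<close>
  have "v 0 = 0" if "y = 0"
    using partial_deriv_even_zero[OF s, of x i] that by (simp add: v_def y_def)
  from has_vector_derivative_max_powr[OF v \<gamma>(2) this]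
  have "((\<lambda>t. W *\<^sub>R (max 0 (y + t) powr (2 * \<gamma> + 1) *\<^sub>R v t)) has_vector_derivative
      W *\<^sub>R (max 0 y powr (2 * \<gamma> + 1) *\<^sub>R (v' + ((2 * \<gamma> + 1) / y) *\<^sub>R v 0))) (at 0)"
    by (intro bounded_linear.has_vector_derivative[OF bounded_linear_scaleR_right]) auto
  moreover have "W *\<^sub>R (max 0 (y + t) powr (2 * \<gamma> + 1) *\<^sub>R v t) = weight \<alpha> (x + t *\<^sub>R axis i 1) *\<^sub>R G (x + t *\<^sub>R axis i 1)" for t
    unfolding w G by (simp add: mult.commute)
  moreover have "W *\<^sub>R (max 0 y powr (2 * \<gamma> + 1) *\<^sub>R (v' + ((2 * \<gamma> + 1) / y) *\<^sub>R v 0)) =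
     weight \<alpha> x *\<^sub>R ((axial_laplace \<alpha> i f x + of_real ((\<xi> $ i)\<^sup>2) * f x) * of_real (fb_kernel \<alpha> (\<lambda>_. 0) \<xi> x))"
  proof -
    have w0: "weight \<alpha> x = max 0 y powr (2 * \<gamma> + 1) * W" using w[of 0] by simp
    have k0: "fb_kernel \<alpha> (\<lambda>_. 0) \<xi> x = bessel_j \<gamma> (l * y) * R" using k[of 0] by simp
    show ?thesis
    proof (cases "0 < y")
      case True
      \<comment> \<open>Bessel's equation for t = l y, scaled by l^2. The case l = 0 is separate
        because the equation divides by its argument; there both sides are zero.\<close>
      have be: "l * l * bessel_d 2 \<gamma> (l * y) + (2 * \<gamma> + 1) / y * (l * bessel_d 1 \<gamma> (l * y)) = - (l\<^sup>2 * bessel_j \<gamma> (l * y))"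
      proof (cases "l = 0")
        case False
        then have "l * l * (bessel_d 2 \<gamma> (l * y) + (2 * \<gamma> + 1) / (l * y) * bessel_d 1 \<gamma> (l * y)) = l * l * (- bessel_j \<gamma> (l * y))"
          using bessel_equation[OF \<gamma>(1), of "l * y"] True by (simp del: bessel_d.simps)
        moreover have "l * l * ((2 * \<gamma> + 1) / (l * y) * bessel_d 1 \<gamma> (l * y)) = (2 * \<gamma> + 1) / y * (l * bessel_d 1 \<gamma> (l * y))"
          using False True by (simp add: field_simps del: bessel_d.simps)
        ultimately show ?thesis by (simp add: distrib_left power2_eq_square del: bessel_d.simps)
      qed simp
      define A B b where "A = l * l * bessel_d 2 \<gamma> (l * y)" and "B = l * bessel_d 1 \<gamma> (l * y)" and "b = (2 * \<gamma> + 1) / y"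
      define p q j where "p = partial_deriv i (partial_deriv i f) x" and "q = partial_deriv i f x" and "j = bessel_j \<gamma> (l * y)"
      have be': "A + b * B = - (l\<^sup>2 * j)" using be by (simp add: A_def B_def b_def j_def)
      have v'_eq: "v' = p * of_real (j * R) - f x * of_real (A * R)" unfolding v'_def p_def j_def A_def ..
      have v0_eq: "v 0 = q * of_real (j * R) - f x * of_real (B * R)" unfolding v_def q_def j_def B_def by simp
      have "complex_of_real (2 * \<gamma> + 1) * radial_quot i f x = of_real b * q"
        using True by (simp add: radial_quot_def y_def[symmetric] b_def q_def)
      moreover have "v' + b *\<^sub>R v 0 = (p + of_real b * q) * of_real (j * R) - f x * of_real ((A + b * B) * R)"
        unfolding v'_eq v0_eq by (simp add: scaleR_conv_of_real algebra_simps)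
      ultimately have "v' + b *\<^sub>R v 0 = (p + of_real (2 * \<gamma> + 1) * radial_quot i f x + of_real (l\<^sup>2) * f x) * of_real (j * R)"
        unfolding be' by (simp add: algebra_simps)
      then show ?thesis
        unfolding w0 k0 axial_laplace_def p_def b_def j_def \<gamma>_def[symmetric] l_def[symmetric] by (simp add: mult.commute)
    next
      case False
      then show ?thesis unfolding w0 by simp
    qed
  qed
  ultimately show ?thesis by simp
qed

lemma fb_by_parts:
  assumes f: "f \<in> schwartz_even"
  shows "(\<integral>x. weight \<alpha> x *\<^sub>R ((axial_laplace \<alpha> i f x + of_real ((\<xi> $ i)\<^sup>2) * f x) * of_real (fb_kernel \<alpha> (\<lambda>_. 0) \<xi> x)) \<partial>lborel) = 0" (is "(\<integral>x. ?g' x \<partial>lborel) = 0")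
    and "integrable lborel (\<lambda>x. weight \<alpha> x *\<^sub>R ((axial_laplace \<alpha> i f x + of_real ((\<xi> $ i)\<^sup>2) * f x) * of_real (fb_kernel \<alpha> (\<lambda>_. 0) \<xi> x)))"
proof -
  let ?k = "fb_kernel \<alpha> (\<lambda>_. 0) \<xi>"
  let ?N = "real CARD('n) + 2"
  have ge: "\<alpha> $ i \<ge> - 1/2" for i using a[rule_format, of i] by linarith
  define h where "h x = axial_laplace \<alpha> i f x + of_real ((\<xi> $ i)\<^sup>2) * f x" for x
  have hs: "h \<in> symbols K" for K unfolding h_def axial_laplace_def
    by (intro symbols_add symbols_cmult symbols_partial_deriv radial_quot_symbols schwartz_even_symbols f)
  have km[measurable]: "?k \<in> borel_measurable borel" by (rule fb_kernel_measurable[OF a])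
  have hm[measurable]: "h \<in> borel_measurable borel" by (rule smooth_fun_measurable[OF symbols_smooth[OF hs[of 0]]])
  have g'm: "?g' \<in> borel_measurable borel" unfolding h_def[symmetric] by measurable
  \<comment> \<open>The undifferentiated kernel is a product of values of j, each of modulus at most
    1 by the energy bound.\<close>
  define Ck :: real where "Ck = 1"
  have Ck: "0 \<le> Ck" "\<bar>?k x\<bar> \<le> Ck" for x
    unfolding fb_kernel_def abs_prod Ck_def using bessel_abs_le_1(1)[OF ge] by (auto intro!: prod_le_1)
  obtain Ch where Ch: "0 \<le> Ch" "\<And>x. norm (h x) \<le> Ch * jap x powr decay_rate \<alpha>" using symbols_bound[OF hs] by blast
  have g'b: "norm (?g' x) \<le> (Ch * Ck) * jap x powr (- ?N)" for x
    unfolding h_def[symmetric]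
  proof (rule weight_decay[OF a, where f = "\<lambda>x. h x * of_real (?k x)"])
    have "norm (h x) * \<bar>?k x\<bar> \<le> (Ch * jap x powr decay_rate \<alpha>) * Ck"
      using Ch Ck by (intro mult_mono) auto
    then show "norm (h x * of_real (?k x)) \<le> (Ch * Ck) * jap x powr decay_rate \<alpha>"
      by (simp add: norm_mult mult_ac)
  qed
  show "integrable lborel ?g'" by (rule integrable_lborel_decay[OF g'm g'b])
  let ?u = "\<lambda>x. partial_deriv i f x * of_real (?k x)
        - f x * of_real (\<xi> $ i * bessel_d 1 (\<alpha> $ i) (\<xi> $ i * x $ i) * fb_rest \<alpha> i \<xi> x)"
  show "(\<integral>x. ?g' x \<partial>lborel) = 0"
  proof (rule integral_line_derivative_zero)
    show "?g' \<in> borel_measurable borel" by (rule g'm)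
    show "((\<lambda>t. weight \<alpha> (x + t *\<^sub>R axis i 1) *\<^sub>R ?u (x + t *\<^sub>R axis i 1)) has_vector_derivative ?g' x) (at 0)" for x
      by (rule fb_line_derivative[OF f])
    show "integrable lborel (\<lambda>x. weight \<alpha> x *\<^sub>R ?u x)"
    proof -
      obtain Cf where Cf: "0 \<le> Cf" "\<And>x. norm (f x) \<le> Cf * jap x powr decay_rate \<alpha>"
        using symbols_bound[OF schwartz_even_symbols[OF f]] by blast
      obtain Cd where Cd: "0 \<le> Cd" "\<And>x. norm (partial_deriv i f x) \<le> Cd * jap x powr decay_rate \<alpha>"
        using symbols_bound[OF symbols_partial_deriv[OF schwartz_even_symbols[OF f]]] by blast
      define Cr where "Cr = \<bar>\<xi> $ i\<bar> * 1 * 1"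
      have r: "\<bar>\<xi> $ i * bessel_d 1 (\<alpha> $ i) (\<xi> $ i * x $ i) * fb_rest \<alpha> i \<xi> x\<bar> \<le> Cr" for x
        unfolding abs_mult Cr_def fb_rest_def abs_prod using bessel_abs_le_1 ge
        by (intro mult_mono prod_le_1) (auto simp: prod_nonneg simp del: bessel_d.simps)
      have b: "norm (weight \<alpha> x *\<^sub>R ?u x) \<le> (Cd * Ck + Cf * Cr) * jap x powr (- ?N)" for x
      proof (rule weight_decay[OF a])
        have "norm (partial_deriv i f x) * \<bar>?k x\<bar> \<le> (Cd * jap x powr decay_rate \<alpha>) * Ck"
          using Cd Ck by (intro mult_mono) auto
        moreover have "norm (f x) * \<bar>\<xi> $ i * bessel_d 1 (\<alpha> $ i) (\<xi> $ i * x $ i) * fb_rest \<alpha> i \<xi> x\<bar> \<le> (Cf * jap x powr decay_rate \<alpha>) * Cr"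
          using Cf r[of x] by (intro mult_mono) auto
        moreover have "norm (?u x) \<le> norm (partial_deriv i f x) * \<bar>?k x\<bar>
          + norm (f x) * \<bar>\<xi> $ i * bessel_d 1 (\<alpha> $ i) (\<xi> $ i * x $ i) * fb_rest \<alpha> i \<xi> x\<bar>"
          using norm_triangle_ineq4[of "partial_deriv i f x * of_real (?k x)"
            "f x * of_real (\<xi> $ i * bessel_d 1 (\<alpha> $ i) (\<xi> $ i * x $ i) * fb_rest \<alpha> i \<xi> x)"]
          by (simp only: norm_mult norm_of_real)
        ultimately show "norm (?u x) \<le> (Cd * Ck + Cf * Cr) * jap x powr decay_rate \<alpha>"
          by (simp add: algebra_simps)
      qed
      have s: "smooth_fun f" using f by (simp add: schwartz_even_def)
      have [measurable]: "f \<in> borel_measurable borel" "partial_deriv i f \<in> borel_measurable borel"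
        by (intro smooth_fun_measurable smooth_fun_partial_deriv s)+
      have [measurable]: "(\<lambda>x. bessel_d 1 (\<alpha> $ i) (\<xi> $ i * x $ i)) \<in> borel_measurable borel"
        by (rule bessel_d_measurable[OF ge])
      have "(\<lambda>x. bessel_j (\<alpha> $ j) (\<xi> $ j * x $ j)) \<in> borel_measurable borel" for j
        using bessel_d_measurable[OF ge[of j], of 0 "\<xi> $ j" j] by simp
      then have [measurable]: "(\<lambda>x. fb_rest \<alpha> i \<xi> x) \<in> borel_measurable borel"
        unfolding fb_rest_def by (intro borel_measurable_prod)
      have "(\<lambda>x. weight \<alpha> x *\<^sub>R ?u x) \<in> borel_measurable borel" by measurable
      then show ?thesis by (rule integrable_lborel_decay) (rule b)
    qed
    \<comment> \<open>The dominating function has to control the derivative on a segment of length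
      1. For y within distance 1 of x, |x|^2 \<le> 2 |y|^2 + 2, hence \<open>jap x\<close> is at
      most 3 times \<open>jap y\<close>; this is the origin of the factor
      \<open>3 powr ?N\<close>.\<close>
    show "integrable lborel (\<lambda>x::real^'n. (Ch * Ck * 3 powr ?N) * jap x powr (- ?N))"
      by (rule integrable_mult_right[OF integrable_jap_powr])
    fix x :: "real^'n" and t :: real assume t: "0 \<le> t" "t \<le> 1"
    let ?y = "x + t *\<^sub>R axis i 1"
    have "norm x \<le> norm ?y + 1"
      using norm_triangle_ineq4[of ?y "t *\<^sub>R axis i 1"] t by simp
    then have "(norm x)\<^sup>2 \<le> (norm ?y + 1)\<^sup>2" by (intro power_mono) auto
    also have "\<dots> \<le> 2 * (norm ?y)\<^sup>2 + 2"
      using zero_le_power2[of "norm ?y - 1"] by (simp add: power2_eq_square algebra_simps)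
    finally have "(norm x)\<^sup>2 \<le> 2 * (norm ?y)\<^sup>2 + 2" .
    moreover have "1 + u \<le> 3 * (1 + v)" if "u \<le> 2 * v + 2" "0 \<le> v" for u v :: real using that by simp
    ultimately have "jap x \<le> 3 * jap ?y" using zero_le_power2 by blast
    then have "(3 * jap ?y) powr (- ?N) \<le> jap x powr (- ?N)" by (intro powr_mono2') auto
    moreover have "J powr (- N) \<le> 3 powr N * K" if "(3 * J) powr (- N) \<le> K" "0 < J" for J N K :: real
      using that by (simp add: powr_mult powr_minus field_simps)
    ultimately have "jap ?y powr (- ?N) \<le> 3 powr ?N * jap x powr (- ?N)" using jap_pos(1) by blast
    then have "(Ch * Ck) * jap ?y powr (- ?N) \<le> (Ch * Ck) * (3 powr ?N * jap x powr (- ?N))"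
      using Ch Ck by (intro mult_left_mono) auto
    then show "norm (?g' ?y) \<le> (Ch * Ck * 3 powr ?N) * jap x powr (- ?N)"
      using order_trans[OF g'b[of ?y]] by (simp only: mult.assoc)
  qed
qed

section \<open>The transform preserves even Schwartz functions\<close>

lemma fourier_bessel_laplace:
  assumes f: "f \<in> schwartz_even"
  shows "fourier_bessel \<alpha> (laplace \<alpha> f) \<xi> = - of_real ((norm \<xi>)\<^sup>2) * fourier_bessel \<alpha> f \<xi>"
proof -
  let ?k = "fb_kernel \<alpha> (\<lambda>_. 0) \<xi>"
  have I: "fourier_bessel \<alpha> g \<xi> = (\<integral>x. weight \<alpha> x *\<^sub>R (g x * of_real (?k x)) \<partial>lborel)" if "g \<in> schwartz_even" for g
    unfolding fourier_bessel_eq fb_deriv_def by (rule integral_mu[OF fb_integrand_measurable[OF a that]])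
  have "0 = (\<Sum>i\<in>UNIV. \<integral>x. weight \<alpha> x *\<^sub>R ((axial_laplace \<alpha> i f x + of_real ((\<xi> $ i)\<^sup>2) * f x) * of_real (?k x)) \<partial>lborel)"
    unfolding fb_by_parts(1)[OF f] by simp
  also have "\<dots> = (\<integral>x. (\<Sum>i\<in>UNIV. weight \<alpha> x *\<^sub>R ((axial_laplace \<alpha> i f x + of_real ((\<xi> $ i)\<^sup>2) * f x) * of_real (?k x))) \<partial>lborel)"
    by (rule Bochner_Integration.integral_sum[symmetric]) (rule fb_by_parts(2)[OF f])
  also have "\<dots> = (\<integral>x. weight \<alpha> x *\<^sub>R (laplace \<alpha> f x * of_real (?k x)) + of_real ((norm \<xi>)\<^sup>2) * (weight \<alpha> x *\<^sub>R (f x * of_real (?k x))) \<partial>lborel)"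
    unfolding laplace_axial norm_power2_vec of_real_sum scaleR_sum_right[symmetric] sum_distrib_right[symmetric] sum.distrib
    by (simp only: distrib_right scaleR_add_right mult_scaleR_right mult.assoc)
  also have "\<dots> = fourier_bessel \<alpha> (laplace \<alpha> f) \<xi> + of_real ((norm \<xi>)\<^sup>2) * fourier_bessel \<alpha> f \<xi>"
    unfolding I[OF f] I[OF laplace_schwartz_even[OF f]]
    by (simp only: Bochner_Integration.integral_add[OF integrable_lborel_fb[OF laplace_schwartz_even[OF f]]
          integrable_mult_right[OF integrable_lborel_fb[OF f]]] integral_mult_right_zero)
  finally show ?thesis by (simp add: eq_neg_iff_add_eq_0)
qed

lemma fourier_bessel_even: "even_fun (fourier_bessel \<alpha> f)"
proof -
  have "bessel_j (\<alpha> $ j) (flip i \<xi> $ j * x $ j) = bessel_j (\<alpha> $ j) (\<xi> $ j * x $ j)" for i j \<xi> x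
    using bessel_j_even[of "\<alpha> $ j" "\<xi> $ j * x $ j"] by (cases "j = i") auto
  then show ?thesis unfolding even_fun_def fourier_bessel_def by simp
qed

lemma fourier_bessel_jap_power:
  assumes "f \<in> schwartz_even"
  shows "\<exists>g\<in>schwartz_even. \<forall>\<xi>. of_real (jap \<xi> ^ N) * fourier_bessel \<alpha> f \<xi> = fourier_bessel \<alpha> g \<xi>"
proof (induction N)
  case 0
  show ?case using assms by auto
next
  case (Suc N)
  then obtain g where g: "g \<in> schwartz_even" "\<And>\<xi>. of_real (jap \<xi> ^ N) * fourier_bessel \<alpha> f \<xi> = fourier_bessel \<alpha> g \<xi>" by blast
  have "fourier_bessel \<alpha> (\<lambda>x. g x - laplace \<alpha> g x) \<xi> = of_real (jap \<xi>) * fourier_bessel \<alpha> g \<xi>" for \<xi>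
  proof -
    have "fourier_bessel \<alpha> (\<lambda>x. g x - laplace \<alpha> g x) \<xi> = fourier_bessel \<alpha> g \<xi> - fourier_bessel \<alpha> (laplace \<alpha> g) \<xi>"
      unfolding fourier_bessel_eq fb_deriv_def left_diff_distrib
      by (rule Bochner_Integration.integral_diff) (intro fb_integrand_integrable[OF a] g laplace_schwartz_even)+
    then show ?thesis unfolding fourier_bessel_laplace[OF g(1)] by (simp add: algebra_simps)
  qed
  then have "of_real (jap \<xi> ^ Suc N) * fourier_bessel \<alpha> f \<xi> = fourier_bessel \<alpha> (\<lambda>x. g x - laplace \<alpha> g x) \<xi>" for \<xi>
    using g(2)[of \<xi>] by (simp add: mult.assoc)
  then show ?case using schwartz_even_diff[OF g(1) laplace_schwartz_even[OF g(1)]] by blast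
qed

text \<open>The transform of f is \<open>jap \<xi> powr (- real N)\<close> times the transform of
  another even Schwartz function, which is a symbol of order 0. The product rule for symbols then
  gives the decay of all derivatives at once.\<close>

lemma fourier_bessel_schwartz_even:
  assumes f: "f \<in> schwartz_even"
  shows "fourier_bessel \<alpha> f \<in> schwartz_even"
proof -
  have "fourier_bessel \<alpha> f \<in> symbols K" for K
  proof -
    define N where "N = nat \<lceil>- K\<rceil>"
    have N: "- real N \<le> K" unfolding N_def by linarith
    obtain g where g: "g \<in> schwartz_even" "\<And>\<xi>. of_real (jap \<xi> ^ N) * fourier_bessel \<alpha> f \<xi> = fourier_bessel \<alpha> g \<xi>"
      using fourier_bessel_jap_power[OF f] by blast
    have "fourier_bessel \<alpha> f = (\<lambda>\<xi>. of_real (jap \<xi> powr (- real N)) * fourier_bessel \<alpha> g \<xi>)"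
    proof
      fix \<xi> :: "real^'n"
      have "jap \<xi> powr (- real N) * jap \<xi> ^ N = 1" by (simp add: powr_minus powr_realpow)
      then show "fourier_bessel \<alpha> f \<xi> = of_real (jap \<xi> powr (- real N)) * fourier_bessel \<alpha> g \<xi>"
        unfolding g(2)[symmetric] mult.assoc[symmetric] of_real_mult[symmetric] by simp
    qed
    moreover have "(\<lambda>\<xi>. of_real (jap \<xi> powr (- real N)) * fourier_bessel \<alpha> g \<xi>) \<in> symbols (- real N + 0)"
      by (intro symbols_mult symbols_jap_powr fourier_bessel_symbols0[OF a] g)
    ultimately have "fourier_bessel \<alpha> f \<in> symbols (- real N)" by simp
    then show ?thesis using N by (rule symbols_mono)
  qed
  then show ?thesis using fourier_bessel_even by (simp add: schwartz_even_iff)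
qed

end

subsection \<open>Gaussian-type test functions\<close>

text \<open>The M-th term of the exponential series at 1 + r is at most the whole sum; the shift by
  1 accounts for the factor \<open>exp 1\<close>.\<close>

lemma exp_minus_le_powr:
  assumes "0 \<le> (r::real)"
  shows "exp (- r) \<le> fact M * exp 1 * (1 + r) powr (- real M)"
proof -
  have "(\<Sum>n\<in>{M}. (1 + r) ^ n /\<^sub>R fact n) \<le> (\<Sum>n. (1 + r) ^ n /\<^sub>R fact n)"
    using assms by (intro sum_le_suminf summable_exp_generic) auto
  then have "(1 + r) ^ M / fact M \<le> exp (1 + r)" by (simp add: exp_def divide_inverse mult.commute)
  then have "exp (- r) * ((1 + r) ^ M / fact M) \<le> exp (- r) * exp (1 + r)" by (intro mult_left_mono) auto
  also have "\<dots> = exp 1" by (simp add: exp_add[symmetric])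
  finally show ?thesis using assms by (simp add: powr_minus powr_realpow field_simps)
qed

text \<open>The products of \<open>exp (- p x)\<close> with symbols of arbitrary order form a set
  closed under differentiation, since each derivative multiplies by a derivative of p at worst. The
  order is free to grow because the Gaussian bound from \<open>pos\<close> absorbs every power of
  \<open>jap x\<close>.\<close>

lemma symbols_exp_minus:
  assumes p: "p \<in> symbols L" and pos: "\<And>x. (norm x)\<^sup>2 \<le> Re (p x)"
  shows "(\<lambda>x::real^'n::finite. exp (- p x)) \<in> symbols K"
proof (rule symbols_coinduct[of _ "{(\<lambda>x. q x * exp (- p x)) | q a. q \<in> symbols a}"])
  have "(\<lambda>x. (1::complex)) \<in> symbols 0" by (rule symbols_const) simp
  then show "(\<lambda>x::real^'n. exp (- p x)) \<in> {(\<lambda>x. q x * exp (- p x)) | q a. q \<in> symbols a}"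
    by (intro CollectI exI[of _ "\<lambda>x. 1"]) auto
next
  have d: "((\<lambda>x. exp (- p x)) has_derivative (\<lambda>h. \<Sum>i\<in>UNIV. (h $ i) *\<^sub>R (- partial_deriv i p x * exp (- p x)))) (at x)" for x
  proof -
    have "((\<lambda>x. - p x) has_derivative (\<lambda>h. - (\<Sum>i\<in>UNIV. (h $ i) *\<^sub>R partial_deriv i p x))) (at x)"
      by (intro has_derivative_minus has_derivative_partials symbols_differentiable[OF p])
    moreover have "(exp has_derivative (\<lambda>h. exp (- p x) * h)) (at (- p x))"
      using DERIV_exp[of "- p x"] by (simp add: has_field_derivative_def)
    ultimately have "((\<lambda>x. exp (- p x)) has_derivative (\<lambda>h. exp (- p x) * - (\<Sum>i\<in>UNIV. (h $ i) *\<^sub>R partial_deriv i p x))) (at x)"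
      by (rule has_derivative_compose)
    moreover have "exp (- p x) * - (\<Sum>i\<in>UNIV. (h $ i) *\<^sub>R partial_deriv i p x) =
      (\<Sum>i\<in>UNIV. (h $ i) *\<^sub>R (- partial_deriv i p x * exp (- p x)))" for h :: "real^'n"
      by (simp add: sum_distrib_left sum_negf mult.commute)
    ultimately show ?thesis by simp
  qed
  fix h :: "real^'n \<Rightarrow> complex" assume "h \<in> {(\<lambda>x. q x * exp (- p x)) | q a. q \<in> symbols a}"
  then obtain q a where h: "h = (\<lambda>x. q x * exp (- p x))" and q: "q \<in> symbols a" by blast
  have ed: "(\<lambda>x. exp (- p x)) differentiable (at x)" for x using d unfolding differentiable_def by blast
  show "h differentiable (at x)" for x
    unfolding h by (intro differentiable_mult symbols_differentiable[OF q] ed)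
  have "partial_deriv i h = (\<lambda>x. (partial_deriv i q x - q x * partial_deriv i p x) * exp (- p x))" for i
    unfolding h partial_deriv_mult[OF symbols_differentiable[OF q] ed] partial_deriv_eq_sumI[OF d, abs_def]
    by (rule ext) (simp add: partial_deriv_mult[OF symbols_differentiable[OF q] ed] partial_deriv_eq_sumI[OF d] algebra_simps)
  moreover have "(\<lambda>x. partial_deriv i q x - q x * partial_deriv i p x) \<in> symbols (max a (a + L))" for i
    by (intro symbols_diff symbols_mono[OF symbols_partial_deriv[OF q]]
        symbols_mono[OF symbols_mult[OF q symbols_partial_deriv[OF p]]]) auto
  ultimately show "partial_deriv i h \<in> {(\<lambda>x. q x * exp (- p x)) | q a. q \<in> symbols a}" for i
    by (intro CollectI exI[of _ "\<lambda>x. partial_deriv i q x - q x * partial_deriv i p x"] exI[of _ "max a (a + L)"] conjI)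
  obtain C where C: "0 \<le> C" "\<And>x. norm (q x) \<le> C * jap x powr a" using symbols_bound[OF q] by blast
  define M where "M = nat \<lceil>a - K\<rceil>"
  have M: "a - real M \<le> K" unfolding M_def by linarith
  have "norm (h x) \<le> (C * (fact M * exp 1)) * jap x powr K" for x
  proof -
    have "norm (h x) = norm (q x) * exp (- Re (p x))" by (simp add: h norm_mult)
    also have "\<dots> \<le> (C * jap x powr a) * (fact M * exp 1 * jap x powr (- real M))"
    proof (intro mult_mono C(2))
      have "exp (- Re (p x)) \<le> exp (- (norm x)\<^sup>2)" using pos[of x] by simp
      also have "\<dots> \<le> fact M * exp 1 * jap x powr (- real M)" by (rule exp_minus_le_powr) simp
      finally show "exp (- Re (p x)) \<le> fact M * exp 1 * jap x powr (- real M)" .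
    qed (use C in auto)
    also have "\<dots> = (C * (fact M * exp 1)) * jap x powr (a - real M)"
      by (simp add: powr_diff powr_minus divide_inverse mult_ac)
    also have "\<dots> \<le> (C * (fact M * exp 1)) * jap x powr K"
      using C M by (intro mult_left_mono powr_mono) auto
    finally show ?thesis .
  qed
  then show "\<exists>C. \<forall>x. norm (h x) \<le> C * jap x powr K" by blast
qed

text \<open>On the positive orthant \<open>exp (- box_exponent b k x)\<close> tends to \<open>exp (- |x|\<^sup>2)\<close> times the indicator of
  \<open>{..b}\<close>; the factor \<open>1 / k\<close> makes this hold at the boundary as well.\<close>

definition box_exponent :: "real^'n::finite \<Rightarrow> nat \<Rightarrow> real^'n \<Rightarrow> real" where
  "box_exponent b k x = (norm x)\<^sup>2 + (\<Sum>i\<in>UNIV. (x $ i / b $ i) ^ (2 * k)) / real k"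

lemma box_exponent_ge: "(norm x)\<^sup>2 \<le> box_exponent b k x"
  unfolding box_exponent_def by (simp add: sum_nonneg)

lemma schwartz_even_box_function:
  "(\<lambda>x. of_real (exp (- box_exponent b k x))) \<in> schwartz_even"
proof -
  have 1: "(\<lambda>x. complex_of_real ((x $ i / b $ i) ^ (2 * k))) \<in> symbols (1 + real k)" for i
  proof -
    have "(\<lambda>x. (of_real (1 / b $ i) * complex_of_real (x $ i)) ^ (2 * k)) \<in> symbols (real (2 * k) * (1 / 2))"
      by (intro symbols_power symbols_cmult symbols_coord)
    then have "(\<lambda>x. (of_real (1 / b $ i) * complex_of_real (x $ i)) ^ (2 * k)) \<in> symbols (1 + real k)"
      by (rule symbols_mono) simp
    moreover have "(\<lambda>x. (of_real (1 / b $ i) * complex_of_real (x $ i)) ^ (2 * k)) = (\<lambda>x. complex_of_real ((x $ i / b $ i) ^ (2 * k)))"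
      by simp
    ultimately show ?thesis by simp
  qed
  have "(\<lambda>x. complex_of_real ((norm x)\<^sup>2) + of_real (1 / real k) * (\<Sum>i\<in>UNIV. complex_of_real ((x $ i / b $ i) ^ (2 * k)))) \<in> symbols (1 + real k)"
    by (intro symbols_add symbols_mono[OF symbols_norm2] symbols_cmult symbols_sum 1) auto
  moreover have "(\<lambda>x. complex_of_real ((norm x)\<^sup>2) + of_real (1 / real k) * (\<Sum>i\<in>UNIV. complex_of_real ((x $ i / b $ i) ^ (2 * k)))) =
     (\<lambda>x. complex_of_real (box_exponent b k x))"
    by (simp add: box_exponent_def)
  ultimately have P: "(\<lambda>x. complex_of_real (box_exponent b k x)) \<in> symbols (1 + real k)" by simp
  have "(\<lambda>x. of_real (exp (- box_exponent b k x))) \<in> symbols K" for K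
    using symbols_exp_minus[OF P, of K] box_exponent_ge[of _ b k] by (simp add: exp_of_real[symmetric])
  moreover have "box_exponent b k (flip i x) = box_exponent b k x" for i x
  proof -
    have "(flip i x $ j / b $ j) ^ (2 * k) = (x $ j / b $ j) ^ (2 * k)" for j by (simp add: power_mult)
    then show ?thesis unfolding box_exponent_def norm_flip by simp
  qed
  ultimately show ?thesis by (simp add: schwartz_even_iff even_fun_def)
qed

lemma power_div_nat_tendsto:
  fixes v :: real
  assumes "0 \<le> v"
  shows "v \<le> 1 \<Longrightarrow> (\<lambda>k. v ^ k / real k) \<longlonglongrightarrow> 0"
    and "1 < v \<Longrightarrow> filterlim (\<lambda>k. v ^ k / real k) at_top sequentially"
proof -
  assume v: "v \<le> 1"
  show "(\<lambda>k. v ^ k / real k) \<longlonglongrightarrow> 0"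
  proof (rule tendsto_sandwich[OF _ _ tendsto_const lim_1_over_n])
    show "\<forall>\<^sub>F k in sequentially. v ^ k / real k \<le> 1 / real k"
      using assms v by (intro always_eventually allI divide_right_mono power_le_one) auto
  qed (use assms in auto)
next
  assume v: "1 < v"
  show "filterlim (\<lambda>k. v ^ k / real k) at_top sequentially"
    using v by real_asymp
qed

lemma box_function_tendsto:
  fixes x b :: "real^'n::finite"
  assumes b: "\<And>i. 0 < b $ i" and x: "\<And>i. 0 < x $ i"
  shows "(\<lambda>k. exp (- box_exponent b k x)) \<longlonglongrightarrow> indicator {..b} x * exp (- (norm x)\<^sup>2)"
proof (cases "x \<in> {..b}")
  case True
  then have le: "x $ i \<le> b $ i" for i by (simp add: less_eq_vec_def)
  have "(\<lambda>k. ((x $ i / b $ i)\<^sup>2) ^ k / real k) \<longlonglongrightarrow> 0" for i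
    using b[of i] x[of i] le[of i] by (intro power_div_nat_tendsto(1)) (auto simp: power_le_one)
  then have "(\<lambda>k. exp (- ((norm x)\<^sup>2 + (\<Sum>i\<in>UNIV. ((x $ i / b $ i)\<^sup>2) ^ k / real k)))) \<longlonglongrightarrow> exp (- ((norm x)\<^sup>2 + (\<Sum>i\<in>(UNIV::'n set). 0)))"
    by (intro tendsto_intros)
  then show ?thesis using True by (simp add: box_exponent_def power_mult sum_divide_distrib)
next
  case False
  then obtain i where i: "b $ i < x $ i" by (auto simp: less_eq_vec_def not_le)
  have lim: "filterlim (\<lambda>k. ((x $ i / b $ i)\<^sup>2) ^ k / real k) at_top sequentially"
    using b[of i] i by (intro power_div_nat_tendsto(2)) (auto simp: one_less_power)
  have "((x $ i / b $ i)\<^sup>2) ^ k / real k \<le> box_exponent b k x" for k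
  proof -
    have "((x $ i / b $ i)\<^sup>2) ^ k \<le> (\<Sum>i\<in>UNIV. (x $ i / b $ i) ^ (2 * k))"
      using member_le_sum[of i UNIV "\<lambda>i. (x $ i / b $ i) ^ (2 * k)"] by (simp add: power_mult)
    then have "((x $ i / b $ i)\<^sup>2) ^ k / real k \<le> (\<Sum>i\<in>UNIV. (x $ i / b $ i) ^ (2 * k)) / real k"
      by (intro divide_right_mono) auto
    then show ?thesis by (simp add: box_exponent_def add_increasing)
  qed
  then have "filterlim (\<lambda>k. box_exponent b k x) at_top sequentially"
    by (intro filterlim_at_top_mono[OF lim] always_eventually allI)
  then have "(\<lambda>k. exp (- box_exponent b k x)) \<longlonglongrightarrow> 0"
    by (intro filterlim_compose[OF exp_at_bot] filterlim_uminus_at_bot_at_top[THEN filterlim_compose])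
  then show ?thesis using False by simp
qed

subsection \<open>Uniqueness of the representing function\<close>

lemma AE_zero_of_set_integrals_real:
  fixes f :: "'a \<Rightarrow> real"
  assumes f: "integrable M f" and z: "\<And>A. A \<in> sets M \<Longrightarrow> (\<integral>x. indicator A x *\<^sub>R f x \<partial>M) = 0"
  shows "AE x in M. f x = 0"
proof -
  have [measurable]: "f \<in> borel_measurable M" using f by simp
  \<comment> \<open>Stated for a real multiple so that c = 1 and c = -1 cover the sets where f is
    positive and where it is negative.\<close>
  have nonneg: "AE x in M. indicator {x \<in> space M. 0 < c * f x} x *\<^sub>R (c * f x) = 0" for c :: real
  proof -
    let ?A = "{x \<in> space M. 0 < c * f x}"
    have A: "?A \<in> sets M" by measurable
    have int: "integrable M (\<lambda>x. indicator ?A x *\<^sub>R (c * f x))"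
      using A f by (intro integrable_mult_indicator) auto
    have "(\<integral>x. indicator ?A x *\<^sub>R (c * f x) \<partial>M) = c * (\<integral>x. indicator ?A x *\<^sub>R f x \<partial>M)"
      by (subst integral_mult_right_zero[symmetric]) (simp add: mult_ac)
    then have "(\<integral>x. indicator ?A x *\<^sub>R (c * f x) \<partial>M) = 0" using z[OF A] by simp
    then show ?thesis
      by (subst (asm) integral_nonneg_eq_0_iff_AE[OF int]) (auto simp: indicator_def)
  qed
  show ?thesis using nonneg[of 1] nonneg[of "- 1"] AE_space
  proof eventually_elim
    case (elim x)
    then show ?case by (auto simp: indicator_def split: if_splits)
  qed
qed

lemma AE_zero_of_set_integrals:
  fixes f :: "'a \<Rightarrow> complex"
  assumes f: "integrable M f" and z: "\<And>A. A \<in> sets M \<Longrightarrow> (\<integral>x. indicator A x *\<^sub>R f x \<partial>M) = 0"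
  shows "AE x in M. f x = 0"
proof -
  have i: "integrable M (\<lambda>x. indicator A x *\<^sub>R f x)" if "A \<in> sets M" for A
    using that f by (rule integrable_mult_indicator)
  have "AE x in M. Re (f x) = 0"
  proof (rule AE_zero_of_set_integrals_real)
    show "integrable M (\<lambda>x. Re (f x))" using f by (rule integrable_Re)
    show "(\<integral>x. indicator A x *\<^sub>R Re (f x) \<partial>M) = 0" if A: "A \<in> sets M" for A
      using integral_Re[OF i[OF A]] z[OF A] by simp
  qed
  moreover have "AE x in M. Im (f x) = 0"
  proof (rule AE_zero_of_set_integrals_real)
    show "integrable M (\<lambda>x. Im (f x))" using f by (rule integrable_Im)
    show "(\<integral>x. indicator A x *\<^sub>R Im (f x) \<partial>M) = 0" if A: "A \<in> sets M" for A
      using integral_Im[OF i[OF A]] z[OF A] by simp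
  qed
  ultimately show ?thesis by eventually_elim (simp add: complex_eq_iff)
qed

text \<open>Dynkin's argument: the lower sets are stable under intersection, by taking infima, and
  generate the Borel sets; \<open>total\<close> handles complements. The induction runs over Borel
  sets of the whole space, because a lower set is not contained in the orthant on which
  \<open>mu \<alpha>\<close> lives; measurability is recovered by intersecting with the
  orthant.\<close>

lemma set_integrals_zero_of_lower_sets:
  fixes \<theta> :: "real^'n::finite \<Rightarrow> complex"
  assumes \<theta>: "integrable (mu \<alpha>) \<theta>" and total: "(\<integral>x. \<theta> x \<partial>mu \<alpha>) = 0"
    and low: "\<And>b. (\<integral>x. indicator {..b} x *\<^sub>R \<theta> x \<partial>mu \<alpha>) = 0"
    and B: "B \<in> sets (mu \<alpha>)"
  shows "(\<integral>x. indicator B x *\<^sub>R \<theta> x \<partial>mu \<alpha>) = 0"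
proof -
  let ?G = "range (\<lambda>a::real^'n. {..a})"
  have [measurable]: "\<theta> \<in> borel_measurable (mu \<alpha>)" using \<theta> by simp
  have sm: "A \<inter> pos_orthant \<in> sets (mu \<alpha>)" if "A \<in> sets borel" for A
    using that unfolding sets_mu sets_restrict_space by blast
  have im: "integrable (mu \<alpha>) (\<lambda>x. indicator A x *\<^sub>R \<theta> x)" if "A \<in> sets borel" for A
  proof -
    have "integrable (mu \<alpha>) (\<lambda>x. indicator (A \<inter> pos_orthant) x *\<^sub>R \<theta> x)"
      using sm[OF that] \<theta> by (rule integrable_mult_indicator)
    then show ?thesis
      by (rule Bochner_Integration.integrable_cong[THEN iffD1, rotated 2]) (auto simp: space_mu indicator_def)
  qed
  have eq: "sets borel = sigma_sets UNIV ?G"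
    unfolding borel_eq_atMost[where 'a = "real^'n"] by (simp add: sets_measure_of)
  have stable: "Int_stable ?G"
  proof (rule Int_stableI_image)
    fix a b :: "real^'n"
    show "\<exists>c\<in>UNIV. {..a} \<inter> {..b} = {..c}" by (intro bexI[of _ "inf a b"]) auto
  qed
  have "A \<in> sets borel \<and> (\<integral>x. indicator A x *\<^sub>R \<theta> x \<partial>mu \<alpha>) = 0" if "A \<in> sigma_sets UNIV ?G" for A
    using stable subset_UNIV[of ?G, folded Pow_UNIV] that
  proof (induction rule: sigma_sets_induct_disjoint)
    case (basic A)
    then show ?case using low by auto
  next
    case empty
    show ?case by simp
  next
    case (compl A)
    then have A: "A \<in> sets borel" by blast
    have "(\<integral>x. indicator (UNIV - A) x *\<^sub>R \<theta> x \<partial>mu \<alpha>) = (\<integral>x. \<theta> x - indicator A x *\<^sub>R \<theta> x \<partial>mu \<alpha>)"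
      by (rule Bochner_Integration.integral_cong) (auto simp: indicator_def)
    also have "\<dots> = 0" using total compl by (subst Bochner_Integration.integral_diff[OF \<theta> im[OF A]]) auto
    finally show ?case using A by auto
  next
    case (union A)
    then have A: "\<And>i. A i \<in> sets borel" "\<And>i. (\<integral>x. indicator (A i) x *\<^sub>R \<theta> x \<partial>mu \<alpha>) = 0" by auto
    have I: "(\<integral>x. indicator (C \<inter> pos_orthant) x *\<^sub>R \<theta> x \<partial>mu \<alpha>) = (\<integral>x. indicator C x *\<^sub>R \<theta> x \<partial>mu \<alpha>)" for C
      by (rule Bochner_Integration.integral_cong) (auto simp: space_mu indicator_def)
    have "set_lebesgue_integral (mu \<alpha>) (\<Union>i. A i \<inter> pos_orthant) \<theta> = (\<Sum>i. set_lebesgue_integral (mu \<alpha>) (A i \<inter> pos_orthant) \<theta>)"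
    proof (rule lebesgue_integral_countable_add)
      show "A i \<inter> pos_orthant \<in> sets (mu \<alpha>)" for i by (rule sm[OF A(1)])
      show "(A i \<inter> pos_orthant) \<inter> (A j \<inter> pos_orthant) = {}" if "i \<noteq> j" for i j
        using union(1) that by (auto simp: disjoint_family_on_def)
      have "(\<Union>i. A i \<inter> pos_orthant) \<in> sets (mu \<alpha>)" using sm[OF A(1)] by blast
      then show "set_integrable (mu \<alpha>) (\<Union>i. A i \<inter> pos_orthant) \<theta>"
        unfolding set_integrable_def using \<theta> by (rule integrable_mult_indicator)
    qed
    moreover have "(\<Union>i. A i \<inter> pos_orthant) = (\<Union>i. A i) \<inter> pos_orthant" by blast
    ultimately have "(\<integral>x. indicator (\<Union>i. A i) x *\<^sub>R \<theta> x \<partial>mu \<alpha>) = 0"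
      by (simp add: set_lebesgue_integral_def I A(2))
    then show ?case using A(1) by auto
  qed
  moreover obtain A where "A \<in> sets borel" "B = A \<inter> pos_orthant"
    using B unfolding sets_mu sets_restrict_space by blast
  moreover have "(\<integral>x. indicator (A \<inter> pos_orthant) x *\<^sub>R \<theta> x \<partial>mu \<alpha>) = (\<integral>x. indicator A x *\<^sub>R \<theta> x \<partial>mu \<alpha>)" for A
    by (rule Bochner_Integration.integral_cong) (auto simp: space_mu indicator_def)
  ultimately show ?thesis using eq by metis
qed

text \<open>In place of Hoelder's inequality, |\<psi>| |f| \<le> |f| + C |\<psi>|^p pointwise,
  according to whether |\<psi>| is at most 1 or not. This treats p = 1 and p > 1 alike.\<close>

lemma Lp_mult_schwartz_integrable:
  fixes \<alpha> :: "real^'n::finite"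
  assumes a: "\<forall>i. \<alpha> $ i > - 1 / 2" and p: "1 \<le> p" and \<psi>: "\<psi> \<in> Lp \<alpha> p" and f: "f \<in> schwartz_even"
  shows "integrable (mu \<alpha>) (\<lambda>x. \<psi> x * f x)"
proof -
  have m: "\<psi> \<in> borel_measurable (mu \<alpha>)" and i: "integrable (mu \<alpha>) (\<lambda>x. norm (\<psi> x) powr p)"
    using \<psi> by (auto simp: Lp_def)
  have fm: "f \<in> borel_measurable borel" by (rule schwartz_even_measurable[OF f])
  obtain C where C: "\<And>x. norm (f x) \<le> C" using symbols0_bound[OF schwartz_even_symbols[OF f]] by blast
  have C0: "0 \<le> C" using C norm_ge_zero order_trans by blast
  have fi: "integrable (mu \<alpha>) (\<lambda>x. norm (f x))"
    by (rule schwartz_mult_integrable[OF a f, of _ 1 0]) (use fm in auto)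
  show ?thesis
  proof (rule Bochner_Integration.integrable_bound[OF Bochner_Integration.integrable_add[OF fi integrable_mult_right[OF i, of C]]])
    show "(\<lambda>x. \<psi> x * f x) \<in> borel_measurable (mu \<alpha>)"
      using m measurable_mu_borel[OF fm] by (rule borel_measurable_times)
    show "AE x in mu \<alpha>. norm (\<psi> x * f x) \<le> norm (norm (f x) + C * norm (\<psi> x) powr p)"
    proof (rule AE_I2)
      fix x
      have "norm (\<psi> x) * norm (f x) \<le> norm (f x) + C * norm (\<psi> x) powr p"
      proof (cases "norm (\<psi> x) \<le> 1")
        case True
        then have "norm (\<psi> x) * norm (f x) \<le> 1 * norm (f x)" by (intro mult_right_mono) auto
        moreover have "0 \<le> C * norm (\<psi> x) powr p" using C0 by simp
        ultimately show ?thesis by linarith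
      next
        case False
        then have "norm (\<psi> x) powr 1 \<le> norm (\<psi> x) powr p" using p by (intro powr_mono) auto
        then have "norm (\<psi> x) * norm (f x) \<le> norm (\<psi> x) powr p * C"
          using C False by (intro mult_mono) auto
        then have "norm (\<psi> x) * norm (f x) \<le> C * norm (\<psi> x) powr p" by (simp add: mult.commute)
        then show ?thesis using norm_ge_zero[of "f x"] by linarith
      qed
      then show "norm (\<psi> x * f x) \<le> norm (norm (f x) + C * norm (\<psi> x) powr p)" by (simp add: norm_mult)
    qed
  qed
qed

text \<open>A general L^p function need not be integrable, so the set integrals are taken of \<psi>
  times a Gaussian, which never vanishes. The same product dominates the approximating
  integrands.\<close>

lemma AE_zero_of_schwartz_pairing:
  fixes \<alpha> :: "real^'n::finite"
  assumes a: "\<forall>i. \<alpha> $ i > - 1 / 2" and p: "1 \<le> p" and \<psi>: "\<psi> \<in> Lp \<alpha> p"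
    and z: "\<And>f. f \<in> schwartz_even \<Longrightarrow> (\<integral>x. \<psi> x * f x \<partial>mu \<alpha>) = 0"
  shows "AE x in mu \<alpha>. \<psi> x = 0"
proof -
  define e where "e x = complex_of_real (exp (- (norm x)\<^sup>2))" for x :: "real^'n"
  \<comment> \<open>For \<open>b\<close> = 0 and k = 0 the sum in \<open>box_exponent\<close> is
    divided by \<open>real 0\<close>, which makes it 0 and leaves the plain Gaussian.\<close>
  have e: "e \<in> schwartz_even"
    using schwartz_even_box_function[of "0 :: real^'n" 0] by (simp add: box_exponent_def e_def[abs_def])
  let ?\<theta> = "\<lambda>x. \<psi> x * e x"
  have \<theta>: "integrable (mu \<alpha>) ?\<theta>" by (rule Lp_mult_schwartz_integrable[OF a p \<psi> e])
  have low: "(\<integral>x. indicator {..b} x *\<^sub>R ?\<theta> x \<partial>mu \<alpha>) = 0" for b :: "real^'n"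
  proof (cases "\<forall>i. 0 < b $ i")
    \<comment> \<open>A box whose upper corner has a nonpositive coordinate misses the open
      orthant.\<close>
    case False
    then obtain i where "b $ i \<le> 0" by (auto simp: not_less)
    then have "indicator {..b} x *\<^sub>R ?\<theta> x = 0" if "x \<in> space (mu \<alpha>)" for x
      using that unfolding space_mu pos_orthant_def by (force simp: indicator_def less_eq_vec_def dest: spec[of _ i])
    then have "(\<integral>x. indicator {..b} x *\<^sub>R ?\<theta> x \<partial>mu \<alpha>) = (\<integral>x. 0 \<partial>mu \<alpha>)"
      by (intro Bochner_Integration.integral_cong) auto
    then show ?thesis by simp
  next
    case True
    define E where "E k x = complex_of_real (exp (- box_exponent b k x))" for k x
    have E: "E k \<in> schwartz_even" for k unfolding E_def by (rule schwartz_even_box_function)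
    have "(\<lambda>k. \<integral>x. \<psi> x * E k x \<partial>mu \<alpha>) \<longlonglongrightarrow> (\<integral>x. indicator {..b} x *\<^sub>R ?\<theta> x \<partial>mu \<alpha>)"
    proof (rule integral_dominated_convergence)
      have "{..b} \<inter> pos_orthant \<in> sets (mu \<alpha>)" unfolding sets_mu sets_restrict_space by auto
      then have "integrable (mu \<alpha>) (\<lambda>x. indicator ({..b} \<inter> pos_orthant) x *\<^sub>R ?\<theta> x)"
        using \<theta> by (rule integrable_mult_indicator)
      then have "integrable (mu \<alpha>) (\<lambda>x. indicator {..b} x *\<^sub>R ?\<theta> x)"
        by (rule Bochner_Integration.integrable_cong[THEN iffD1, rotated 2]) (auto simp: space_mu indicator_def)
      then show "(\<lambda>x. indicator {..b} x *\<^sub>R ?\<theta> x) \<in> borel_measurable (mu \<alpha>)" by simp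
      show "(\<lambda>x. \<psi> x * E k x) \<in> borel_measurable (mu \<alpha>)" for k
        using Lp_mult_schwartz_integrable[OF a p \<psi> E] by simp
      show "integrable (mu \<alpha>) (\<lambda>x. norm (?\<theta> x))" using \<theta> by (rule integrable_norm)
      show "AE x in mu \<alpha>. (\<lambda>k. \<psi> x * E k x) \<longlonglongrightarrow> indicator {..b} x *\<^sub>R ?\<theta> x"
      proof (rule AE_I2)
        fix x assume "x \<in> space (mu \<alpha>)"
        then have "\<And>i. 0 < x $ i" by (simp add: space_mu pos_orthant_def)
        then have "(\<lambda>k. \<psi> x * E k x) \<longlonglongrightarrow> \<psi> x * of_real (indicator {..b} x * exp (- (norm x)\<^sup>2))"
          unfolding E_def using True by (intro tendsto_intros box_function_tendsto) auto
        moreover have "\<psi> x * of_real (indicator {..b} x * exp (- (norm x)\<^sup>2)) = indicator {..b} x *\<^sub>R ?\<theta> x"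
          by (simp add: e_def scaleR_conv_of_real)
        ultimately show "(\<lambda>k. \<psi> x * E k x) \<longlonglongrightarrow> indicator {..b} x *\<^sub>R ?\<theta> x" by simp
      qed
      show "AE x in mu \<alpha>. norm (\<psi> x * E k x) \<le> norm (?\<theta> x)" for k
      proof (rule AE_I2)
        fix x
        show "norm (\<psi> x * E k x) \<le> norm (?\<theta> x)"
          unfolding norm_mult E_def e_def using box_exponent_ge[of x b k] by (intro mult_left_mono) auto
      qed
    qed
    then show ?thesis unfolding z[OF E] by (simp add: LIMSEQ_const_iff)
  qed
  have "AE x in mu \<alpha>. ?\<theta> x = 0"
    by (rule AE_zero_of_set_integrals[OF \<theta>]) (rule set_integrals_zero_of_lower_sets[OF \<theta> z[OF e] low])
  then show ?thesis by eventually_elim (simp add: e_def)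
qed

section \<open>Independence of the norm from the representing function\<close>

lemma Lp_diff:
  assumes p: "1 \<le> p" and "\<psi> \<in> Lp \<alpha> p" "\<psi>' \<in> Lp \<alpha> p"
  shows "(\<lambda>x. \<psi> x - \<psi>' x) \<in> Lp \<alpha> p"
proof -
  have [measurable]: "\<psi> \<in> borel_measurable (mu \<alpha>)" "\<psi>' \<in> borel_measurable (mu \<alpha>)"
    and i: "integrable (mu \<alpha>) (\<lambda>x. norm (\<psi> x) powr p)" "integrable (mu \<alpha>) (\<lambda>x. norm (\<psi>' x) powr p)"
    using assms by (auto simp: Lp_def)
  have "integrable (mu \<alpha>) (\<lambda>x. norm (\<psi> x - \<psi>' x) powr p)"
  proof (rule Bochner_Integration.integrable_bound)
    show "integrable (mu \<alpha>) (\<lambda>x. 2 powr p * (norm (\<psi> x) powr p + norm (\<psi>' x) powr p))"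
      using i by simp
    show "AE x in mu \<alpha>. norm (norm (\<psi> x - \<psi>' x) powr p) \<le> norm (2 powr p * (norm (\<psi> x) powr p + norm (\<psi>' x) powr p))"
    proof (rule AE_I2)
      fix x
      let ?m = "max (norm (\<psi> x)) (norm (\<psi>' x))"
      have "norm (\<psi> x - \<psi>' x) \<le> 2 * ?m" using norm_triangle_ineq4[of "\<psi> x" "\<psi>' x"] by simp
      then have "norm (\<psi> x - \<psi>' x) powr p \<le> (2 * ?m) powr p" using p by (intro powr_mono2) auto
      also have "\<dots> = 2 powr p * ?m powr p" by (simp add: powr_mult)
      also have "?m powr p \<le> norm (\<psi> x) powr p + norm (\<psi>' x) powr p" by (simp add: max_def)
      finally show "norm (norm (\<psi> x - \<psi>' x) powr p) \<le> norm (2 powr p * (norm (\<psi> x) powr p + norm (\<psi>' x) powr p))" by simp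
    qed
  qed measurable
  then show ?thesis by (simp add: Lp_def)
qed

lemma dist_of_fun_diff:
  fixes \<alpha> :: "real^'n::finite"
  assumes a: "\<forall>i. \<alpha> $ i > - 1 / 2" and p: "1 \<le> p" and \<psi>: "\<psi> \<in> Lp \<alpha> p" "\<psi>' \<in> Lp \<alpha> p"
  shows "dist_of_fun \<alpha> (\<lambda>x. \<psi> x - \<psi>' x) = dist_of_fun \<alpha> \<psi> - dist_of_fun \<alpha> \<psi>'"
  using Lp_mult_schwartz_integrable[OF a p \<psi>(1)] Lp_mult_schwartz_integrable[OF a p \<psi>(2)]
  by (auto simp: dist_of_fun_def fun_eq_iff left_diff_distrib)

text \<open>Two representing functions differ by an L^p function that pairs to zero with every even
  Schwartz function. After this the choice operator disappears, and the norm may be computed from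
  any explicit representative.\<close>

lemma dist_Lp_norm_eq:
  fixes \<alpha> :: "real^'n::finite"
  assumes a: "\<forall>i. \<alpha> $ i > - 1 / 2" and p: "1 \<le> p" and \<psi>: "\<psi> \<in> Lp \<alpha> p" "dist_of_fun \<alpha> \<psi> = T"
  shows "dist_Lp_norm \<alpha> p T = Lp_norm \<alpha> p \<psi>"
proof -
  define \<psi>' where "\<psi>' = (SOME \<psi>. \<psi> \<in> Lp \<alpha> p \<and> dist_of_fun \<alpha> \<psi> = T)"
  have \<psi>': "\<psi>' \<in> Lp \<alpha> p" "dist_of_fun \<alpha> \<psi>' = T"
    using someI[of "\<lambda>\<psi>. \<psi> \<in> Lp \<alpha> p \<and> dist_of_fun \<alpha> \<psi> = T" \<psi>] \<psi> by (auto simp: \<psi>'_def)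
  have "AE x in mu \<alpha>. \<psi>' x - \<psi> x = 0"
  proof (rule AE_zero_of_schwartz_pairing[OF a p])
    show "(\<lambda>x. \<psi>' x - \<psi> x) \<in> Lp \<alpha> p" by (rule Lp_diff[OF p \<psi>'(1) \<psi>(1)])
    fix f :: "real^'n \<Rightarrow> complex" assume f: "f \<in> schwartz_even"
    have "dist_of_fun \<alpha> (\<lambda>x. \<psi>' x - \<psi> x) f = 0"
      unfolding dist_of_fun_diff[OF a p \<psi>'(1) \<psi>(1)] \<psi>'(2) \<psi>(2) by simp
    then show "(\<integral>x. (\<psi>' x - \<psi> x) * f x \<partial>mu \<alpha>) = 0" using f by (simp add: dist_of_fun_def)
  qed
  then have "AE x in mu \<alpha>. norm (\<psi>' x) powr p = norm (\<psi> x) powr p" by eventually_elim simp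
  then have "(\<integral>x. norm (\<psi>' x) powr p \<partial>mu \<alpha>) = (\<integral>x. norm (\<psi> x) powr p \<partial>mu \<alpha>)"
    using \<psi>(1) \<psi>'(1) by (intro integral_cong_AE) (auto simp: Lp_def intro: borel_measurable_integrable)
  then show ?thesis by (simp add: dist_Lp_norm_def \<psi>'_def[symmetric] Lp_norm_def)
qed

subsection \<open>The spaces E\<close>

lemma tempered_even_diff:
  assumes "T \<in> tempered_even" "S \<in> tempered_even"
  shows "T - S \<in> tempered_even"
  using assms unfolding tempered_even_def
  by (auto simp: algebra_simps fun_diff_def intro: continuous_map_diff)

lemma tempered_even_minus: "T \<in> tempered_even \<Longrightarrow> - T \<in> tempered_even"
  unfolding tempered_even_def by (auto simp: fun_Compl_def)

lemma weighted_transform_diff: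
  "weighted_transform \<alpha> s (T - S) = weighted_transform \<alpha> s T - weighted_transform \<alpha> s S"
  by (auto simp: weighted_transform_def mult_dist_def fourier_bessel_dist_def dual_op_def fun_eq_iff)

text \<open>Passing to the dual reverses the order: on the test function the weight acts first and
  the transform second.\<close>

lemma weighted_transform_apply:
  assumes "\<phi> \<in> schwartz_even"
  shows "weighted_transform \<alpha> s T \<phi> = T (fourier_bessel \<alpha> (\<lambda>x. of_real (jap x powr s) * \<phi> x))"
  using assms schwartz_even_jap_powr_mult[OF assms, of s]
  by (simp add: weighted_transform_def mult_dist_def fourier_bessel_dist_def dual_op_def)

lemma weighted_transform_off: "\<phi> \<notin> schwartz_even \<Longrightarrow> weighted_transform \<alpha> s T \<phi> = 0"
  by (simp add: weighted_transform_def mult_dist_def dual_op_def)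

lemma c_const_nonneg:
  assumes "\<forall>i. \<alpha> $ i > - 1 / 2"
  shows "0 \<le> c_const \<alpha>"
proof -
  have "0 < Gamma (\<alpha> $ i + 1)" for i using assms[rule_format, of i] by (intro Gamma_real_pos) auto
  then show ?thesis unfolding c_const_def by (intro divide_nonneg_nonneg prod_nonneg) (auto intro: less_imp_le)
qed

context
  fixes \<alpha> :: "real^'n::finite"
  assumes a: "\<forall>i. \<alpha> $ i > - 1 / 2"
begin

lemma E_space_diff:
  assumes p: "1 \<le> p" and "T \<in> E_space \<alpha> s p" "S \<in> E_space \<alpha> s p"
  shows "T - S \<in> E_space \<alpha> s p"
proof -
  obtain \<psi> \<psi>' where \<psi>: "\<psi> \<in> Lp \<alpha> p" "dist_of_fun \<alpha> \<psi> = weighted_transform \<alpha> s T"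
    and \<psi>': "\<psi>' \<in> Lp \<alpha> p" "dist_of_fun \<alpha> \<psi>' = weighted_transform \<alpha> s S"
    using assms by (auto simp: E_space_def dist_in_Lp_def)
  have "dist_in_Lp \<alpha> p (weighted_transform \<alpha> s (T - S))"
    unfolding dist_in_Lp_def weighted_transform_diff \<psi>(2)[symmetric] \<psi>'(2)[symmetric]
    using Lp_diff[OF p \<psi>(1) \<psi>'(1)] dist_of_fun_diff[OF a p \<psi>(1) \<psi>'(1)] by blast
  then show ?thesis using assms tempered_even_diff by (auto simp: E_space_def)
qed

text \<open>On the transform side, both embeddings and powers of the operator are multiplications by a
  smooth even symbol with values in \<open>[0, 1]\<close>.\<close>

lemma E_space_multiplier:
  assumes p: "1 \<le> p" and T: "T \<in> E_space \<alpha> t p" and T': "T' \<in> tempered_even"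
    and h: "(\<lambda>x. complex_of_real (h x)) \<in> symbols K" "even_fun (\<lambda>x. complex_of_real (h x))"
    and h01: "\<And>x. 0 \<le> h x" "\<And>x. h x \<le> 1"
    and mult: "\<And>\<phi>. \<phi> \<in> schwartz_even \<Longrightarrow>
       weighted_transform \<alpha> s T' \<phi> = weighted_transform \<alpha> t T (\<lambda>x. of_real (h x) * \<phi> x)"
  shows "T' \<in> E_space \<alpha> s p" "E_norm \<alpha> s p T' \<le> E_norm \<alpha> t p T"
proof -
  obtain \<psi> where \<psi>: "\<psi> \<in> Lp \<alpha> p" "dist_of_fun \<alpha> \<psi> = weighted_transform \<alpha> t T"
    using T by (auto simp: E_space_def dist_in_Lp_def)
  define \<psi>' where "\<psi>' x = of_real (h x) * \<psi> x" for x
  have m: "\<psi> \<in> borel_measurable (mu \<alpha>)" and i: "integrable (mu \<alpha>) (\<lambda>x. norm (\<psi> x) powr p)"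
    using \<psi>(1) by (auto simp: Lp_def)
  have m': "\<psi>' \<in> borel_measurable (mu \<alpha>)"
    unfolding \<psi>'_def
    by (rule borel_measurable_times[OF measurable_mu_borel[OF smooth_fun_measurable[OF symbols_smooth[OF h(1)]]] m])
  have le: "norm (\<psi>' x) powr p \<le> norm (\<psi> x) powr p" for x
  proof (rule powr_mono2)
    show "norm (\<psi>' x) \<le> norm (\<psi> x)"
      using h01[of x] by (simp add: \<psi>'_def norm_mult mult_left_le_one_le)
  qed (use p in auto)
  have i': "integrable (mu \<alpha>) (\<lambda>x. norm (\<psi>' x) powr p)"
    by (rule Bochner_Integration.integrable_bound[OF i]) (use m' le in auto)
  have L: "\<psi>' \<in> Lp \<alpha> p" using m' i' by (simp add: Lp_def)
  have rep: "dist_of_fun \<alpha> \<psi>' = weighted_transform \<alpha> s T'"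
  proof
    fix \<phi> :: "real^'n \<Rightarrow> complex"
    show "dist_of_fun \<alpha> \<psi>' \<phi> = weighted_transform \<alpha> s T' \<phi>"
    proof (cases "\<phi> \<in> schwartz_even")
      case True
      have "dist_of_fun \<alpha> \<psi>' \<phi> = dist_of_fun \<alpha> \<psi> (\<lambda>x. of_real (h x) * \<phi> x)"
        using True schwartz_even_symbol_mult[OF h True] by (simp add: dist_of_fun_def \<psi>'_def mult_ac)
      then show ?thesis using mult[OF True] \<psi>(2) by simp
    next
      case False
      then show ?thesis by (simp add: dist_of_fun_def weighted_transform_off)
    qed
  qed
  show "T' \<in> E_space \<alpha> s p"
    using T' L rep by (auto simp: E_space_def dist_in_Lp_def)
  have "Lp_norm \<alpha> p \<psi>' \<le> Lp_norm \<alpha> p \<psi>"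
    unfolding Lp_norm_def
  proof (rule powr_mono2)
    show "(\<integral>x. norm (\<psi>' x) powr p \<partial>mu \<alpha>) \<le> (\<integral>x. norm (\<psi> x) powr p \<partial>mu \<alpha>)"
      by (rule integral_mono[OF i' i le])
  qed (use p in \<open>auto intro: integral_nonneg_AE\<close>)
  then show "E_norm \<alpha> s p T' \<le> E_norm \<alpha> t p T"
    unfolding E_norm_def dist_Lp_norm_eq[OF a p L rep] dist_Lp_norm_eq[OF a p \<psi>]
    by (intro mult_left_mono c_const_nonneg[OF a])
qed

section \<open>The embeddings and the powers of the operator\<close>

lemma E_space_embedding:
  assumes p: "1 \<le> p" and st: "s \<le> t" and T: "T \<in> E_space \<alpha> t p"
  shows "T \<in> E_space \<alpha> s p" "E_norm \<alpha> s p T \<le> E_norm \<alpha> t p T"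
proof -
  have tm: "T \<in> tempered_even" using T by (simp add: E_space_def)
  have even: "even_fun (\<lambda>x::real^'n. complex_of_real (jap x powr (s - t)))"
    by (rule even_fun_radial[of "\<lambda>r. of_real ((1 + r\<^sup>2) powr (s - t))"])
  have le1: "jap x powr (s - t) \<le> 1" for x :: "real^'n"
    using powr_mono[of "s - t" 0 "jap x"] st by simp
  have mult: "weighted_transform \<alpha> s T \<phi> = weighted_transform \<alpha> t T (\<lambda>x. of_real (jap x powr (s - t)) * \<phi> x)"
    if \<phi>: "\<phi> \<in> schwartz_even" for \<phi>
  proof -
    have "(\<lambda>x. complex_of_real (jap x powr t) * (of_real (jap x powr (s - t)) * \<phi> x)) = (\<lambda>x. of_real (jap x powr s) * \<phi> x)"
      by (simp only: mult.assoc[symmetric] of_real_mult[symmetric] powr_add[symmetric]) simp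
    then show ?thesis
      unfolding weighted_transform_apply[OF \<phi>] weighted_transform_apply[OF schwartz_even_jap_powr_mult[OF \<phi>]] by simp
  qed
  show "T \<in> E_space \<alpha> s p" "E_norm \<alpha> s p T \<le> E_norm \<alpha> t p T"
    using E_space_multiplier[OF p T tm symbols_jap_powr even _ le1 mult] by auto
qed

lemma E_space_neg_laplace:
  assumes p: "1 \<le> p" and T: "T \<in> E_space \<alpha> s p"
  shows "- laplace_dist \<alpha> T \<in> E_space \<alpha> (s - 1) p" "E_norm \<alpha> (s - 1) p (- laplace_dist \<alpha> T) \<le> E_norm \<alpha> s p T"
proof -
  have tm: "T \<in> tempered_even" using T by (simp add: E_space_def)
  define h where "h x = (norm x)\<^sup>2 * jap x powr (- 1)" for x :: "real^'n"
  have hs: "(\<lambda>x. complex_of_real (h x)) \<in> symbols (1 + - 1)"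
    unfolding h_def of_real_mult by (intro symbols_mult symbols_norm2 symbols_jap_powr)
  have he: "even_fun (\<lambda>x. complex_of_real (h x))"
    unfolding h_def by (rule even_fun_radial[of "\<lambda>r. of_real (r\<^sup>2 * (1 + r\<^sup>2) powr (- 1))"])
  have h0: "0 \<le> h x" for x by (simp add: h_def)
  have h1: "h x \<le> 1" for x
    using jap_pos(1)[of x] by (simp add: h_def powr_minus_divide divide_le_eq)
  have mult: "weighted_transform \<alpha> (s - 1) (- laplace_dist \<alpha> T) \<phi> = weighted_transform \<alpha> s T (\<lambda>x. of_real (h x) * \<phi> x)"
    if \<phi>: "\<phi> \<in> schwartz_even" for \<phi>
  proof -
    \<comment> \<open>The test function with the weight of the target space already applied, so that
      the remaining factor |x|^2 comes from the Laplacian alone.\<close>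
    define \<eta> where "\<eta> = (\<lambda>x. of_real (jap x powr (s - 1)) * \<phi> x)"
    have \<eta>: "\<eta> \<in> schwartz_even" unfolding \<eta>_def by (rule schwartz_even_jap_powr_mult[OF \<phi>])
    define g where "g = fourier_bessel \<alpha> (\<lambda>x. of_real ((norm x)\<^sup>2) * \<eta> x)"
    \<comment> \<open>Homogeneity of \<open>T\<close> is known on even Schwartz functions only, so
      the sign can be pulled out once \<open>g\<close> is known to be one.\<close>
    have g: "g \<in> schwartz_even"
      unfolding g_def by (intro fourier_bessel_schwartz_even[OF a] schwartz_even_norm2_mult \<eta>)
    have "weighted_transform \<alpha> (s - 1) (- laplace_dist \<alpha> T) \<phi> = - laplace_dist \<alpha> T (fourier_bessel \<alpha> \<eta>)"
      unfolding weighted_transform_apply[OF \<phi>] \<eta>_def by simp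
    also have "\<dots> = - T (laplace \<alpha> (fourier_bessel \<alpha> \<eta>))"
      using fourier_bessel_schwartz_even[OF a \<eta>] by (simp add: laplace_dist_def dual_op_def)
    also have "laplace \<alpha> (fourier_bessel \<alpha> \<eta>) = (\<lambda>x. (- 1) * g x)"
      unfolding laplace_fourier_bessel[OF a \<eta>] g_def by simp
    also have "T (\<lambda>x. (- 1) * g x) = (- 1) * T g"
      using tm g unfolding tempered_even_def by blast
    also have "- ((- 1) * T g) = T g" by simp
    finally have "weighted_transform \<alpha> (s - 1) (- laplace_dist \<alpha> T) \<phi> = T g" .
    moreover have "(\<lambda>x. of_real ((norm x)\<^sup>2) * \<eta> x) = (\<lambda>x. of_real (jap x powr s) * (of_real (h x) * \<phi> x))"
    proof
      fix x :: "real^'n"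
      have "(norm x)\<^sup>2 * jap x powr (s - 1) = jap x powr s * h x"
        unfolding h_def using powr_add[of "jap x" s "- 1"] by simp
      then have "complex_of_real ((norm x)\<^sup>2) * of_real (jap x powr (s - 1)) = of_real (jap x powr s) * of_real (h x)"
        by (simp only: of_real_mult[symmetric])
      then show "of_real ((norm x)\<^sup>2) * \<eta> x = of_real (jap x powr s) * (of_real (h x) * \<phi> x)"
        unfolding \<eta>_def mult.assoc[symmetric] by simp
    qed
    ultimately show ?thesis
      unfolding weighted_transform_apply[OF schwartz_even_symbol_mult[OF hs he \<phi>]] g_def by (simp only:)
  qed
  show "- laplace_dist \<alpha> T \<in> E_space \<alpha> (s - 1) p" "E_norm \<alpha> (s - 1) p (- laplace_dist \<alpha> T) \<le> E_norm \<alpha> s p T"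
    using E_space_multiplier[OF p T tempered_even_minus[OF laplace_dist_tempered[OF tm]] hs he h0 h1 mult] by auto
qed

lemma neg_laplace_pow_Suc: "neg_laplace_pow \<alpha> (Suc k) T = - laplace_dist \<alpha> (neg_laplace_pow \<alpha> k T)"
  by (simp add: neg_laplace_pow_def)

lemma neg_laplace_pow_diff: "neg_laplace_pow \<alpha> k (T - S) = neg_laplace_pow \<alpha> k T - neg_laplace_pow \<alpha> k S"
proof (induction k)
  case 0
  show ?case by (simp add: neg_laplace_pow_def)
next
  case (Suc k)
  have diff: "laplace_dist \<alpha> (T - S) = laplace_dist \<alpha> T - laplace_dist \<alpha> S" for T S
    by (auto simp: laplace_dist_def dual_op_def fun_eq_iff)
  show ?case unfolding neg_laplace_pow_Suc Suc diff by (simp add: fun_eq_iff)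
qed

lemma E_space_neg_laplace_pow:
  assumes p: "1 \<le> p" and T: "T \<in> E_space \<alpha> s p"
  shows "neg_laplace_pow \<alpha> k T \<in> E_space \<alpha> (s - real k) p \<and>
    E_norm \<alpha> (s - real k) p (neg_laplace_pow \<alpha> k T) \<le> E_norm \<alpha> s p T"
proof (induction k)
  case 0
  show ?case using T by (simp add: neg_laplace_pow_def)
next
  case (Suc k)
  have "s - real (Suc k) = s - real k - 1" by simp
  then show ?case
    unfolding neg_laplace_pow_Suc using E_space_neg_laplace[OF p, of "neg_laplace_pow \<alpha> k T" "s - real k"] Suc
    by (metis order_trans)
qed

lemma continuous_map_E_topology:
  assumes p: "1 \<le> p"
    and A: "\<And>T. T \<in> E_space \<alpha> s p \<Longrightarrow> A T \<in> E_space \<alpha> t p"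
    and lin: "\<And>T S. A (T - S) = A T - A S"
    and le: "\<And>T. T \<in> E_space \<alpha> s p \<Longrightarrow> E_norm \<alpha> t p (A T) \<le> E_norm \<alpha> s p T"
  shows "continuous_map (E_topology \<alpha> s p) (E_topology \<alpha> t p) A"
  unfolding E_topology_def
proof (rule continuous_map_seminorm_topology)
  fix q assume "q \<in> {E_norm \<alpha> t p}"
  then have q: "q = E_norm \<alpha> t p" by simp
  show "\<exists>F C. finite F \<and> F \<subseteq> {E_norm \<alpha> s p} \<and> 0 \<le> C \<and>
      (\<forall>x\<in>E_space \<alpha> s p. \<forall>r\<ge>0. (\<forall>p\<in>F. p x \<le> r) \<longrightarrow> q (A x) \<le> C * r)"
    by (intro exI[of _ "{E_norm \<alpha> s p}"] exI[of _ 1]) (use le order_trans in \<open>auto simp: q\<close>)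
qed (use A lin E_space_diff[OF p] in auto)

end

theorem proposition15:
  fixes \<alpha> :: "real^'n::finite"
  assumes "\<forall>i. \<alpha> $ i > - 1 / 2"
  shows
    "(\<forall>p s t. 1 \<le> p \<and> s \<le> t \<longrightarrow>
        E_space \<alpha> t p \<subseteq> E_space \<alpha> s p \<and>
        (\<forall>T\<in>E_space \<alpha> t p. E_norm \<alpha> s p T \<le> E_norm \<alpha> t p T) \<and>
        continuous_map (E_topology \<alpha> t p) (E_topology \<alpha> s p) (\<lambda>T. T)) \<and>
     (\<forall>s p. 1 \<le> p \<longrightarrow> (\<forall>k::nat.
        neg_laplace_pow \<alpha> k ` E_space \<alpha> s p \<subseteq> E_space \<alpha> (s - real k) p \<and>
        continuous_map (E_topology \<alpha> s p) (E_topology \<alpha> (s - real k) p) (neg_laplace_pow \<alpha> k) \<and>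
        (\<forall>T\<in>E_space \<alpha> s p.
           E_norm \<alpha> (s - real k) p (neg_laplace_pow \<alpha> k T) \<le> E_norm \<alpha> s p T)))"
proof (intro conjI allI impI)
  fix p s t :: real assume "1 \<le> p \<and> s \<le> t"
  then have p: "1 \<le> p" and st: "s \<le> t" by auto
  note emb = E_space_embedding[OF assms p st]
  show "E_space \<alpha> t p \<subseteq> E_space \<alpha> s p" using emb(1) by blast
  show "\<forall>T\<in>E_space \<alpha> t p. E_norm \<alpha> s p T \<le> E_norm \<alpha> t p T" using emb(2) by blast
  show "continuous_map (E_topology \<alpha> t p) (E_topology \<alpha> s p) (\<lambda>T. T)"
    by (rule continuous_map_E_topology[OF assms p]) (auto intro: emb)
next
  fix s p :: real and k :: nat assume p: "1 \<le> p"
  note pow = E_space_neg_laplace_pow[OF assms p]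
  show "neg_laplace_pow \<alpha> k ` E_space \<alpha> s p \<subseteq> E_space \<alpha> (s - real k) p" using pow by blast
  show "\<forall>T\<in>E_space \<alpha> s p. E_norm \<alpha> (s - real k) p (neg_laplace_pow \<alpha> k T) \<le> E_norm \<alpha> s p T"
    using pow by blast
  show "continuous_map (E_topology \<alpha> s p) (E_topology \<alpha> (s - real k) p) (neg_laplace_pow \<alpha> k)"
    by (rule continuous_map_E_topology[OF assms p]) (use pow neg_laplace_pow_diff[OF assms] in auto)
qed

end
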